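(* Let $\alpha,p\in(0,1)$, and let $\{X_n\}$ be the swap-model random walk with parameter $p$ in the moving average environment $\{U_i\}_{i\in\mathbb Z}$ with parameter $\alpha$ (see context). Let $p_{\mathrm{cutoff}}=(1+\sigma_{\mathrm{cutoff}})^{-1}$, with $\sigma_{\mathrm{cutoff}}$ as defined in the context. For $p\in(0,1)$ let $v(p)=N(p)/M(p)$, where $$\begin{aligned}N(p)=&-\alpha^4(1-2p)^2(p-1)p+\alpha^3\Big(1-2p\big((p-2)p(p(2p-5)+6)+4\big)\Big)\\&+\alpha^2(2p-1)\Big(p\big(3p((p-2)p+3)-5\big)+1\Big)-\alpha(1-2p)^2p^2-(p-1)^2p^3(2p-1),\end{aligned}$$ $$\begin{aligned}M(p)=&-2\alpha^5(2p-1)^3-\alpha^4(1-2p)^2\big((p-11)p+6\big)+\alpha^3(2p-1)\big(2p(p^3-9p+10)-5\big)\\&-\alpha^2(p+1)(2p-1)\Big(p\big(p(3p-7)+6\big)-1\Big)+\alpha p^2(2p-1)+(p-1)^2p^3.\end{aligned}$$ Then $p_{\mathrm{cutoff}}>1/2$ if and only if $\alpha>1/2$. Moreover the drift $V=\lim_{n\to\infty}X_n/n$ exists almost surely and is a deterministic constant, and the following hold. (1a) If either $\alpha>1/2$ and $p\in(1/2,p_{\mathrm{cutoff}})$, or $\alpha<1/2$ and $p\in(p_{\mathrm{cutoff}},1/2)$, then almost surely $\lim_{n\to\infty}X_n=\infty$ and $V=v(p)>0$. (1b) If either $\alpha>1/2$ and $p\in(1-p_{\mathrm{cutoff}},1/2)$,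 or $\alpha<1/2$ and $p\in(1/2,1-p_{\mathrm{cutoff}})$, then almost surely $\lim_{n\to\infty}X_n=-\infty$ and $V=-v(1-p)<0$. (2a) If either $\alpha>1/2$ and $p\in[p_{\mathrm{cutoff}},1)$, or $\alpha<1/2$ and $p\in(0,p_{\mathrm{cutoff}}]$, then almost surely $\lim_{n\to\infty}X_n=\infty$, but $V=0$. (2b) If either $\alpha>1/2$ and $p\in(0,1-p_{\mathrm{cutoff}}]$, or $\alpha<1/2$ and $p\in[1-p_{\mathrm{cutoff}},1)$, then almost surely $\lim_{n\to\infty}X_n=-\infty$, but $V=0$. (3) Otherwise (when $\alpha=1/2$ or $p=1/2$ or both), $\{X_n\}$ is recurrent, i.e. almost surely $\liminf_{n\to\infty}X_n=-\infty$ and $\limsup_{n\to\infty}X_n=\infty$, and $V=0$.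
   Context: Swap model: let $\mathbf U=\{U_i\}_{i\in\mathbb Z}$ be a stationary ergodic random environment with $U_i\in\{-1,1\}$, and let $p\in(0,1)$. Given $\mathbf U=\mathbf u$, the process $\{X_n,n=0,1,2,\ldots\}$ is a nearest-neighbour Markov chain on $\mathbb Z$ started from a fixed state $X_0=x_0\in\mathbb Z$, with $\mathbb P(X_{n+1}=i+1\mid X_n=i,\mathbf U=\mathbf u)=p$ if $u_i=1$ and $=1-p$ if $u_i=-1$, and $\mathbb P(X_{n+1}=i-1\mid X_n=i,\mathbf U=\mathbf u)=1-p$ if $u_i=1$ and $=p$ if $u_i=-1$. The environment is sampled once and stays fixed over time; $\mathbb P$ (and "almost surely") refers to the joint law of environment and walk. Moving average environment with parameter $\alpha\in(0,1)$: let $\{\hat U_i\}_{i\in\mathbb Z}$ be iid with $\mathbb P(\hat U_i=1)=\alpha=1-\mathbb P(\hat U_i=-1)$, and let $U_i=1$ if at least two of $\hat U_i,\hat U_{i+1},\hat U_{i+2}$ equal $1$, and $U_i=-1$ otherwise. Definition of $\sigma_{\mathrm{cutoff}}$: for $\alpha\ne1/2$ it is the unique root in $(0,\infty)\setminus\{1\}$ of the function $$\sigma\mapsto-\frac{\alpha(1-\alpha)^2}{\sigma^3}+\frac{\alpha^2(1-\alpha)^2}{\sigma^2}-\frac{(1-\alpha)(1-\alpha+\alpha^2)}{\sigma}+1-2\alpha^2(1-\alpha)^2-\alpha^2(1-\alpha)\sigma^3+\alpha^2(1-\alpha)^2\sigma^2-\alpha(1-\alpha+\alpha^2)\sigma$$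 (existence and uniqueness of this root is part of what is to be shown); for $\alpha=1/2$ put $\sigma_{\mathrm{cutoff}}=1$. Drift: $V$ denotes the almost sure limit $\lim_{n\to\infty}X_n/n$. *)

theory Defs
  imports "HOL-Probability.Probability"
begin

definition swap_trans :: "real \<Rightarrow> (int \<Rightarrow> int) \<Rightarrow> int \<Rightarrow> int \<Rightarrow> real" where
  "swap_trans p u i j =
     (if j = i + 1 then (if u i = 1 then p else 1 - p)
      else if j = i - 1 then (if u i = 1 then 1 - p else p)
      else 0)"

text \<open>The sub-sigma-algebra generated by the whole environment and the walk up to time \<open>n\<close>;
  as all variables take values in the countable type \<open>int\<close>, the level sets generate it.\<close>

definition walk_history ::
  "'a measure \<Rightarrow> (int \<Rightarrow> 'a \<Rightarrow> int) \<Rightarrow> (nat \<Rightarrow> 'a \<Rightarrow> int) \<Rightarrow> nat \<Rightarrow> 'a measure" where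
  "walk_history M U X n = sigma (space M)
     ({{\<omega> \<in> space M. U i \<omega> = a} | i a. True} \<union> {{\<omega> \<in> space M. X k \<omega> = a} | k a. k \<le> n})"

text \<open>Given the environment, \<open>X\<close> is a Markov chain with transition function
  \<open>swap_trans p\<close> started from \<open>x0\<close>. Conditioning on the environment together with the whole past
  of the walk expresses both the transition probabilities and the Markov property under the
  quenched law; \<open>M\<close> carries the joint law of environment and walk.\<close>

definition swap_walk ::
  "'a measure \<Rightarrow> real \<Rightarrow> int \<Rightarrow> (int \<Rightarrow> 'a \<Rightarrow> int) \<Rightarrow> (nat \<Rightarrow> 'a \<Rightarrow> int) \<Rightarrow> bool" where
  "swap_walk M p x0 U X \<longleftrightarrow>
     (\<forall>i. U i \<in> measurable M (count_space UNIV)) \<and>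
     (\<forall>n. X n \<in> measurable M (count_space UNIV)) \<and>
     (AE \<omega> in M. X 0 \<omega> = x0) \<and>
     (\<forall>n j. AE \<omega> in M.
        real_cond_exp M (walk_history M U X n) (indicator {\<omega>' \<in> space M. X (Suc n) \<omega>' = j}) \<omega>
          = swap_trans p (\<lambda>i. U i \<omega>) (X n \<omega>) j)"

definition iid_signs :: "'a measure \<Rightarrow> real \<Rightarrow> (int \<Rightarrow> 'a \<Rightarrow> int) \<Rightarrow> bool" where
  "iid_signs M \<alpha> Uh \<longleftrightarrow>
     prob_space.indep_vars M (\<lambda>_. count_space UNIV) Uh UNIV \<and>
     (\<forall>i. measure M {\<omega> \<in> space M. Uh i \<omega> = 1} = \<alpha> \<and>
          measure M {\<omega> \<in> space M. Uh i \<omega> = -1} = 1 - \<alpha>)"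

definition moving_avg :: "(int \<Rightarrow> 'a \<Rightarrow> int) \<Rightarrow> int \<Rightarrow> 'a \<Rightarrow> int" where
  "moving_avg Uh i \<omega> = (if card {k \<in> {i, i + 1, i + 2}. Uh k \<omega> = 1} \<ge> 2 then 1 else -1)"

definition cutoff_fun :: "real \<Rightarrow> real \<Rightarrow> real" where
  "cutoff_fun \<alpha> \<sigma> =
     - (\<alpha> * (1 - \<alpha>)^2 / \<sigma>^3)
     + \<alpha>^2 * (1 - \<alpha>)^2 / \<sigma>^2
     - (1 - \<alpha>) * (1 - \<alpha> + \<alpha>^2) / \<sigma>
     + 1 - 2 * \<alpha>^2 * (1 - \<alpha>)^2
     - \<alpha>^2 * (1 - \<alpha>) * \<sigma>^3
     + \<alpha>^2 * (1 - \<alpha>)^2 * \<sigma>^2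
     - \<alpha> * (1 - \<alpha> + \<alpha>^2) * \<sigma>"

definition cutoff_root :: "real \<Rightarrow> real \<Rightarrow> bool" where
  "cutoff_root \<alpha> \<sigma> \<longleftrightarrow> \<sigma> \<in> {0<..} - {1} \<and> cutoff_fun \<alpha> \<sigma> = 0"

definition sigma_cutoff :: "real \<Rightarrow> real" where
  "sigma_cutoff \<alpha> = (if \<alpha> = 1/2 then 1 else (THE \<sigma>. cutoff_root \<alpha> \<sigma>))"

definition p_cutoff :: "real \<Rightarrow> real" where
  "p_cutoff \<alpha> = inverse (1 + sigma_cutoff \<alpha>)"

definition drift_num :: "real \<Rightarrow> real \<Rightarrow> real" where
  "drift_num \<alpha> p =
     - (\<alpha>^4 * (1 - 2*p)^2 * (p - 1) * p)
     + \<alpha>^3 * (1 - 2*p * ((p - 2) * p * (p * (2*p - 5) + 6) + 4))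
     + \<alpha>^2 * (2*p - 1) * (p * (3*p * ((p - 2) * p + 3) - 5) + 1)
     - \<alpha> * (1 - 2*p)^2 * p^2
     - (p - 1)^2 * p^3 * (2*p - 1)"

definition drift_den :: "real \<Rightarrow> real \<Rightarrow> real" where
  "drift_den \<alpha> p =
     - (2 * \<alpha>^5 * (2*p - 1)^3)
     - \<alpha>^4 * (1 - 2*p)^2 * ((p - 11) * p + 6)
     + \<alpha>^3 * (2*p - 1) * (2*p * (p^3 - 9*p + 10) - 5)
     - \<alpha>^2 * (p + 1) * (2*p - 1) * (p * (p * (3*p - 7) + 6) - 1)
     + \<alpha> * p^2 * (2*p - 1)
     + (p - 1)^2 * p^3"

definition drift :: "real \<Rightarrow> real \<Rightarrow> real" where
  "drift \<alpha> p = drift_num \<alpha> p / drift_den \<alpha> p"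

definition regime_1a :: "real \<Rightarrow> real \<Rightarrow> bool" where
  "regime_1a \<alpha> p \<longleftrightarrow>
     \<alpha> > 1/2 \<and> p \<in> {1/2<..<p_cutoff \<alpha>} \<or> \<alpha> < 1/2 \<and> p \<in> {p_cutoff \<alpha><..<1/2}"

definition regime_1b :: "real \<Rightarrow> real \<Rightarrow> bool" where
  "regime_1b \<alpha> p \<longleftrightarrow>
     \<alpha> > 1/2 \<and> p \<in> {1 - p_cutoff \<alpha><..<1/2} \<or> \<alpha> < 1/2 \<and> p \<in> {1/2<..<1 - p_cutoff \<alpha>}"

definition regime_2a :: "real \<Rightarrow> real \<Rightarrow> bool" where
  "regime_2a \<alpha> p \<longleftrightarrow>
     \<alpha> > 1/2 \<and> p \<in> {p_cutoff \<alpha>..<1} \<or> \<alpha> < 1/2 \<and> p \<in> {0<..p_cutoff \<alpha>}"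

definition regime_2b :: "real \<Rightarrow> real \<Rightarrow> bool" where
  "regime_2b \<alpha> p \<longleftrightarrow>
     \<alpha> > 1/2 \<and> p \<in> {0<..1 - p_cutoff \<alpha>} \<or> \<alpha> < 1/2 \<and> p \<in> {1 - p_cutoff \<alpha>..<1}"

end

theory Submission
  imports Defs
begin

text \<open>
  With \<open>\<sigma> = (1 - p) / p\<close> and \<open>\<rho> x = \<sigma> powr U x\<close>, everything is governed by the means
  \<open>\<mu> j = E (\<rho> 1 \<cdots> \<rho> j)\<close>. They obey a linear recursion on the four states of a pair of bits, so
  \<open>\<Sum>j. \<mu> j\<close> converges exactly when the determinant of the system, the cutoff function, is positive
  at \<open>\<sigma>\<close>, and then \<open>1 / (2 * (\<Sum>j. \<mu> j) - 1)\<close> is the rational function \<open>drift\<close>. In the variable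
  \<open>ln \<sigma>\<close> the cutoff function is strictly concave, which gives its unique root besides \<open>1\<close> and its sign.

  Upper bounds for the speed come from the cost function \<open>G\<close> whose increment at \<open>x\<close> is the mean crossing
  time of \<open>x\<close> truncated at depth \<open>L\<close>: \<open>G (X n) - n\<close> is a supermartingale with bounded
  increments, so \<open>limsup X n / n \<le> 1 / (1 + 2 * (\<Sum>j=1..L. \<mu> j))\<close> for every \<open>L\<close>. Applied to the walk
  and to its reflection this yields speed \<open>0\<close> whenever both sums diverge. If the sum converges, the
  increments of the walk are stationary under the reweighting by the invariant density of the environment
  seen from the walker, and their mean equals the upper bound; the upper bound is then attained by one half
  of the ergodic theorem. Transience and recurrence follow from the harmonic functions of the walk, and the
  case \<open>\<alpha> = 1/2\<close> uses the symmetry of the bits and Kolmogorov's 0-1 law.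
\<close>

section \<open>The sign of the cutoff function\<close>

text \<open>The moment criterion is sharp for the speed but not for transience: in regime 2 the walk
  escapes although the sum of the means diverges. Every ratio is \<sigma> or its inverse, so writing
  \<sigma> = s powr t raises all products to the power t. For s close enough to 1, on the side where
  the cutoff function is positive, the products are almost surely summable, and t \<ge> 1 carries
  this over to \<sigma>.

  Truncation at depth L keeps the increments of the cost function bounded, so that a Chernoff bound
  applies, and makes them functions of finitely many bits, so that distant windows are independent.
  As every L is allowed, zero and positive speed share one upper bound.

  For the lower bound, the reweighted law has total mass 2 S - 1 with S = \<Sum>j. \<mu> j, and its
  integral of the first step is S - (S - 1) = 1. The weight is at least 1, so both laws have the
  same null sets. Everything about the left direction is the right direction for the walk reflected
  at 0, with 1 - \<alpha> and the same p.\<close>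

lemma cutoff_fun_mirror:
  assumes "s > 0"
  shows "cutoff_fun (1 - a) s = cutoff_fun a (1 / s)"
  unfolding cutoff_fun_def using assms by (simp add: power_divide field_simps) (simp add: power2_eq_square algebra_simps)

lemma cutoff_fun_one: "cutoff_fun a 1 = 0"
  unfolding cutoff_fun_def by (simp add: field_simps) algebra

definition log_cutoff :: "real \<Rightarrow> real \<Rightarrow> real" where
  "log_cutoff a t = cutoff_fun a (exp t)"

definition log_cutoff' :: "real \<Rightarrow> real \<Rightarrow> real" where
  "log_cutoff' a t =
     3 * a * (1 - a)^2 * exp (-3*t) - 2 * a^2 * (1 - a)^2 * exp (-2*t) + (1 - a) * (1 - a + a^2) * exp (-t)
     - 3 * a^2 * (1 - a) * exp (3*t) + 2 * a^2 * (1 - a)^2 * exp (2*t) - a * (1 - a + a^2) * exp t"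

definition log_cutoff'' :: "real \<Rightarrow> real \<Rightarrow> real" where
  "log_cutoff'' a t =
     - 9 * a * (1 - a)^2 * exp (-3*t) + 4 * a^2 * (1 - a)^2 * exp (-2*t) - (1 - a) * (1 - a + a^2) * exp (-t)
     - 9 * a^2 * (1 - a) * exp (3*t) + 4 * a^2 * (1 - a)^2 * exp (2*t) - a * (1 - a + a^2) * exp t"

lemma log_cutoff_eq:
  "log_cutoff a t =
     - (a * (1 - a)^2 * exp (-3*t)) + a^2 * (1 - a)^2 * exp (-2*t) - (1 - a) * (1 - a + a^2) * exp (-t)
     + 1 - 2 * a^2 * (1 - a)^2
     - a^2 * (1 - a) * exp (3*t) + a^2 * (1 - a)^2 * exp (2*t) - a * (1 - a + a^2) * exp t"
proof -
  have "exp (3*t) = exp t ^ 3" "exp (2*t) = exp t ^ 2"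
    by (simp_all flip: exp_of_nat_mult)
  moreover have "exp (-3*t) = 1 / exp t ^ 3" "exp (-2*t) = 1 / exp t ^ 2" "exp (-t) = 1 / exp t"
    by (simp_all add: exp_minus inverse_eq_divide flip: exp_of_nat_mult)
  ultimately show ?thesis
    unfolding log_cutoff_def cutoff_fun_def by simp
qed

lemma log_cutoff_deriv: "(log_cutoff a has_real_derivative log_cutoff' a t) (at t)"
  unfolding log_cutoff_eq[abs_def] log_cutoff'_def
  by (rule derivative_eq_intros refl | simp add: algebra_simps)+

lemma log_cutoff'_deriv: "(log_cutoff' a has_real_derivative log_cutoff'' a t) (at t)"
  unfolding log_cutoff'_def[abs_def] log_cutoff''_def
  by (rule derivative_eq_intros refl | simp add: algebra_simps)+

text \<open>The positive terms in \<open>exp (2*t)\<close> and \<open>exp (-2*t)\<close> of the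
  second derivative have to be beaten. After division by \<open>a * x\<close> the claim is quadratic
  in \<open>x\<close>; completing the square leaves 1 - ab - (4/9) a b^3 with b = 1 - a, which is
  positive because ab \<le> 1/4.\<close>

lemma quartic_term_bound:
  fixes a x :: real
  assumes "0 < a" "a < 1" "x > 0"
  shows "4 * a^2 * (1 - a)^2 * x^2 < 9 * a^2 * (1 - a) * x^3 + a * (1 - a + a^2) * x"
proof -
  define b where "b = 1 - a"
  have b: "0 < b" "b < 1" using assms by (auto simp: b_def)
  have "a * b \<le> 1/4" using zero_le_power2[of "2*a-1"] unfolding b_def
    by (simp add: power2_eq_square algebra_simps)
  moreover have "a * b * b^2 \<le> a * b * 1"
    using assms b by (intro mult_left_mono power_le_one) auto
  moreover have "a * b * (3*x - 2/3*b)^2 \<ge> 0" using assms b by auto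
  ultimately have "a * b * (9*x^2 - 4*b*x) + (1 - a*b) > 0"
    by (simp add: power2_eq_square algebra_simps)
  hence "a * x * (a * b * (9*x^2 - 4*b*x) + (1 - a*b)) > 0" using assms by simp
  moreover have "1 - a*b = 1 - a + a^2" by (simp add: b_def power2_eq_square algebra_simps)
  ultimately show ?thesis unfolding b_def
    by (simp add: power2_eq_square power3_eq_cube algebra_simps)
qed

lemma log_cutoff''_neg:
  assumes "0 < a" "a < 1"
  shows "log_cutoff'' a t < 0"
proof -
  have e: "exp (3*t) = exp t ^ 3" "exp (2*t) = exp t ^ 2"
    by (simp_all flip: exp_of_nat_mult)
  have f: "exp (-3*t) = exp (-t) ^ 3" "exp (-2*t) = exp (-t) ^ 2"
    by (simp_all flip: exp_of_nat_mult)
  have "4 * a^2 * (1 - a)^2 * exp (2*t) < 9 * a^2 * (1 - a) * exp (3*t) + a * (1 - a + a^2) * exp t"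
    using quartic_term_bound[OF assms, of "exp t"] by (simp only: e) simp
  moreover have "4 * a^2 * (1 - a)^2 * exp (-2*t) < 9 * a * (1 - a)^2 * exp (-3*t) + (1 - a) * (1 - a + a^2) * exp (-t)"
    using quartic_term_bound[of "1 - a" "exp (-t)"] assms
    unfolding f by (simp add: algebra_simps power2_eq_square)
  ultimately show ?thesis unfolding log_cutoff''_def by linarith
qed

lemma log_cutoff'_strict_decr:
  assumes "0 < a" "a < 1" "s < t"
  shows "log_cutoff' a t < log_cutoff' a s"
  using DERIV_neg_imp_decreasing[OF assms(3), of "log_cutoff' a"]
    log_cutoff'_deriv log_cutoff''_neg[OF assms(1,2)] by blast

text \<open>Strict concavity as decreasing chord slopes, cleared of denominators so that known zeros
  can be substituted at any of the three points.\<close>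

lemma log_cutoff_slopes:
  assumes "0 < a" "a < 1" "x < y" "y < z"
  shows "(log_cutoff a z - log_cutoff a y) * (y - x) < (log_cutoff a y - log_cutoff a x) * (z - y)"
proof -
  obtain u where u: "x < u" "u < y" "log_cutoff a y - log_cutoff a x = (y - x) * log_cutoff' a u"
    using MVT2[OF assms(3), of "log_cutoff a"] log_cutoff_deriv by blast
  obtain v where v: "y < v" "v < z" "log_cutoff a z - log_cutoff a y = (z - y) * log_cutoff' a v"
    using MVT2[OF assms(4), of "log_cutoff a"] log_cutoff_deriv by blast
  have "log_cutoff' a v < log_cutoff' a u"
    using u v by (intro log_cutoff'_strict_decr assms) auto
  hence "(z - y) * (y - x) * log_cutoff' a v < (z - y) * (y - x) * log_cutoff' a u"
    using assms by (intro mult_strict_left_mono) auto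
  thus ?thesis unfolding u(3) v(3) by (simp only: mult_ac)
qed

lemma log_cutoff'_zero: "log_cutoff' a 0 = (1 + 2 * a * (1 - a)) * (1 - 2 * a)"
  unfolding log_cutoff'_def by (simp add: power2_eq_square algebra_simps)

lemma log_cutoff_zero: "log_cutoff a 0 = 0"
  by (simp add: log_cutoff_def cutoff_fun_one)

text \<open>Supplies the negative value that the intermediate value theorem needs to the left of 1,
  and at the same time places the root above \<open>1 - a\<close>, which later makes a coefficient
  of the linear system positive.\<close>

lemma cutoff_fun_at_compl:
  assumes "0 < a" "a < 1"
  shows "cutoff_fun a (1 - a) < 0"
proof -
  define b where "b = 1 - a"
  have b: "0 < b" "b < 1" "a = 1 - b" using assms by (auto simp: b_def)
  have "a * b^2 / b^3 = a / b" "a^2 * b^2 / b^2 = a^2" "b * (b + a^2) / b = b + a^2"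
    using b by (simp_all add: power2_eq_square power3_eq_cube)
  hence "cutoff_fun a b = - (a / b) + a^2 - (b + a^2) + 1 - 2 * a^2 * b^2 - a^2 * b * b^3
      + a^2 * b^2 * b^2 - a * (b + a^2) * b"
    unfolding cutoff_fun_def b_def by (simp only: diff_add_eq diff_diff_eq2)
  also have "- (b + a^2) + 1 - 2 * a^2 * b^2 - a^2 * b * b^3 + a^2 * b^2 * b^2 - a * (b + a^2) * b = - (a^2 * b^2)"
    unfolding b_def by algebra
  hence "- (a / b) + a^2 - (b + a^2) + 1 - 2 * a^2 * b^2 - a^2 * b * b^3
      + a^2 * b^2 * b^2 - a * (b + a^2) * b = - (a^2 * b^2) + a^2 - a / b" by linarith
  finally have "cutoff_fun a b = - (a^2 * b^2) + a^2 - a / b" .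
  moreover have "a^2 < a / b" 
  proof -
    have "a^2 < a" using assms by (simp add: power2_eq_square)
    also have "a \<le> a / b" using b assms by (simp add: field_simps)
    finally show ?thesis .
  qed
  moreover have "a^2 * b^2 \<ge> 0" by simp
  ultimately show ?thesis unfolding b_def by linarith
qed

text \<open>In the variable t = ln s the slope at 0 is negative, so the function is positive just
  left of 0, while it is negative at \<open>ln (1 - a)\<close>. This gives a root \<open>z\<close>
  in between, and strict concavity fixes the sign on the intervals cut out by \<open>z\<close> and
  0.\<close>

lemma cutoff_sign_gt:
  assumes "1/2 < a" "a < 1"
  shows "\<exists>c>1 - a. c < 1 \<and> (\<forall>s>0. cutoff_fun a s = 0 \<longleftrightarrow> s = c \<or> s = 1)
    \<and> (\<forall>s>0. cutoff_fun a s > 0 \<longleftrightarrow> c < s \<and> s < 1)"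
proof -
  have a: "0 < a" using assms by simp
  have d0: "log_cutoff' a 0 < 0" unfolding log_cutoff'_zero
    using assms by (intro mult_pos_neg add_pos_nonneg) auto
  define l where "l = ln (1 - a)"
  have l: "l < 0" "exp l = 1 - a" using assms by (auto simp: l_def)
  have gl: "log_cutoff a l < 0" using cutoff_fun_at_compl[OF a assms(2)] l by (simp add: log_cutoff_def)
  obtain d where d: "d > 0" "\<And>h. h > 0 \<Longrightarrow> h < d \<Longrightarrow> log_cutoff a 0 < log_cutoff a (0 - h)"
    using DERIV_neg_dec_left[OF log_cutoff_deriv d0] by blast
  define e where "e = min (d/2) (-l/2)"
  have e: "e > 0" "e < d" "l < -e" using d l by (auto simp: e_def min_def)
  have ge: "log_cutoff a (-e) > 0" using d(2)[OF e(1,2)] by (simp add: log_cutoff_zero)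
  have cont: "continuous_on A (log_cutoff a)" for A
    by (intro continuous_at_imp_continuous_on ballI DERIV_isCont[OF log_cutoff_deriv])
  obtain z where z: "l \<le> z" "z \<le> -e" "log_cutoff a z = 0"
    using IVT'[of "log_cutoff a" l 0 "-e"] gl ge e cont by force
  have zl: "l < z" using z gl by (cases "l = z") auto
  have z0: "z < 0" using z e by simp
  have P: "log_cutoff a t > 0" if "z < t" "t < 0" for t
  proof -
    have "- log_cutoff a t * (t - z) < log_cutoff a t * (0 - t)"
      using log_cutoff_slopes[OF a assms(2) that] by (simp add: z log_cutoff_zero)
    hence "0 < log_cutoff a t * (- z)" by (simp add: algebra_simps)
    thus ?thesis using z0 by (simp add: mult_less_0_iff)
  qed
  have N: "log_cutoff a t < 0" if "t < z" for t
  proof -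
    have "0 < (- log_cutoff a t) * (0 - z)"
      using log_cutoff_slopes[OF a assms(2) that z0] by (simp add: z log_cutoff_zero)
    thus ?thesis using z0 by (simp add: zero_less_mult_iff mult_less_0_iff not_less)
  qed
  have N2: "log_cutoff a t < 0" if "0 < t" for t
  proof -
    have "log_cutoff a t * (0 - z) < 0"
      using log_cutoff_slopes[OF a assms(2) z0 that] by (simp add: z log_cutoff_zero)
    thus ?thesis using z0 by (simp add: zero_less_mult_iff mult_less_0_iff not_less)
  qed
  have ln: "cutoff_fun a s = log_cutoff a (ln s)" if "s > 0" for s
    using that by (simp add: log_cutoff_def)
  have pos: "cutoff_fun a s > 0" if "exp z < s" "s < 1" for s
  proof -
    have "s > 0" using that(1) exp_gt_zero[of z] by linarith
    thus ?thesis using that P[of "ln s"] ln by (metis exp_less_cancel_iff exp_ln ln_less_zero)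
  qed
  have neg: "cutoff_fun a s < 0" if "0 < s" "s < exp z" for s
    using that N[of "ln s"] ln by (metis exp_less_cancel_iff exp_ln)
  have neg': "cutoff_fun a s < 0" if "1 < s" for s
    using that N2[of "ln s"] ln by simp
  have z': "1 - a < exp z" "exp z < 1" using zl l z0 by (metis exp_less_mono, simp)
  have root: "cutoff_fun a (exp z) = 0" using z by (simp add: log_cutoff_def)
  have tri: "0 < s \<and> s < exp z \<or> s = exp z \<or> exp z < s \<and> s < 1 \<or> s = 1 \<or> 1 < s" if "s > 0" for s
    using that by linarith
  have "cutoff_fun a s = 0 \<longleftrightarrow> s = exp z \<or> s = 1" "cutoff_fun a s > 0 \<longleftrightarrow> exp z < s \<and> s < 1" if "s > 0" for s
    using tri[OF that] pos[of s] neg[of s] neg'[of s] root cutoff_fun_one[of a] z'(2) by auto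
  thus ?thesis using z' by blast
qed

text \<open>In the symmetric case the slope at t = 0 vanishes, so by strict concavity 0 is the
  strict maximum.\<close>

lemma cutoff_sign_half:
  assumes "s > 0" "s \<noteq> 1"
  shows "cutoff_fun (1/2) s < 0"
proof -
  have a: "0 < (1/2::real)" "(1/2::real) < 1" by auto
  have d0: "log_cutoff' (1/2) 0 = 0" by (simp add: log_cutoff'_zero)
  have "log_cutoff (1/2) t < 0" if "t \<noteq> 0" for t
  proof (cases "t > 0")
    case True
    then obtain v where v: "0 < v" "v < t" "log_cutoff (1/2) t - log_cutoff (1/2) 0 = (t - 0) * log_cutoff' (1/2) v"
      using MVT2[of 0 t "log_cutoff (1/2)"] log_cutoff_deriv by blast
    show ?thesis using log_cutoff'_strict_decr[OF a v(1)] v d0 True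
      by (auto simp: log_cutoff_zero mult_less_0_iff)
  next
    case False
    with that have "t < 0" by auto
    then obtain v where v: "t < v" "v < 0" "log_cutoff (1/2) 0 - log_cutoff (1/2) t = (0 - t) * log_cutoff' (1/2) v"
      using MVT2[of t 0 "log_cutoff (1/2)"] log_cutoff_deriv by blast
    have "t * log_cutoff' (1/2) v < 0"
      using log_cutoff'_strict_decr[OF a v(2)] d0 \<open>t < 0\<close> by (simp add: mult_less_0_iff)
    thus ?thesis using v by (simp add: log_cutoff_zero)
  qed
  from this[of "ln s"] assms show ?thesis by (simp add: log_cutoff_def)
qed

text \<open>The mirror image of the case above 1/2 under s -> 1/s; \<open>a * c < 1\<close> is the
  lower bound of the mirrored root seen through the reciprocal.\<close>

lemma cutoff_sign_lt:
  assumes "0 < a" "a < 1/2"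
  shows "\<exists>c>1. a * c < 1 \<and> (\<forall>s>0. cutoff_fun a s = 0 \<longleftrightarrow> s = c \<or> s = 1)
    \<and> (\<forall>s>0. cutoff_fun a s > 0 \<longleftrightarrow> 1 < s \<and> s < c)"
proof -
  have "1/2 < 1 - a" "1 - a < 1" using assms by auto
  then obtain c where c: "1 - (1 - a) < c" "c < 1"
    "\<forall>s>0. cutoff_fun (1 - a) s = 0 \<longleftrightarrow> s = c \<or> s = 1"
    "\<forall>s>0. cutoff_fun (1 - a) s > 0 \<longleftrightarrow> c < s \<and> s < 1"
    using cutoff_sign_gt by blast
  have c0: "c > 0" using c(1) assms by simp
  have m: "cutoff_fun a s = cutoff_fun (1 - a) (1 / s)" if "s > 0" for s
    using cutoff_fun_mirror[of "1/s" a] that by simp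
  have "cutoff_fun a s = 0 \<longleftrightarrow> s = 1/c \<or> s = 1" "cutoff_fun a s > 0 \<longleftrightarrow> 1 < s \<and> s < 1/c" if "s > 0" for s
    using c(3,4)[rule_format, of "1/s"] that c0 m[OF that] by (auto simp: field_simps)
  moreover have "1 < 1/c" "a * (1/c) < 1" using c(1,2) c0 by simp_all
  ultimately show ?thesis by blast
qed

lemma sigma_cutoff_eqI:
  assumes "a \<noteq> 1/2" "c > 0" "c \<noteq> 1" "\<forall>s>0. cutoff_fun a s = 0 \<longleftrightarrow> s = c \<or> s = 1"
  shows "sigma_cutoff a = c" "\<exists>!s. cutoff_root a s"
proof -
  have "cutoff_root a = (\<lambda>s. s = c)"
    unfolding cutoff_root_def using assms by auto
  thus "sigma_cutoff a = c" "\<exists>!s. cutoff_root a s"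
    unfolding sigma_cutoff_def using assms(1) by simp_all
qed

lemma sigma_cutoff_gt:
  assumes "1/2 < a" "a < 1"
  shows "\<exists>!s. cutoff_root a s" "1 - a < sigma_cutoff a" "sigma_cutoff a < 1"
    "\<forall>s>0. cutoff_fun a s > 0 \<longleftrightarrow> sigma_cutoff a < s \<and> s < 1"
proof -
  obtain c where c: "1 - a < c" "c < 1"
    "\<forall>s>0. cutoff_fun a s = 0 \<longleftrightarrow> s = c \<or> s = 1"
    "\<forall>s>0. cutoff_fun a s > 0 \<longleftrightarrow> c < s \<and> s < 1"
    using cutoff_sign_gt[OF assms] by blast
  have *: "a \<noteq> 1/2" "c > 0" "c \<noteq> 1" using assms c(1,2) by auto
  show "\<exists>!s. cutoff_root a s" "1 - a < sigma_cutoff a" "sigma_cutoff a < 1"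
    "\<forall>s>0. cutoff_fun a s > 0 \<longleftrightarrow> sigma_cutoff a < s \<and> s < 1"
    using sigma_cutoff_eqI[OF * c(3)] c(1,2,4) by simp_all
qed

lemma sigma_cutoff_lt:
  assumes "0 < a" "a < 1/2"
  shows "\<exists>!s. cutoff_root a s" "1 < sigma_cutoff a" "a * sigma_cutoff a < 1"
    "\<forall>s>0. cutoff_fun a s > 0 \<longleftrightarrow> 1 < s \<and> s < sigma_cutoff a"
proof -
  obtain c where c: "1 < c" "a * c < 1"
    "\<forall>s>0. cutoff_fun a s = 0 \<longleftrightarrow> s = c \<or> s = 1"
    "\<forall>s>0. cutoff_fun a s > 0 \<longleftrightarrow> 1 < s \<and> s < c"
    using cutoff_sign_lt[OF assms] by blast
  have *: "a \<noteq> 1/2" "c > 0" "c \<noteq> 1" using assms c(1,2) by auto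
  show "\<exists>!s. cutoff_root a s" "1 < sigma_cutoff a" "a * sigma_cutoff a < 1"
    "\<forall>s>0. cutoff_fun a s > 0 \<longleftrightarrow> 1 < s \<and> s < sigma_cutoff a"
    using sigma_cutoff_eqI[OF * c(3)] c(1,2,4) by simp_all
qed

lemma cutoff_fun_half_le:
  assumes "s > 0" shows "cutoff_fun (1/2) s \<le> 0"
  using cutoff_sign_half[OF assms] by (cases "s = 1") (simp_all add: cutoff_fun_one)

text \<open>These inequalities are the conditions \<open>A > 0\<close> and \<open>B > 0\<close> of
  the linear system below: continuing a run of equal bits must multiply the mean product by less
  than 1.\<close>

lemma cutoff_fun_pos_imp:
  assumes "0 < a" "a < 1" "0 < s" "cutoff_fun a s > 0"
  shows "a * s < 1" "1 - a < s"
proof -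
  consider "a > 1/2" | "a = 1/2" | "a < 1/2" by linarith
  hence "a * s < 1 \<and> 1 - a < s"
  proof cases
    case 1
    have "sigma_cutoff a < s" "s < 1" using sigma_cutoff_gt(4)[OF 1 assms(2)] assms(3) assms(4) by auto
    with sigma_cutoff_gt(2)[OF 1 assms(2)] have "1 - a < s" "s < 1" by auto
    moreover have "a * s \<le> 1 * s" using assms by (intro mult_right_mono) auto
    ultimately show ?thesis by linarith
  next
    case 2
    thus ?thesis using cutoff_fun_half_le[OF assms(3)] assms(4) by (metis not_le)
  next
    case 3
    have *: "1 < s" "s < sigma_cutoff a" "a * sigma_cutoff a < 1"
      using sigma_cutoff_lt(4)[OF assms(1) 3] assms(3) sigma_cutoff_lt(3)[OF assms(1) 3] assms(4) by auto
    hence "a * s < a * sigma_cutoff a" using assms by (intro mult_strict_left_mono) auto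
    with * have "a * s < 1" by (meson less_trans)
    with * assms show ?thesis by auto
  qed
  thus "a * s < 1" "1 - a < s" by auto
qed

section \<open>The linear system for the mean crossing times\<close>

definition maj :: "bool \<Rightarrow> bool \<Rightarrow> bool \<Rightarrow> bool" where
  "maj x y z \<longleftrightarrow> x \<and> y \<or> x \<and> z \<or> y \<and> z"

definition maj_ratio :: "real \<Rightarrow> bool \<Rightarrow> bool \<Rightarrow> bool \<Rightarrow> real" where
  "maj_ratio s x y z = (if maj x y z then s else 1 / s)"

text \<open>The mean of the product of the first \<open>j\<close> ratios, given that the first two bits are \<open>x\<close> and \<open>y\<close>.\<close>

primrec prod_mean_from :: "real \<Rightarrow> real \<Rightarrow> nat \<Rightarrow> bool \<Rightarrow> bool \<Rightarrow> real" where
  "prod_mean_from a s 0 x y = 1"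
| "prod_mean_from a s (Suc j) x y =
     a * maj_ratio s x y True * prod_mean_from a s j y True
     + (1 - a) * maj_ratio s x y False * prod_mean_from a s j y False"

definition pair_mean :: "real \<Rightarrow> (bool \<Rightarrow> bool \<Rightarrow> real) \<Rightarrow> real" where
  "pair_mean a f = a^2 * f True True + a * (1 - a) * (f True False + f False True) + (1 - a)^2 * f False False"

definition prod_mean :: "real \<Rightarrow> real \<Rightarrow> nat \<Rightarrow> real" where
  "prod_mean a s j = pair_mean a (prod_mean_from a s j)"

text \<open>First-step operator: iterated from 0 it produces the partial sums of
  \<open>prod_mean_from\<close> over \<open>j\<close>, so the full sums, if finite, are a fixed
  point.\<close>

definition trap_step :: "real \<Rightarrow> real \<Rightarrow> (bool \<Rightarrow> bool \<Rightarrow> real) \<Rightarrow> bool \<Rightarrow> bool \<Rightarrow> real" where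
  "trap_step a s f x y = 1 + a * maj_ratio s x y True * f y True + (1 - a) * maj_ratio s x y False * f y False"

lemma trap_step_iff:
  "(\<forall>x y. f x y = trap_step a s f x y) \<longleftrightarrow>
     f True True = 1 + a * s * f True True + (1 - a) * s * f True False \<and>
     f True False = 1 + a * s * f False True + (1 - a) / s * f False False \<and>
     f False True = 1 + a * s * f True True + (1 - a) / s * f True False \<and>
     f False False = 1 + a / s * f False True + (1 - a) / s * f False False"
  unfolding trap_step_def maj_ratio_def maj_def by (simp add: all_bool_eq conj_ac)

text \<open>Coefficients of the fixed point system with denominators cleared:
  \<open>A = p * (1 - a * s)\<close> and \<open>B = q * (1 - b / s)\<close> belong to the two states
  with equal bits, whose equations refer to themselves. Eliminating these states leaves
  \<open>p * q * B * f True False = C1 + D1 * f False True\<close> and the companion equation with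
  \<open>A\<close>, \<open>C2\<close>, \<open>D2\<close>.\<close>

context
  fixes a p q b s A B C1 C2 D1 D2 :: real
  assumes p: "0 < p" "p < 1" and a: "0 < a" "a < 1"
  defines "q \<equiv> 1 - p" and "b \<equiv> 1 - a"
  defines "s \<equiv> q / p"
  defines "A \<equiv> p - q * a" and "B \<equiv> q - p * b"
  defines "C1 \<equiv> p * q * B + b * p^2 * q" and "D1 \<equiv> a * q^2 * B + a * b * p^3"
  defines "C2 \<equiv> p * q * A + a * q^2 * p" and "D2 \<equiv> a * b * q^3 + b * p^2 * A"
begin

text \<open>The determinant of the two equations left after the elimination; this is the origin of
  the polynomial \<open>drift_num\<close>.\<close>

lemma drift_num_eq: "drift_num a p = p^2 * q^2 * A * B - D1 * D2"
  unfolding drift_num_def D1_def D2_def A_def B_def q_def b_def by algebra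

text \<open>Up to a positive factor the cutoff function is the same determinant, so its sign decides
  whether a positive solution exists.\<close>

lemma drift_num_eq_cutoff: "drift_num a p = p^3 * q^3 * cutoff_fun a s"
proof -
  have q: "q > 0" using p by (simp add: q_def)
  have "p^3 * q^3 * cutoff_fun a s = - (a * b^2 * p^6) + a^2 * b^2 * p^5 * q - b * (b + a^2) * p^4 * q^2
     + (1 - 2 * a^2 * b^2) * p^3 * q^3 - a^2 * b * q^6 + a^2 * b^2 * p * q^5 - a * (b + a^2) * p^2 * q^4"
    unfolding cutoff_fun_def s_def b_def using p q
    by (simp add: power_divide divide_simps) (simp add: algebra_simps power_numeral_reduce)
  also have "\<dots> = drift_num a p"
    unfolding drift_num_def q_def b_def by algebra
  finally show ?thesis by simp
qed

text \<open>The polynomial identity behind the closed form of the speed: after division by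
  \<open>A * B * drift_num a p\<close> the bracket on the right is \<open>pair_mean\<close> of the
  solution given by Cramer's rule.\<close>

lemma drift_den_eq:
  "A * B * (drift_den a p + drift_num a p) =
    2 * (a^2 * B * (p * drift_num a p + q * b * (C1 * p * q * A + D1 * C2))
       + a * b * A * B * ((C1 * p * q * A + D1 * C2) + (C2 * p * q * B + D2 * C1))
       + b^2 * A * (q * drift_num a p + p * a * (C2 * p * q * B + D2 * C1)))"
  unfolding drift_num_def drift_den_def C1_def C2_def D1_def D2_def A_def B_def q_def b_def by algebra

text \<open>Elimination followed by Cramer's rule, stated without division so that it can be used
  while the signs of \<open>A\<close>, \<open>B\<close> and the determinant are still
  unknown.\<close>

lemma trap_step_solution:
  assumes f: "\<forall>x y. f x y = trap_step a s f x y"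
  shows "A * f True True = p + q * b * f True False"
    "B * f False False = q + p * a * f False True"
    "drift_num a p * f True False = C1 * p * q * A + D1 * C2"
    "drift_num a p * f False True = C2 * p * q * B + D2 * C1"
proof -
  have q: "q > 0" using p by (simp add: q_def)
  define t where "t = 1 / s"
  have st: "p * s = q" "q * t = p" using p q by (simp_all add: s_def t_def)
  have bt: "1 - a = b" "b / s = b * t" "a / s = a * t" by (simp_all add: t_def b_def)
  have e': "f True True = 1 + a * s * f True True + b * s * f True False \<and>
      f True False = 1 + a * s * f False True + b * t * f False False \<and>
      f False True = 1 + a * s * f True True + b * t * f True False \<and>
      f False False = 1 + a * t * f False True + b * t * f False False"
    using f[unfolded trap_step_iff] unfolding bt by blast
  note e = e'[THEN conjunct1] e'[THEN conjunct2, THEN conjunct1]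
    e'[THEN conjunct2, THEN conjunct2, THEN conjunct1] e'[THEN conjunct2, THEN conjunct2, THEN conjunct2]
  have "p * f True True = p * (1 + a * s * f True True + b * s * f True False)" by (rule arg_cong[OF e(1)])
  also have "\<dots> = p + a * (p * s) * f True True + b * (p * s) * f True False" by (simp only: algebra_simps)
  finally show 1: "A * f True True = p + q * b * f True False" unfolding st A_def by (simp add: algebra_simps)
  have "q * f False False = q * (1 + a * t * f False True + b * t * f False False)" by (rule arg_cong[OF e(4)])
  also have "\<dots> = q + a * (q * t) * f False True + b * (q * t) * f False False" by (simp only: algebra_simps)
  finally show 2: "B * f False False = q + p * a * f False True" unfolding st B_def by (simp add: algebra_simps)
  have "p * q * B * f True False = p * q * B * (1 + a * s * f False True + b * t * f False False)" by (rule arg_cong[OF e(2)])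
  also have "\<dots> = p * q * B + a * q * (p * s) * B * f False True + b * p * (q * t) * (B * f False False)"
    by (simp only: algebra_simps)
  also have "\<dots> = C1 + D1 * f False True" unfolding st 2 C1_def D1_def
    by (simp add: algebra_simps power2_eq_square power3_eq_cube)
  finally have 3: "p * q * B * f True False = C1 + D1 * f False True" .
  have "p * q * A * f False True = p * q * A * (1 + a * s * f True True + b * t * f True False)" by (rule arg_cong[OF e(3)])
  also have "\<dots> = p * q * A + a * q * (p * s) * (A * f True True) + b * p * (q * t) * A * f True False"
    by (simp only: algebra_simps)
  also have "\<dots> = C2 + D2 * f True False" unfolding st 1 C2_def D2_def
    by (simp add: algebra_simps power2_eq_square power3_eq_cube)
  finally have 4: "p * q * A * f False True = C2 + D2 * f True False" .
  have "drift_num a p * f True False = p * q * A * (p * q * B * f True False) - D1 * (D2 * f True False)"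
    unfolding drift_num_eq by (simp add: algebra_simps power2_eq_square)
  also have "\<dots> = p * q * A * C1 + D1 * (p * q * A * f False True) - D1 * (D2 * f True False)"
    unfolding 3 by (simp only: algebra_simps)
  also have "\<dots> = C1 * p * q * A + D1 * C2" unfolding 4 by (simp add: algebra_simps)
  finally show "drift_num a p * f True False = C1 * p * q * A + D1 * C2" .
  have "drift_num a p * f False True = p * q * B * (p * q * A * f False True) - D2 * (D1 * f False True)"
    unfolding drift_num_eq by (simp add: algebra_simps power2_eq_square)
  also have "\<dots> = p * q * B * C2 + D2 * (p * q * B * f True False) - D2 * (D1 * f False True)"
    unfolding 4 by (simp only: algebra_simps)
  also have "\<dots> = C2 * p * q * B + D2 * C1" unfolding 3 by (simp add: algebra_simps)
  finally show "drift_num a p * f False True = C2 * p * q * B + D2 * C1" .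
qed

lemma trap_coeffs_pos:
  assumes "A > 0" "B > 0"
  shows "C1 * p * q * A + D1 * C2 > 0" "C2 * p * q * B + D2 * C1 > 0"
proof -
  have "q > 0" "b > 0" using p a by (auto simp: q_def b_def)
  with assms p a have "C1 > 0" "C2 > 0" "D1 > 0" "D2 > 0"
    unfolding C1_def C2_def D1_def D2_def by (auto intro!: add_pos_pos mult_pos_pos)
  with assms \<open>q > 0\<close> p show "C1 * p * q * A + D1 * C2 > 0" "C2 * p * q * B + D2 * C1 > 0"
    by (auto intro!: add_pos_pos mult_pos_pos)
qed

text \<open>Positivity propagates through the elimination: each of \<open>A\<close>,
  \<open>B\<close> and finally the determinant times a positive unknown equals a positive
  number.\<close>

lemma trap_step_pos_imp:
  assumes f: "\<forall>x y. f x y = trap_step a s f x y" and pos: "\<And>x y. f x y > 0"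
  shows "cutoff_fun a s > 0"
proof -
  have q: "q > 0" "b > 0" using p a by (auto simp: q_def b_def)
  note e = trap_step_solution[OF f]
  have "A * f True True > 0" unfolding e using p q pos by (intro add_pos_pos mult_pos_pos) auto
  hence A: "A > 0" using pos by (rule zero_less_mult_pos2)
  have "B * f False False > 0" unfolding e using p a q pos by (intro add_pos_pos mult_pos_pos) auto
  hence B: "B > 0" using pos by (rule zero_less_mult_pos2)
  have "drift_num a p * f True False > 0" unfolding e using trap_coeffs_pos[OF A B] by simp
  hence "drift_num a p > 0" using pos by (rule zero_less_mult_pos2)
  moreover have "p^3 * q^3 > 0" using p q by simp
  ultimately show ?thesis unfolding drift_num_eq_cutoff by (rule zero_less_mult_pos)
qed

lemma trap_step_exists:
  assumes "cutoff_fun a s > 0"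
  obtains f where "\<forall>x y. f x y = trap_step a s f x y" "\<And>x y. f x y > 0"
proof -
  have q: "q > 0" "b > 0" using p a by (auto simp: q_def b_def)
  have s: "s > 0" using p q by (simp add: s_def)
  have A: "A > 0" using cutoff_fun_pos_imp(1)[OF a s assms] p by (simp add: s_def A_def field_simps)
  have B: "B > 0" using cutoff_fun_pos_imp(2)[OF a s assms] p by (simp add: s_def B_def b_def field_simps)
  have N: "drift_num a p > 0" unfolding drift_num_eq_cutoff using p q assms by simp
  define f10 where "f10 = (C1 * p * q * A + D1 * C2) / drift_num a p"
  define f01 where "f01 = (C2 * p * q * B + D2 * C1) / drift_num a p"
  define f11 where "f11 = (p + q * b * f10) / A"
  define f00 where "f00 = (q + p * a * f01) / B"
  define f where "f x y = (if x then if y then f11 else f10 else if y then f01 else f00)" for x y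
  have "f10 > 0" "f01 > 0" unfolding f10_def f01_def using trap_coeffs_pos[OF A B] N by auto
  moreover from this have "f11 > 0" "f00 > 0" unfolding f11_def f00_def using p a q A B
    by (auto intro!: divide_pos_pos add_pos_pos mult_pos_pos)
  ultimately have pos: "f x y > 0" for x y by (simp add: f_def)
  have 1: "A * f11 = p + q * b * f10" using A by (simp add: f11_def)
  have 2: "B * f00 = q + p * a * f01" using B by (simp add: f00_def)
  have 5: "drift_num a p * f10 = C1 * p * q * A + D1 * C2"
    "drift_num a p * f01 = C2 * p * q * B + D2 * C1" using N by (simp_all add: f10_def f01_def)
  \<comment> \<open>The reduced equations are checked after multiplication by the determinant, which
    turns the quotients \<open>f10\<close> and \<open>f01\<close> into polynomials.\<close>
  have "drift_num a p * (C1 + D1 * f01) = drift_num a p * C1 + D1 * (drift_num a p * f01)"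
    by (simp only: algebra_simps)
  also have "\<dots> = p * q * B * (C1 * p * q * A + D1 * C2)" unfolding 5
    unfolding drift_num_eq by (simp add: algebra_simps power2_eq_square)
  also have "\<dots> = drift_num a p * (p * q * B * f10)" unfolding 5[symmetric] by (simp only: mult_ac)
  finally have 3: "p * q * B * f10 = C1 + D1 * f01" using N by simp
  have "drift_num a p * (C2 + D2 * f10) = drift_num a p * C2 + D2 * (drift_num a p * f10)"
    by (simp only: algebra_simps)
  also have "\<dots> = p * q * A * (C2 * p * q * B + D2 * C1)" unfolding 5
    unfolding drift_num_eq by (simp add: algebra_simps power2_eq_square)
  also have "\<dots> = drift_num a p * (p * q * A * f01)" unfolding 5[symmetric] by (simp only: mult_ac)
  finally have 4: "p * q * A * f01 = C2 + D2 * f10" using N by simp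
  define t where "t = 1 / s"
  have st: "p * s = q" "q * t = p" using p q by (simp_all add: s_def t_def)
  have bt: "1 - a = b" "b / s = b * t" "a / s = a * t" by (simp_all add: t_def b_def)
  have cancel: "x = y" if "c * x = c * y" "c > 0" for c x y :: real using that by simp
  have "p * (1 + a * s * f11 + b * s * f10) = p + a * (p * s) * f11 + b * (p * s) * f10"
    by (simp only: algebra_simps)
  also have "\<dots> = p * f11" using 1 unfolding st A_def by algebra
  finally have g1: "f11 = 1 + a * s * f11 + b * s * f10" by (rule cancel[OF sym]) (rule p(1))
  have "q * (1 + a * t * f01 + b * t * f00) = q + a * (q * t) * f01 + b * (q * t) * f00"
    by (simp only: algebra_simps)
  also have "\<dots> = q * f00" using 2 unfolding st B_def by algebra
  finally have g4: "f00 = 1 + a * t * f01 + b * t * f00" by (rule cancel[OF sym]) (rule q(1))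
  have "p * q * B * (1 + a * s * f01 + b * t * f00)
      = p * q * B + a * q * (p * s) * B * f01 + b * p * (q * t) * (B * f00)" by (simp only: algebra_simps)
  also have "\<dots> = C1 + D1 * f01" unfolding st 2 C1_def D1_def
    by (simp add: algebra_simps power2_eq_square power3_eq_cube)
  also note 3[symmetric]
  finally have g2: "f10 = 1 + a * s * f01 + b * t * f00"
    by (rule cancel[OF sym]) (intro mult_pos_pos p(1) q(1) B)
  have "p * q * A * (1 + a * s * f11 + b * t * f10)
      = p * q * A + a * q * (p * s) * (A * f11) + b * p * (q * t) * A * f10" by (simp only: algebra_simps)
  also have "\<dots> = C2 + D2 * f10" unfolding st 1 C2_def D2_def
    by (simp add: algebra_simps power2_eq_square power3_eq_cube)
  also note 4[symmetric]
  finally have g3: "f01 = 1 + a * s * f11 + b * t * f10"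
    by (rule cancel[OF sym]) (intro mult_pos_pos p(1) q(1) A)
  have "\<forall>x y. f x y = trap_step a s f x y"
    unfolding trap_step_iff bt f_def if_True if_False using g1 g2 g3 g4 by blast
  with pos show ?thesis using that by blast
qed

lemma pair_mean_solution:
  assumes f: "\<forall>x y. f x y = trap_step a s f x y" and F: "cutoff_fun a s > 0"
  shows "2 * pair_mean a f - 1 = 1 / drift a p"
proof -
  have q: "q > 0" "b > 0" using p a by (auto simp: q_def b_def)
  have s: "s > 0" using p q by (simp add: s_def)
  have A: "A > 0" using cutoff_fun_pos_imp(1)[OF a s F] p by (simp add: s_def A_def field_simps)
  have B: "B > 0" using cutoff_fun_pos_imp(2)[OF a s F] p by (simp add: s_def B_def b_def field_simps)
  have N: "drift_num a p > 0" unfolding drift_num_eq_cutoff using p q F by simp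
  note e = trap_step_solution[OF f]
  have "A * B * (drift_den a p + drift_num a p) =
    2 * (a^2 * B * (p * drift_num a p + q * b * (drift_num a p * f True False))
       + a * b * A * B * (drift_num a p * f True False + drift_num a p * f False True)
       + b^2 * A * (q * drift_num a p + p * a * (drift_num a p * f False True)))"
    unfolding e(3,4) by (rule drift_den_eq)
  also have "\<dots> = 2 * drift_num a p * (a^2 * B * (p + q * b * f True False)
      + a * b * A * B * (f True False + f False True) + b^2 * A * (q + p * a * f False True))"
    by (simp only: algebra_simps)
  also have "\<dots> = A * B * (2 * (pair_mean a f * drift_num a p))"
    unfolding e(1,2)[symmetric] pair_mean_def b_def[symmetric] by (simp only: algebra_simps)
  finally have "A * B * (drift_den a p + drift_num a p) = A * B * (2 * (pair_mean a f * drift_num a p))" .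
  hence *: "drift_den a p + drift_num a p = 2 * (pair_mean a f * drift_num a p)" using A B by simp
  hence **: "2 * pair_mean a f - 1 = drift_den a p / drift_num a p" using N by (simp add: field_simps)
  thus "2 * pair_mean a f - 1 = 1 / drift a p" by (simp add: drift_def)
qed

end

section \<open>Summability of the mean products\<close>

lemma prod_mean_from_nonneg:
  assumes "0 < a" "a < 1" "0 < s"
  shows "prod_mean_from a s j x y \<ge> 0"
proof (induction j arbitrary: x y)
  case (Suc j)
  show ?case using assms by (auto intro!: add_nonneg_nonneg mult_nonneg_nonneg Suc divide_nonneg_pos simp: maj_ratio_def)
qed auto

lemma prod_mean_nonneg:
  assumes "0 < a" "a < 1" "0 < s"
  shows "prod_mean a s j \<ge> 0"
  unfolding prod_mean_def pair_mean_def using assms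
  by (intro add_nonneg_nonneg mult_nonneg_nonneg prod_mean_from_nonneg) auto

lemma prod_mean_0: "prod_mean a s 0 = 1"
  by (simp add: prod_mean_def pair_mean_def power2_eq_square algebra_simps)

lemma sum_prod_mean_from_Suc:
  "(\<Sum>j<Suc n. prod_mean_from a s j x y) = trap_step a s (\<lambda>x y. \<Sum>j<n. prod_mean_from a s j x y) x y"
  unfolding sum.lessThan_Suc_shift trap_step_def by (simp add: sum.distrib sum_distrib_left)

text \<open>Finite sums form a positive fixed point of \<open>trap_step\<close>, which forces a
  positive determinant. Conversely a positive determinant gives a positive fixed point, and this
  dominates all partial sums.\<close>

lemma prod_mean_summable_iff:
  assumes a: "0 < a" "a < 1" and p: "0 < p" "p < 1"
  shows "summable (prod_mean a ((1 - p) / p)) \<longleftrightarrow> cutoff_fun a ((1 - p) / p) > 0"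
    and "cutoff_fun a ((1 - p) / p) > 0 \<Longrightarrow>
      2 * (\<Sum>j. prod_mean a ((1 - p) / p) j) - 1 = 1 / drift a p \<and> drift a p > 0"
proof -
  define s where "s = (1 - p) / p"
  have s: "s > 0" using p by (simp add: s_def)
  define w where "w j x y = prod_mean_from a s j x y" for j x y
  have w: "w j x y \<ge> 0" for j x y using prod_mean_from_nonneg[OF a s] by (simp add: w_def)
  have fixpt: "\<forall>x y. (\<Sum>j. w j x y) = trap_step a s (\<lambda>x y. \<Sum>j. w j x y) x y"
    if sm: "\<And>x y. summable (\<lambda>j. w j x y)"
  proof (intro allI)
    fix x y
    have "(\<lambda>n. \<Sum>j<Suc n. w j x y) \<longlonglongrightarrow> trap_step a s (\<lambda>x y. \<Sum>j. w j x y) x y"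
      unfolding w_def sum_prod_mean_from_Suc trap_step_def
      by (intro tendsto_intros summable_LIMSEQ sm[unfolded w_def])
    moreover have "(\<lambda>n. \<Sum>j<Suc n. w j x y) \<longlonglongrightarrow> (\<Sum>j. w j x y)"
      by (intro LIMSEQ_Suc summable_LIMSEQ sm)
    ultimately show "(\<Sum>j. w j x y) = trap_step a s (\<lambda>x y. \<Sum>j. w j x y) x y"
      using LIMSEQ_unique by blast
  qed
  have ge1: "(\<Sum>j. w j x y) \<ge> 1" if "\<And>x y. summable (\<lambda>j. w j x y)" for x y
    using sum_le_suminf[OF that, of "{0}" x y] w by (simp add: w_def)
  have sm1: "summable (\<lambda>j. w j x y)" if sm: "summable (prod_mean a s)" for x y
  proof -
    \<comment> \<open>The least probability of a pair of bits: the averaged mean controls each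
      conditional mean up to this factor.\<close>
    define m where "m = min (a * a) (min (a * (1 - a)) ((1 - a) * (1 - a)))"
    have m: "m > 0" using a by (simp add: m_def)
    have "m * w j x y \<le> prod_mean a s j" for j
    proof -
      have "m * w j x y \<le> (if x then if y then a*a else a*(1-a) else if y then a*(1-a) else (1-a)*(1-a)) * w j x y"
        unfolding m_def using w by (intro mult_right_mono) auto
      also have "\<dots> \<le> a*a * w j True True + a*(1-a) * w j True False + a*(1-a) * w j False True
          + (1-a)*(1-a) * w j False False"
      proof -
        have "a*a * w j True True \<ge> 0" "a*(1-a) * w j True False \<ge> 0" "a*(1-a) * w j False True \<ge> 0"
          "(1-a)*(1-a) * w j False False \<ge> 0" using a w by simp_all
        thus ?thesis by (cases x; cases y; fastforce)
      qed
      also have "\<dots> = prod_mean a s j"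
        unfolding prod_mean_def pair_mean_def w_def[symmetric] by (simp add: power2_eq_square algebra_simps)
      finally show ?thesis .
    qed
    hence "summable (\<lambda>j. m * w j x y)"
      using w m by (intro summable_comparison_test_ev[OF _ sm]) auto
    thus ?thesis using m by (simp add: summable_cmult_iff)
  qed
  have sm2: "summable (\<lambda>j. w j x y)" if F: "cutoff_fun a s > 0" for x y
  proof -
    obtain f where f: "\<forall>x y. f x y = trap_step a s f x y" "\<And>x y. f x y > 0"
      using trap_step_exists[OF p a] F unfolding s_def by blast
    \<comment> \<open>\<open>trap_step\<close> is monotone and \<open>f\<close> is a nonnegative
      fixed point, so the iterates started at 0 stay below \<open>f\<close>.\<close>
    have "(\<Sum>j<n. w j x y) \<le> f x y" for n x y
    proof (induction n arbitrary: x y)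
      case 0 thus ?case using f(2) by (simp add: less_imp_le)
    next
      case (Suc n)
      have "(\<Sum>j<Suc n. w j x y) \<le> trap_step a s f x y"
        unfolding w_def sum_prod_mean_from_Suc trap_step_def using a s
        by (intro add_mono mult_left_mono Suc[unfolded w_def] mult_nonneg_nonneg) (auto simp: maj_ratio_def)
      also have "\<dots> = f x y" by (rule f(1)[rule_format, symmetric])
      finally show ?case .
    qed
    thus ?thesis using w by (intro summableI_nonneg_bounded)
  qed
  have "cutoff_fun a s > 0" if "summable (prod_mean a s)"
  proof -
    have "(\<Sum>j. w j x y) > 0" for x y using ge1[OF sm1[OF that], of x y] by simp
    thus ?thesis using trap_step_pos_imp[OF p a fixpt[OF sm1[OF that], unfolded s_def]] by (simp add: s_def)
  qed
  moreover have sums: "prod_mean a s sums pair_mean a (\<lambda>x y. \<Sum>j. w j x y)" if "cutoff_fun a s > 0"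
    unfolding prod_mean_def pair_mean_def w_def[symmetric]
    by (intro sums_add sums_mult summable_sums sm2 that)
  ultimately show "summable (prod_mean a ((1 - p) / p)) \<longleftrightarrow> cutoff_fun a ((1 - p) / p) > 0"
    unfolding s_def[symmetric] using sums_summable by blast
  assume F: "cutoff_fun a ((1 - p) / p) > 0"
  note F' = F[folded s_def]
  have e: "2 * (\<Sum>j. prod_mean a s j) - 1 = 1 / drift a p"
    using pair_mean_solution(1)[OF p a fixpt[OF sm2[OF F'], unfolded s_def] F] sums[OF F']
    by (simp add: sums_iff s_def)
  have "(\<Sum>j. prod_mean a s j) \<ge> 1"
    using sum_le_suminf[OF sums_summable[OF sums[OF F']], of "{0}"] prod_mean_nonneg[OF a s]
    by (simp add: prod_mean_0)
  hence "1 / drift a p > 0" using e by linarith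
  with e show "2 * (\<Sum>j. prod_mean a ((1 - p) / p) j) - 1 = 1 / drift a p \<and> drift a p > 0"
    by (simp add: s_def)
qed

section \<open>A half of the ergodic theorem\<close>

definition orbit_sum :: "('a \<Rightarrow> 'a) \<Rightarrow> ('a \<Rightarrow> real) \<Rightarrow> nat \<Rightarrow> 'a \<Rightarrow> real" where
  "orbit_sum T g n x = (\<Sum>i<n. g ((T ^^ i) x))"

lemma orbit_sum_0 [simp]: "orbit_sum T g 0 x = 0"
  by (simp add: orbit_sum_def)

lemma orbit_sum_add: "orbit_sum T g (m + n) x = orbit_sum T g m x + orbit_sum T g n ((T ^^ m) x)"
  by (induction n) (auto simp: orbit_sum_def add.commute[of m] funpow_add)

lemma orbit_sum_Suc: "orbit_sum T g (Suc n) x = g x + orbit_sum T g n (T x)"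
  using orbit_sum_add[of T g 1 n x] by (simp add: orbit_sum_def)

text \<open>The orbit is cut greedily: from a point outside \<open>N\<close> a block of length at
  most \<open>K\<close> with average at most \<open>w\<close> is taken, from a point of
  \<open>N\<close> a single step, which costs at most
  \<open>1 \<le> w + (1 + \<bar>w\<bar>)\<close>. The last, incomplete block is shorter than
  \<open>K\<close> and is paid for by the term with \<open>K\<close>.\<close>

lemma orbit_sum_block_bound:
  fixes w :: real
  assumes g: "\<And>x. \<bar>g x\<bar> \<le> 1"
    and good: "\<And>x. x \<in> B \<Longrightarrow> x \<notin> N \<Longrightarrow> \<exists>n\<in>{1..K}. orbit_sum T g n x \<le> n * w"
    and inv: "\<And>x. x \<in> B \<Longrightarrow> T x \<in> B" and x: "x \<in> B"
  shows "orbit_sum T g n x \<le> n * w + (1 + \<bar>w\<bar>) * K + (1 + \<bar>w\<bar>) * orbit_sum T (indicator N) n x"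
  using x
proof (induction n arbitrary: x rule: less_induct)
  case (less n)
  have invn: "(T ^^ m) y \<in> B" if "y \<in> B" for m y using that by (induction m) (auto intro: inv)
  have nonneg: "0 \<le> orbit_sum T (indicator N) m y" for m y
    unfolding orbit_sum_def by (intro sum_nonneg) auto
  have absw: "0 \<le> (1 + \<bar>w\<bar>) * orbit_sum T (indicator N) m y" for m y
    using nonneg[of m y] by (intro mult_nonneg_nonneg) auto
  show ?case
  proof (cases "x \<in> N")
    case True
    show ?thesis
    proof (cases n)
      case (Suc m)
      have "orbit_sum T g n x \<le> 1 + (m * w + (1 + \<bar>w\<bar>) * K + (1 + \<bar>w\<bar>) * orbit_sum T (indicator N) m (T x))"
        using less.IH[of m "T x"] inv[OF less.prems] g[of x] Suc by (simp add: orbit_sum_Suc)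
      also have "\<dots> \<le> (w + (1 + \<bar>w\<bar>)) + (m * w + (1 + \<bar>w\<bar>) * K + (1 + \<bar>w\<bar>) * orbit_sum T (indicator N) m (T x))"
        by simp
      also have "\<dots> = n * w + (1 + \<bar>w\<bar>) * K + (1 + \<bar>w\<bar>) * orbit_sum T (indicator N) n x"
        using True Suc by (simp add: orbit_sum_Suc algebra_simps)
      finally show ?thesis .
    qed simp
  next
    case False
    then obtain m where m: "m \<ge> 1" "m \<le> K" "orbit_sum T g m x \<le> m * w"
      using good[OF less.prems] by auto
    show ?thesis
    proof (cases "m \<le> n")
      case True
      define k where "k = n - m"
      have n: "n = m + k" "k < n" using True m by (auto simp: k_def)
      have "orbit_sum T g n x \<le> m * w + (k * w + (1 + \<bar>w\<bar>) * K + (1 + \<bar>w\<bar>) * orbit_sum T (indicator N) k ((T ^^ m) x))"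
        unfolding n(1) orbit_sum_add using m(3) less.IH[OF n(2) invn[OF less.prems, of m]] by simp
      also have "\<dots> \<le> n * w + (1 + \<bar>w\<bar>) * K + (1 + \<bar>w\<bar>) * orbit_sum T (indicator N) n x"
        unfolding n(1) orbit_sum_add using absw[of m x] by (simp add: algebra_simps)
      finally show ?thesis .
    next
      case False
      have "orbit_sum T g n x \<le> (\<Sum>i<n. 1)"
        unfolding orbit_sum_def using g by (intro sum_mono) (auto simp: abs_le_iff)
      also have "\<dots> = real n * 1" by simp
      also have "\<dots> \<le> real n * (w + (1 + \<bar>w\<bar>))" by (intro mult_left_mono) auto
      also have "\<dots> = n * w + (1 + \<bar>w\<bar>) * n" by (simp add: algebra_simps)
      also have "(1 + \<bar>w\<bar>) * n \<le> (1 + \<bar>w\<bar>) * K" using False m by (intro mult_left_mono) auto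
      finally show ?thesis using absw[of n x] by simp
    qed
  qed
qed

locale bounded_observable = finite_measure P for P :: "'a measure" +
  fixes T :: "'a \<Rightarrow> 'a" and g :: "'a \<Rightarrow> real"
  assumes T [measurable]: "T \<in> measurable P P" and pres: "distr P P T = P"
    and g_meas [measurable]: "g \<in> borel_measurable P" and g_bound: "\<And>x. \<bar>g x\<bar> \<le> 1"
begin

lemma funpow_measurable [measurable]: "(T ^^ i) \<in> measurable P P"
proof (induction i)
  case (Suc i)
  have "T \<circ> (T ^^ i) \<in> measurable P P" using Suc T by (rule measurable_comp)
  thus ?case by (simp add: comp_def)
qed (simp add: id_def)

lemma orbit_sum_measurable:
  assumes [measurable]: "h \<in> borel_measurable P"
  shows "orbit_sum T h n \<in> borel_measurable P"
  unfolding orbit_sum_def[abs_def] by measurable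

lemma orbit_g_measurable [measurable]: "orbit_sum T g n \<in> borel_measurable P"
  by (rule orbit_sum_measurable) measurable

lemma integral_funpow:
  fixes h :: "'a \<Rightarrow> real"
  assumes [measurable]: "h \<in> borel_measurable P"
  shows "(\<integral>x. h ((T ^^ i) x) \<partial>P) = (\<integral>x. h x \<partial>P)"
proof (induction i)
  case (Suc i)
  have "(\<integral>x. h ((T ^^ i) x) \<partial>P) = (\<integral>x. h ((T ^^ i) x) \<partial>(distr P P T))" by (simp add: pres)
  also have "\<dots> = (\<integral>x. h ((T ^^ i) (T x)) \<partial>P)"
    by (rule integral_distr) measurable
  finally show ?case using Suc by (simp add: funpow_swap1)
qed simp

lemma integrable_bounded:
  fixes h :: "'a \<Rightarrow> real" and c :: real
  assumes "h \<in> borel_measurable P" "\<And>x. \<bar>h x\<bar> \<le> c"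
  shows "integrable P h"
  using assms by (intro integrable_const_bound[where B = c]) auto

lemma integral_orbit_sum:
  fixes h :: "'a \<Rightarrow> real" and c :: real
  assumes [measurable]: "h \<in> borel_measurable P" and bd: "\<And>x. \<bar>h x\<bar> \<le> c"
  shows "(\<integral>x. orbit_sum T h n x \<partial>P) = n * (\<integral>x. h x \<partial>P)" "integrable P (orbit_sum T h n)"
proof -
  have *: "integrable P (\<lambda>x. h ((T ^^ i) x))" for i
    by (rule integrable_bounded[where c = c]) (auto simp: bd)
  thus "integrable P (orbit_sum T h n)" unfolding orbit_sum_def[abs_def] by simp
  show "(\<integral>x. orbit_sum T h n x \<partial>P) = n * (\<integral>x. h x \<partial>P)"
    unfolding orbit_sum_def by (subst Bochner_Integration.integral_sum) (auto simp: * integral_funpow)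
qed

text \<open>The block bound is integrated over \<open>B\<close> and divided by \<open>n\<close>: the
  boundary term vanishes as n grows, leaving an error proportional to the measure of the points
  whose good block is longer than \<open>K\<close>. These sets decrease to a null set.\<close>

lemma integral_le_invariant:
  fixes w :: real
  assumes B [measurable]: "B \<in> sets P"
    and inv: "\<And>x. x \<in> space P \<Longrightarrow> T x \<in> B \<longleftrightarrow> x \<in> B"
    and ev: "AE x in P. x \<in> B \<longrightarrow> (\<exists>n\<ge>1. orbit_sum T g n x \<le> n * w)"
  shows "(\<integral>x. indicator B x * g x \<partial>P) \<le> w * measure P B"
proof -
  define N where "N K = {x \<in> space P. x \<in> B \<and> (\<forall>n\<in>{1..K}. \<not> orbit_sum T g n x \<le> n * w)}" for K :: nat
  have N [measurable]: "N K \<in> sets P" for K unfolding N_def by measurable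
  define I where "I = (\<integral>x. indicator B x * g x \<partial>P)"
  have BP: "B \<subseteq> space P" using sets.sets_into_space[OF B] .
  have bound: "I - w * measure P B \<le> (1 + \<bar>w\<bar>) * measure P (N K)" for K
  proof (rule ccontr)
    assume *: "\<not> ?thesis"
    define d where "d = I - w * measure P B - (1 + \<bar>w\<bar>) * measure P (N K)"
    have d: "d > 0" using * by (simp add: d_def)
    define h where "h x = indicator B x * g x" for x
    have [measurable]: "h \<in> borel_measurable P" unfolding h_def[abs_def] by measurable
    have hb: "\<bar>h x\<bar> \<le> 1" for x using g_bound[of x] by (auto simp: h_def indicator_def)
    have invn: "(T ^^ i) x \<in> B \<longleftrightarrow> x \<in> B" if "x \<in> space P" for i x
    proof (induction i)
      case (Suc i)
      have "(T ^^ i) x \<in> space P" using measurable_space[OF funpow_measurable that] .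
      thus ?case using Suc inv by simp
    qed simp
    \<comment> \<open>The right side is independent of \<open>n\<close>, so a positive defect
      \<open>d\<close> contradicts the Archimedean property.\<close>
    have "n * d \<le> (1 + \<bar>w\<bar>) * K * measure P B" for n :: nat
    proof -
      have hs: "orbit_sum T h n x = indicator B x * orbit_sum T g n x" if "x \<in> space P" for x
        unfolding orbit_sum_def h_def using invn[OF that] by (simp add: indicator_def sum_distrib_left)
      have le: "orbit_sum T h n x \<le> indicator B x * (n * w + (1 + \<bar>w\<bar>) * K) + (1 + \<bar>w\<bar>) * orbit_sum T (indicator (N K)) n x"
        if x: "x \<in> space P" for x
      proof (cases "x \<in> B")
        case True
        have "orbit_sum T g n x \<le> n * w + (1 + \<bar>w\<bar>) * K + (1 + \<bar>w\<bar>) * orbit_sum T (indicator (N K)) n x"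
          by (rule orbit_sum_block_bound[where B = B])
             (use True g_bound inv BP in \<open>auto simp: N_def subset_iff\<close>)
        thus ?thesis using True hs[OF x] by simp
      next
        case False
        have "0 \<le> orbit_sum T (indicator (N K)) n x" unfolding orbit_sum_def by (intro sum_nonneg) auto
        thus ?thesis using False hs[OF x] by simp
      qed
      have [simp]: "integrable P (orbit_sum T (indicator (N K)) n)" "integrable P (orbit_sum T h n)"
        by (rule integral_orbit_sum(2)[where c = 1]; auto simp: hb)+
      have [simp]: "integrable P (indicat_real B)"
        by (rule integrable_bounded[where c = 1]) auto
      have "n * I = (\<integral>x. orbit_sum T h n x \<partial>P)"
        unfolding I_def h_def[symmetric] by (rule integral_orbit_sum(1)[symmetric, where c = 1]) (auto simp: hb)
      also have "\<dots> \<le> (\<integral>x. indicator B x * (n * w + (1 + \<bar>w\<bar>) * K) + (1 + \<bar>w\<bar>) * orbit_sum T (indicator (N K)) n x \<partial>P)"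
        by (intro integral_mono le Bochner_Integration.integrable_add integrable_mult_right integrable_mult_left) auto
      also have "\<dots> = measure P B * (n * w + (1 + \<bar>w\<bar>) * K) + (1 + \<bar>w\<bar>) * (\<integral>x. orbit_sum T (indicator (N K)) n x \<partial>P)"
        using BP by (subst Bochner_Integration.integral_add)
          (auto simp: Int_absorb2 intro!: integrable_mult_right integrable_mult_left)
      also have "(\<integral>x. orbit_sum T (indicator (N K)) n x \<partial>P) = n * measure P (N K)"
        by (subst integral_orbit_sum(1)[where c = 1]) (auto simp: N_def intro!: arg_cong[where f = "measure P"])
      finally show ?thesis unfolding d_def by (simp add: algebra_simps)
    qed
    moreover obtain n :: nat where "n * d > (1 + \<bar>w\<bar>) * K * measure P B"
      using reals_Archimedean3[OF d] by blast
    ultimately show False by (meson not_less)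
  qed
  have "(\<lambda>K. measure P (N K)) \<longlonglongrightarrow> measure P (\<Inter>K. N K)"
    by (rule finite_Lim_measure_decseq) (auto simp: N_def decseq_def)
  also have "measure P (\<Inter>K. N K) = 0"
  proof -
    have "AE x in P. x \<notin> (\<Inter>K. N K)" using ev
    proof eventually_elim
      case (elim x)
      show ?case
      proof
        assume x: "x \<in> (\<Inter>K. N K)"
        hence "x \<in> B" by (auto simp: N_def)
        with elim obtain n where "n \<ge> 1" "orbit_sum T g n x \<le> n * w" by auto
        moreover have "x \<in> N n" using x by auto
        ultimately show False by (auto simp: N_def)
      qed
    qed
    thus ?thesis by (subst measure_eq_0_null_sets) (auto simp: AE_iff_null_sets)
  qed
  finally have "(\<lambda>K. (1 + \<bar>w\<bar>) * measure P (N K)) \<longlonglongrightarrow> (1 + \<bar>w\<bar>) * 0"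
    by (intro tendsto_mult tendsto_const)
  hence "I - w * measure P B \<le> (1 + \<bar>w\<bar>) * 0"
    by (rule LIMSEQ_le_const) (use bound in auto)
  thus ?thesis by (simp add: I_def)
qed

text \<open>Half of Birkhoff's ergodic theorem: once the averages are asymptotically at most \<open>v\<close>, a mean of
  at least \<open>v\<close> leaves no room for an invariant set on which they drop below \<open>v\<close>. No ergodicity is needed.\<close>

lemma orbit_average_tendsto:
  fixes v :: real
  assumes upper: "AE x in P. \<forall>e>0. eventually (\<lambda>n. orbit_sum T g n x \<le> n * (v + e)) sequentially"
    and mean: "(\<integral>x. g x \<partial>P) \<ge> v * measure P (space P)"
  shows "AE x in P. (\<lambda>n. orbit_sum T g n x / n) \<longlonglongrightarrow> v"
proof -
  \<comment> \<open>The set where the lower limit of the averages is below \<open>v - e\<close>. The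
    slack \<open>1 / (real k + 1)\<close> lets it survive the change of the sum by at most 1 when
    the orbit is shifted by one step, so the set is invariant.\<close>
  define A where "A e = {x \<in> space P. \<exists>k::nat. \<forall>m. \<exists>n\<ge>m. orbit_sum T g n x < n * (v - e - 1 / (real k + 1))}" for e :: real
  have A [measurable]: "A e \<in> sets P" for e unfolding A_def by measurable
  have inv: "T x \<in> A e \<longleftrightarrow> x \<in> A e" if x: "x \<in> space P" for x e
  proof -
    have Tx: "T x \<in> space P" using measurable_space[OF T x] .
    define c where "c = v - e"
    \<comment> \<open>Replacing \<open>k\<close> by \<open>2*k+1\<close> halves the slack exactly;
      the other half pays for the shifted step once n is large.\<close>
    have half: "1 / (real (2*k+1) + 1) = (1 / (real k + 1)) / 2" for k :: nat by (simp add: field_simps)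
    have large: "\<exists>m0. \<forall>n\<ge>m0. real n * d > r" if d0: "d > 0" for r d :: real
    proof -
      obtain m0 :: nat where "real m0 * d > r" using reals_Archimedean3[OF d0] by blast
      moreover have "real m0 * d \<le> real n * d" if "n \<ge> m0" for n
        using that d0 by (intro mult_right_mono) auto
      ultimately have "\<forall>n\<ge>m0. r < real n * d" by (auto intro: less_le_trans)
      thus ?thesis by (rule exI)
    qed
    show ?thesis
    proof
      assume "T x \<in> A e"
      then obtain k :: nat where k: "\<forall>m. \<exists>n\<ge>m. orbit_sum T g n (T x) < n * (c - 1 / (real k + 1))"
        unfolding A_def c_def mem_Collect_eq by (elim conjE exE)
      define d where "d = 1 / (real k + 1)"
      have d: "d > 0" by (simp add: d_def)
      have half_d: "1 / (real (2*k+1) + 1) = d / 2" unfolding half d_def by (simp add: add.commute)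
      obtain m0 where m0: "\<And>n. n \<ge> m0 \<Longrightarrow> real n * (d/2) > 1 - c + d/2" using large[of "d/2" "1 - c + d/2"] d by auto
      have "\<exists>n\<ge>m. orbit_sum T g n x < n * (c - 1 / (real (2*k+1) + 1))" for m
      proof -
        from k[THEN spec, of "max m m0", folded d_def] obtain n
          where n': "n \<ge> max m m0 \<and> orbit_sum T g n (T x) < n * (c - d)" by (elim exE)
        note n = conjunct1[OF n'] conjunct2[OF n']
        have "orbit_sum T g (Suc n) x < 1 + n * (c - d)" using n g_bound[of x] by (simp add: orbit_sum_Suc abs_le_iff)
        also have "\<dots> < Suc n * (c - d/2)" using m0[of n] n by (simp add: algebra_simps add_divide_distrib)
        finally show ?thesis unfolding half_d using n(1) by (intro exI[of _ "Suc n"]) auto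
      qed
      hence "\<forall>m. \<exists>n\<ge>m. orbit_sum T g n x < n * (c - 1 / (real (2*k+1) + 1))" by (rule allI)
      with x show "x \<in> A e" unfolding A_def c_def by (intro CollectI conjI exI[of _ "2*k+1"])
    next
      assume "x \<in> A e"
      then obtain k :: nat where k: "\<forall>m. \<exists>n\<ge>m. orbit_sum T g n x < n * (c - 1 / (real k + 1))"
        unfolding A_def c_def mem_Collect_eq by (elim conjE exE)
      define d where "d = 1 / (real k + 1)"
      have d: "d > 0" by (simp add: d_def)
      have half_d: "1 / (real (2*k+1) + 1) = d / 2" unfolding half d_def by (simp add: add.commute)
      obtain m0 where m0: "\<And>n. n \<ge> m0 \<Longrightarrow> real n * (d/2) > 1 + c - d" using large[of "d/2" "1 + c - d"] d by auto
      have "\<exists>n\<ge>m. orbit_sum T g n (T x) < n * (c - 1 / (real (2*k+1) + 1))" for m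
      proof -
        from k[THEN spec, of "Suc (max m m0)", folded d_def] obtain n'
          where n'': "n' \<ge> Suc (max m m0) \<and> orbit_sum T g n' x < n' * (c - d)" by (elim exE)
        note n' = conjunct1[OF n''] conjunct2[OF n'']
        then obtain n where n: "n' = Suc n" "n \<ge> max m m0" by (cases n') auto
        have "orbit_sum T g n (T x) < 1 + Suc n * (c - d)"
          using n' n g_bound[of x] by (simp add: orbit_sum_Suc abs_le_iff)
        also have "\<dots> < n * (c - d/2)" using m0[of n] n by (simp add: algebra_simps add_divide_distrib)
        finally show ?thesis unfolding half_d using n(2) by (intro exI[of _ n]) auto
      qed
      hence "\<forall>m. \<exists>n\<ge>m. orbit_sum T g n (T x) < n * (c - 1 / (real (2*k+1) + 1))" by (rule allI)
      with Tx show "T x \<in> A e" unfolding A_def c_def by (intro CollectI conjI exI[of _ "2*k+1"])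
    qed
  qed
  \<comment> \<open>On \<open>A e\<close> the integral is at most
    \<open>(v - e) * measure P (A e)\<close>, on the complement at most \<open>v\<close> times its
    measure. The total is at least \<open>v * measure P (space P)\<close>, so \<open>A e\<close> has
    measure 0.\<close>
  have null: "measure P (A e) = 0" if e: "e > 0" for e
  proof -
    define Ac where "Ac = space P - A e"
    have [measurable]: "Ac \<in> sets P" by (auto simp: Ac_def)
    have Asub: "A e \<subseteq> space P" by (auto simp: A_def)
    have 1: "(\<integral>x. indicator (A e) x * g x \<partial>P) \<le> (v - e) * measure P (A e)"
    proof (rule integral_le_invariant[OF A inv])
      show "AE x in P. x \<in> A e \<longrightarrow> (\<exists>n\<ge>1. orbit_sum T g n x \<le> n * (v - e))"
      proof (intro AE_I2 impI)
        fix x assume "x \<in> A e"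
        then obtain k :: nat where "\<forall>m. \<exists>n\<ge>m. orbit_sum T g n x < n * (v - e - 1 / (real k + 1))"
          unfolding A_def mem_Collect_eq by (elim conjE exE)
        from this[THEN spec, of 1] obtain n where n: "n \<ge> 1" "orbit_sum T g n x < n * (v - e - 1 / (real k + 1))" by (elim exE conjE)
        have "n * (v - e - 1 / (real k + 1)) \<le> n * (v - e)" by (intro mult_left_mono) auto
        with n(2) have "orbit_sum T g n x \<le> n * (v - e)" by linarith
        with n(1) show "\<exists>n\<ge>1. orbit_sum T g n x \<le> n * (v - e)" by (intro exI[of _ n] conjI)
      qed
    qed
    have 2: "(\<integral>x. indicator Ac x * g x \<partial>P) \<le> (v + \<eta>) * measure P Ac" if \<eta>: "\<eta> > 0" for \<eta>
    proof (rule integral_le_invariant)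
      show "T x \<in> Ac \<longleftrightarrow> x \<in> Ac" if "x \<in> space P" for x
        using inv[OF that, of e] measurable_space[OF T that] that by (auto simp: Ac_def)
      show "AE x in P. x \<in> Ac \<longrightarrow> (\<exists>n\<ge>1. orbit_sum T g n x \<le> n * (v + \<eta>))"
        using upper
      proof eventually_elim
        case (elim x)
        hence "eventually (\<lambda>n. n \<ge> 1 \<and> orbit_sum T g n x \<le> n * (v + \<eta>)) sequentially"
          using \<eta> by (intro eventually_conj eventually_ge_at_top) auto
        from eventually_happens[OF this] show ?case by auto
      qed
    qed measurable
    have "(\<integral>x. indicator Ac x * g x \<partial>P) \<le> v * measure P Ac"
    proof (rule field_le_epsilon)
      fix \<delta> :: real assume "\<delta> > 0"
      define \<eta> where "\<eta> = \<delta> / (measure P Ac + 1)"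
      have pos: "measure P Ac + 1 > 0" by (simp add: add_nonneg_pos)
      have \<eta>: "\<eta> > 0" using \<open>\<delta> > 0\<close> pos by (simp add: \<eta>_def)
      have "\<eta> * measure P Ac \<le> \<eta> * (measure P Ac + 1)" using \<eta> by (intro mult_left_mono) auto
      also have "\<dots> = \<delta>" using pos by (simp add: \<eta>_def)
      finally show "(\<integral>x. indicator Ac x * g x \<partial>P) \<le> v * measure P Ac + \<delta>"
        using 2[OF \<eta>] by (simp add: algebra_simps)
    qed
    moreover have "(\<integral>x. g x \<partial>P) = (\<integral>x. indicator (A e) x * g x + indicator Ac x * g x \<partial>P)"
      by (intro Bochner_Integration.integral_cong) (auto simp: Ac_def indicator_def)
    moreover have "\<dots> = (\<integral>x. indicator (A e) x * g x \<partial>P) + (\<integral>x. indicator Ac x * g x \<partial>P)"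
      by (intro Bochner_Integration.integral_add integrable_bounded[where c = 1])
         (use g_bound in \<open>auto simp: indicator_def\<close>)
    moreover have "measure P (space P) = measure P (A e) + measure P Ac"
      unfolding Ac_def using finite_measure_compl[OF A, of e] by simp
    ultimately have "e * measure P (A e) \<le> 0" using 1 mean by (simp add: algebra_simps)
    thus ?thesis using e measure_nonneg[of P "A e"] by (simp add: mult_le_0_iff antisym)
  qed
  have "AE x in P. x \<notin> A (1 / (real m + 1))" for m :: nat
  proof -
    have "A (1 / (real m + 1)) \<in> null_sets P" using null[of "1 / (real m + 1)"]
      by (intro null_setsI) (auto simp: emeasure_eq_measure)
    thus ?thesis by (rule AE_not_in)
  qed
  hence "AE x in P. \<forall>m::nat. x \<notin> A (1 / (real m + 1))" by (rule AE_all_countable[THEN iffD2, OF allI])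
  with upper AE_space show ?thesis
  proof eventually_elim
    case (elim x)
    show ?case
    proof (rule LIMSEQ_I)
      fix r :: real assume r: "r > 0"
      obtain m :: nat where m: "1 / (real m + 1) < r / 2" using reals_Archimedean[of "r/2"] r
        by (auto simp: inverse_eq_divide add.commute)
      have "\<not> (\<forall>M. \<exists>n\<ge>M. orbit_sum T g n x < n * (v - 1 / (real m + 1) - 1 / (real m + 1)))"
      proof -
        have "x \<in> space P" "x \<notin> A (1 / (real m + 1))" using elim(2,3) by (auto simp: add.commute)
        thus ?thesis unfolding A_def mem_Collect_eq by blast
      qed
      then obtain M where M: "\<And>n. n \<ge> M \<Longrightarrow> orbit_sum T g n x \<ge> n * (v - 1 / (real m + 1) - 1 / (real m + 1))"
        unfolding not_all not_ex not_less by (metis not_less)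
      obtain M' where M': "\<And>n. n \<ge> M' \<Longrightarrow> orbit_sum T g n x \<le> n * (v + r / 2)"
        using elim(1)[rule_format, of "r / 2"] r unfolding eventually_sequentially by auto
      show "\<exists>n0. \<forall>n\<ge>n0. norm (orbit_sum T g n x / n - v) < r"
      proof (intro exI[of _ "Suc (max M M')"] allI impI)
        fix n assume n: "n \<ge> Suc (max M M')"
        hence n0: "real n > 0" by simp
        have "orbit_sum T g n x / n \<le> v + r / 2" using M'[of n] n n0 by (simp add: divide_le_eq mult.commute)
        moreover have "orbit_sum T g n x / n \<ge> v - 1 / (real m + 1) - 1 / (real m + 1)"
          using M[of n] n n0 by (simp add: le_divide_eq mult.commute)
        ultimately show "norm (orbit_sum T g n x / n - v) < r" using m r by (simp add: abs_less_iff)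
      qed
    qed
  qed
qed

end

section \<open>The quenched walk\<close>

abbreviation envs :: "(int \<Rightarrow> int) measure" where
  "envs \<equiv> PiM UNIV (\<lambda>_. count_space UNIV)"

definition right_prob :: "real \<Rightarrow> (int \<Rightarrow> int) \<Rightarrow> int \<Rightarrow> real" where
  "right_prob p u x = (if u x = 1 then p else 1 - p)"

definition odds :: "real \<Rightarrow> (int \<Rightarrow> int) \<Rightarrow> int \<Rightarrow> real" where
  "odds p u x = (1 - right_prob p u x) / right_prob p u x"

lemma swap_trans_eq:
  "swap_trans p u i j = (if j = i + 1 then right_prob p u i else if j = i - 1 then 1 - right_prob p u i else 0)"
  by (simp add: swap_trans_def right_prob_def)

lemma coordinate_measurable [measurable]: "(\<lambda>u. u x) \<in> measurable envs (count_space UNIV)"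
  by (rule measurable_component_singleton) simp

lemma right_prob_measurable [measurable]: "(\<lambda>u. right_prob p u x) \<in> borel_measurable envs"
proof -
  have "(\<lambda>a::int. if a = 1 then p else 1 - p) \<in> borel_measurable (count_space UNIV)" by simp
  from measurable_compose[OF coordinate_measurable this] show ?thesis
    unfolding right_prob_def[abs_def] .
qed

lemma odds_measurable [measurable]: "(\<lambda>u. odds p u x) \<in> borel_measurable envs"
  unfolding odds_def[abs_def] by measurable

text \<open>The discrete antiderivative of \<open>c\<close> that vanishes at 0, with the usual sign
  convention to the left of 0.\<close>

definition isum :: "(int \<Rightarrow> real) \<Rightarrow> int \<Rightarrow> real" where
  "isum c x = (\<Sum>k\<in>{0..<x}. c k) - (\<Sum>k\<in>{x..<0}. c k)"

lemma isum_succ: "isum c (x + 1) = isum c x + c x"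
proof (cases "x \<ge> 0")
  case True
  hence "{0..<x+1} = insert x {0..<x}" "{x+1..<0} = {}" "{x..<0} = {}" by auto
  thus ?thesis by (simp add: isum_def)
next
  case False
  hence "{x..<0} = insert x {x+1..<0}" "{0..<x+1} = {}" "{0..<x} = {}" by auto
  thus ?thesis by (simp add: isum_def)
qed

lemma isum_nat: "isum c (int n) = (\<Sum>k<n. c (int k))"
  by (induction n) (simp_all add: isum_succ[of c "int _", simplified add.commute] isum_def[of c 0])

text \<open>\<open>crossing p u L x\<close> is the mean time to pass from \<open>x\<close> to \<open>x + 1\<close>, truncated at depth \<open>L\<close>.\<close>

primrec crossing :: "real \<Rightarrow> (int \<Rightarrow> int) \<Rightarrow> nat \<Rightarrow> int \<Rightarrow> real" where
  "crossing p u 0 x = 1"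
| "crossing p u (Suc L) x = 1 + odds p u x + odds p u x * crossing p u L (x - 1)"

lemma crossing_eq: "crossing p u L x = 1 + 2 * (\<Sum>j<L. \<Prod>i<Suc j. odds p u (x - int i))"
proof (induction L arbitrary: x)
  case (Suc L)
  have "(\<Sum>j<Suc L. \<Prod>i<Suc j. odds p u (x - int i))
      = odds p u x + (\<Sum>j<L. \<Prod>i<Suc (Suc j). odds p u (x - int i))"
    unfolding sum.lessThan_Suc_shift by simp
  also have "(\<Sum>j<L. \<Prod>i<Suc (Suc j). odds p u (x - int i))
      = odds p u x * (\<Sum>j<L. \<Prod>i<Suc j. odds p u (x - 1 - int i))"
    unfolding prod.lessThan_Suc_shift[of _ "Suc _"] sum_distrib_left
    by (intro sum.cong refl) (simp add: algebra_simps del: prod.lessThan_Suc)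
  finally show ?case using Suc by (simp add: algebra_simps del: prod.lessThan_Suc)
qed simp

lemma crossing_measurable [measurable]: "(\<lambda>u. crossing p u L x) \<in> borel_measurable envs"
  unfolding crossing_eq by measurable

text \<open>The increments of the scale function of the walk, normalised to 1 at site 0. To the left
  of 0 the first product is empty and reciprocals of the odds appear.\<close>

definition potential :: "real \<Rightarrow> (int \<Rightarrow> int) \<Rightarrow> int \<Rightarrow> real" where
  "potential p u x = (\<Prod>i\<in>{1..x}. odds p u i) / (\<Prod>i\<in>{x+1..0}. odds p u i)"

lemma potential_measurable [measurable]: "(\<lambda>u. potential p u x) \<in> borel_measurable envs"
  unfolding potential_def by measurable

lemma exp_le_quadratic:
  fixes y :: real
  assumes "\<bar>y\<bar> \<le> 1"
  shows "exp y \<le> 1 + y + y^2"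
proof (cases "y \<ge> 0")
  case True
  thus ?thesis using assms by (intro exp_bound) auto
next
  case False
  define z where "z = - y"
  have z: "0 \<le> z" using False by (simp add: z_def)
  \<comment> \<open>The product is 1 + z^3, so 1 - z + z^2 bounds \<open>exp (-z)\<close> from
    above.\<close>
  have "1 \<le> (1 + z) * (1 - z + z^2)" using z by (simp add: algebra_simps power2_eq_square)
  also have "\<dots> \<le> exp z * (1 - z + z^2)"
  proof (intro mult_right_mono)
    show "1 + z \<le> exp z" by simp
    have "0 \<le> (1 - z/2)^2 + 3/4 * z^2" by simp
    thus "0 \<le> 1 - z + z^2" by (simp add: power2_eq_square algebra_simps)
  qed
  finally have "exp (-z) * 1 \<le> exp (-z) * (exp z * (1 - z + z^2))" by (intro mult_left_mono) auto
  also have "\<dots> = 1 - z + z^2" by (simp flip: mult.assoc exp_add)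
  finally show ?thesis by (simp add: z_def)
qed

text \<open>Deterministic inversion: cost grows like \<open>c\<close> per site and at most like
  \<open>1 + e\<close> per unit of time, hence at most \<open>(1 + e) / (c - e)\<close> sites are
  gained per unit of time.\<close>

lemma speed_upper_of_cost:
  fixes G :: "int \<Rightarrow> real" and y :: "nat \<Rightarrow> int" and a c d :: real
  assumes c: "c > 0" and G: "(\<lambda>n. G (int n) / n) \<longlonglongrightarrow> c"
    and ev: "\<And>e::real. e > 0 \<Longrightarrow> eventually (\<lambda>n. G (y n) \<le> a + (1 + e) * n) sequentially"
    and d: "d > 0"
  shows "eventually (\<lambda>n. y n \<le> (1 / c + d) * n) sequentially"
proof -
  \<comment> \<open>The wanted inequality \<open>(1 + e) / (c - e) < 1 / c + d\<close> amounts to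
    \<open>e * (c + 1 + c * d) < c^2 * d\<close>; this \<open>e\<close> makes the left side half of
    the right side.\<close>
  define e where "e = c^2 * d / (2 * (c + 1 + c * d))"
  have den: "c + 1 + c * d > 0" using c d by (simp add: add_pos_pos)
  have e: "e > 0" using c d den by (simp add: e_def)
  have e2: "e * (c + 1 + c * d) = c^2 * d / 2" 
  proof -
    have "c^2 * d / (2 * D) * D = c^2 * d / 2" if "D > 0" for D using that by simp
    from this[OF den] show ?thesis by (simp only: e_def)
  qed
  have "e * (c * d) < e * (c + 1 + c * d)" using e c by simp
  also have "\<dots> < c * (c * d)" unfolding e2 using c d by (simp add: power2_eq_square)
  finally have ec: "e < c" using mult_less_cancel_right_pos[of "c * d" e c] c d by simp
  have "c * (1 + e) < (1 + c * d) * (c - e)"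
  proof -
    have "c^2 * d / 2 < c^2 * d" using c d by simp
    thus ?thesis using e2 by (simp add: algebra_simps power2_eq_square)
  qed
  hence r: "(1 + e) / (c - e) < 1 / c + d" using c ec by (simp add: field_simps)
  define k where "k = 1 / c + d - (1 + e) / (c - e)"
  have k: "k > 0" using r by (simp add: k_def)
  have "eventually (\<lambda>n. c - e < G (int n) / n) sequentially"
    using order_tendstoD(1)[OF G, of "c - e"] e by simp
  hence "eventually (\<lambda>n. c - e < G (int n) / n \<and> n > 0) sequentially"
    by (intro eventually_conj eventually_gt_at_top)
  then obtain N where N: "\<And>n. n \<ge> N \<Longrightarrow> c - e < G (int n) / n \<and> n > 0"
    by (auto simp: eventually_sequentially)
  have lin: "eventually (\<lambda>n. real n * k > a) sequentially" if "k > 0" for k a :: real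
    using that by real_asymp
  have "eventually (\<lambda>n. real n * k > a / (c - e)) sequentially"
    "eventually (\<lambda>n. real n * (1 / c + d) > real N) sequentially"
    using lin[OF k] lin[of "1 / c + d"] c d by (auto simp: add_pos_pos)
  with ev[OF e] show ?thesis
  proof eventually_elim
    case (elim n)
    show ?case
    proof (cases "y n \<ge> int N")
      case True
      define m where "m = nat (y n)"
      have m: "y n = int m" "m \<ge> N" using True by (auto simp: m_def)
      have "(c - e) * real m \<le> G (int m)" using N[OF m(2)] by (simp add: less_divide_eq less_imp_le)
      also have "\<dots> \<le> a + (1 + e) * n" using elim m by simp
      finally have "real m \<le> (a + (1 + e) * n) / (c - e)" using ec by (simp add: le_divide_eq mult.commute)
      also have "\<dots> = a / (c - e) + (1 + e) / (c - e) * n"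
        by (simp only: add_divide_distrib[of a] times_divide_eq_left)
      also have "\<dots> \<le> n * k + (1 + e) / (c - e) * n" using elim by simp
      also have "\<dots> = (1 / c + d) * n" by (simp add: k_def algebra_simps)
      finally show ?thesis using m by simp
    next
      case False
      thus ?thesis using elim by (simp add: mult.commute)
    qed
  qed
qed

text \<open>Finitely many visits to each site force the absolute value to infinity, and a
  nearest-neighbour path that has stopped visiting 0 keeps its sign.\<close>

lemma nearest_neighbour_escape:
  fixes y :: "nat \<Rightarrow> int"
  assumes nn: "\<And>n. y (Suc n) = y n + 1 \<or> y (Suc n) = y n - 1"
    and fin: "\<And>x. finite {n. y n = x}"
  shows "filterlim y at_top sequentially \<or> filterlim y at_bot sequentially"
proof -
  have ev: "eventually (\<lambda>n. \<bar>y n\<bar> > K) sequentially" for K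
  proof -
    have "finite (\<Union>x\<in>{-K..K}. {n. y n = x})" using fin by auto
    also have "(\<Union>x\<in>{-K..K}. {n. y n = x}) = {n. \<not> \<bar>y n\<bar> > K}" by auto
    finally show ?thesis by (simp add: eventually_cofinite flip: cofinite_eq_sequentially)
  qed
  then obtain N where N: "\<And>n. n \<ge> N \<Longrightarrow> \<bar>y n\<bar> > 0" using eventually_sequentially by (metis (no_types, lifting))
  have sgn: "(y n > 0) = (y N > 0)" if "n \<ge> N" for n
    using that
  proof (induction n rule: dec_induct)
    case (step n)
    thus ?case using N[of n] N[of "Suc n"] nn[of n] by auto
  qed simp
  show ?thesis
  proof (cases "y N > 0")
    case True
    have "filterlim y at_top sequentially"
    proof (rule filterlim_at_top[THEN iffD2], intro allI)
      fix K
      show "eventually (\<lambda>n. K \<le> y n) sequentially"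
        using ev[of K] eventually_ge_at_top[of N]
      proof eventually_elim
        case (elim n)
        thus ?case using sgn[of n] True by auto
      qed
    qed
    thus ?thesis ..
  next
    case False
    have "filterlim y at_bot sequentially"
    proof (rule filterlim_at_bot[THEN iffD2], intro allI)
      fix K
      show "eventually (\<lambda>n. y n \<le> K) sequentially"
        using ev[of "\<bar>K\<bar>"] eventually_ge_at_top[of N]
      proof eventually_elim
        case (elim n)
        thus ?case using sgn[of n] False by auto
      qed
    qed
    thus ?thesis ..
  qed
qed

locale quenched_walk = prob_space M for M :: "'a measure" +
  fixes p :: real and x0 :: int and U :: "int \<Rightarrow> 'a \<Rightarrow> int" and X :: "nat \<Rightarrow> 'a \<Rightarrow> int"
  assumes p01: "0 < p" "p < 1" and walk: "swap_walk M p x0 U X"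
begin

definition env :: "'a \<Rightarrow> int \<Rightarrow> int" where "env \<omega> = (\<lambda>i. U i \<omega>)"

abbreviation "hist n \<equiv> walk_history M U X n"

lemma right_prob_01: "0 < right_prob p u x" "right_prob p u x < 1"
  using p01 by (auto simp: right_prob_def)

lemma odds_pos: "odds p u x > 0"
  using right_prob_01[of u x] by (simp add: odds_def)

lemma one_plus_odds: "1 + odds p u x = 1 / right_prob p u x"
  using right_prob_01[of u x] by (simp add: odds_def field_simps)

lemma right_prob_odds: "right_prob p u x * odds p u x = 1 - right_prob p u x"
  using right_prob_01[of u x] by (simp add: odds_def)

lemma U_meas [measurable]: "U i \<in> measurable M (count_space UNIV)"
  and X_meas [measurable]: "X n \<in> measurable M (count_space UNIV)"
  using walk by (auto simp: swap_walk_def)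

lemma X_0: "AE \<omega> in M. X 0 \<omega> = x0"
  using walk by (simp add: swap_walk_def)

lemma space_hist [simp]: "space (hist n) = space M"
  unfolding walk_history_def by (auto intro!: space_measure_of)

lemma hist_generators: "{{\<omega> \<in> space M. U i \<omega> = a} | i a. True} \<union> {{\<omega> \<in> space M. X k \<omega> = a} | k a. k \<le> n} \<subseteq> Pow (space M)"
  by auto

lemma subalgebra_hist: "subalgebra M (hist n)"
proof -
  have "sets (hist n) \<subseteq> sets M"
    unfolding walk_history_def sets_measure_of[OF hist_generators]
    by (intro sets.sigma_sets_subset) auto
  thus ?thesis by (simp add: subalgebra_def)
qed

lemma U_hist [measurable]: "U i \<in> measurable (hist n) (count_space UNIV)"
  and X_hist: "k \<le> n \<Longrightarrow> X k \<in> measurable (hist n) (count_space UNIV)"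
proof -
  have level: "f -` {a} \<inter> space M = {\<omega> \<in> space M. f \<omega> = a}" for f :: "'a \<Rightarrow> int" and a by auto
  have "U i -` {a} \<inter> space M \<in> sets (hist n)" for a
    unfolding walk_history_def sets_measure_of[OF hist_generators]
    unfolding level by (rule sigma_sets.Basic) blast
  thus "U i \<in> measurable (hist n) (count_space UNIV)"
    by (subst measurable_count_space_eq2_countable) auto
  have "X k -` {a} \<inter> space M \<in> sets (hist n)" if "k \<le> n" for a
    unfolding walk_history_def sets_measure_of[OF hist_generators]
    unfolding level using that by (intro sigma_sets.Basic) blast
  thus "X k \<in> measurable (hist n) (count_space UNIV)" if "k \<le> n"
    using that by (subst measurable_count_space_eq2_countable) auto
qed

lemma X_hist_self [measurable]: "X n \<in> measurable (hist n) (count_space UNIV)"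
  and X_hist_0 [measurable]: "X 0 \<in> measurable (hist n) (count_space UNIV)"
  by (auto intro: X_hist)

lemma env_meas [measurable]: "env \<in> measurable M envs"
  unfolding env_def[abs_def] by (rule measurable_PiM_single') auto

lemma env_hist [measurable]: "env \<in> measurable (hist n) envs"
  unfolding env_def[abs_def] by (rule measurable_PiM_single') (auto simp: space_hist)

lemma hist_meas: "f \<in> measurable (hist n) N \<Longrightarrow> f \<in> measurable M N"
  by (rule measurable_from_subalg[OF subalgebra_hist])

lemma swap_trans_meas [measurable]: "(\<lambda>\<omega>. swap_trans p (env \<omega>) (X n \<omega>) j) \<in> borel_measurable M"
proof (rule measurable_compose_countable[OF _ X_meas])
  show "(\<lambda>\<omega>. swap_trans p (env \<omega>) x j) \<in> borel_measurable M" for x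
    unfolding swap_trans_eq by measurable
qed

section \<open>The Markov property as an identity of nonnegative integrals\<close>

lemma one_step_set:
  assumes A: "A \<in> sets (hist n)"
  shows "(\<integral>\<^sup>+\<omega>. indicator A \<omega> * indicator {\<omega> \<in> space M. X (Suc n) \<omega> = j} \<omega> \<partial>M)
       = (\<integral>\<^sup>+\<omega>. indicator A \<omega> * ennreal (swap_trans p (env \<omega>) (X n \<omega>) j) \<partial>M)"
proof -
  interpret F: finite_measure_subalgebra M "hist n"
    by unfold_locales (rule subalgebra_hist)
  have AM [measurable]: "A \<in> sets M" using A subalgebra_hist by (auto simp: subalgebra_def)
  define E where "E = {\<omega> \<in> space M. X (Suc n) \<omega> = j}"
  have E [measurable]: "E \<in> sets M" unfolding E_def by measurable
  have [simp]: "integrable M (indicat_real E)"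
    by (rule integrable_const_bound[where B = 1]) auto
  have tr: "0 \<le> swap_trans p (env \<omega>) (X n \<omega>) j" "swap_trans p (env \<omega>) (X n \<omega>) j \<le> 1" for \<omega>
    using right_prob_01[of "env \<omega>" "X n \<omega>"] by (auto simp: swap_trans_eq)
  have ae: "AE \<omega> in M. real_cond_exp M (hist n) (indicator E) \<omega> = swap_trans p (env \<omega>) (X n \<omega>) j"
    using walk unfolding swap_walk_def E_def env_def by auto
  have "measure M (A \<inter> E) = (\<integral>\<omega>\<in>A. indicator E \<omega> \<partial>M)"
    unfolding set_lebesgue_integral_def using sets.sets_into_space[OF AM]
    by (simp add: indicator_inter_arith[symmetric] Int_absorb2 le_infI1)
  also have "\<dots> = (\<integral>\<omega>\<in>A. real_cond_exp M (hist n) (indicator E) \<omega> \<partial>M)"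
    by (rule F.real_cond_exp_intA) (use A in auto)
  also have "\<dots> = (\<integral>\<omega>. indicator A \<omega> * swap_trans p (env \<omega>) (X n \<omega>) j \<partial>M)"
    unfolding set_lebesgue_integral_def using ae by (intro integral_cong_AE) auto
  finally have eq: "measure M (A \<inter> E) = (\<integral>\<omega>. indicator A \<omega> * swap_trans p (env \<omega>) (X n \<omega>) j \<partial>M)" .
  have "(\<integral>\<^sup>+\<omega>. indicator A \<omega> * ennreal (swap_trans p (env \<omega>) (X n \<omega>) j) \<partial>M)
      = (\<integral>\<^sup>+\<omega>. ennreal (indicator A \<omega> * swap_trans p (env \<omega>) (X n \<omega>) j) \<partial>M)"
    by (intro nn_integral_cong) (auto simp: indicator_def)
  also have "\<dots> = ennreal (measure M (A \<inter> E))"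
    unfolding eq using tr
    by (intro nn_integral_eq_integral integrable_const_bound[where B = 1]) (auto simp: indicator_def)
  also have "\<dots> = (\<integral>\<^sup>+\<omega>. indicator (A \<inter> E) \<omega> \<partial>M)" by (simp add: emeasure_eq_measure)
  finally show ?thesis unfolding E_def[symmetric] by (simp add: indicator_inter_arith)
qed

text \<open>Monotone class extension of the defining property of conditional expectation, from
  events of the history to nonnegative functions on it.\<close>

lemma one_step_factor:
  assumes "f \<in> borel_measurable (hist n)"
  shows "(\<integral>\<^sup>+\<omega>. f \<omega> * indicator {\<omega> \<in> space M. X (Suc n) \<omega> = j} \<omega> \<partial>M)
       = (\<integral>\<^sup>+\<omega>. f \<omega> * ennreal (swap_trans p (env \<omega>) (X n \<omega>) j) \<partial>M)"
  using assms
proof (induction f rule: borel_measurable_induct)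
  case (cong f g)
  have "(\<integral>\<^sup>+\<omega>. f \<omega> * h \<omega> \<partial>M) = (\<integral>\<^sup>+\<omega>. g \<omega> * h \<omega> \<partial>M)" for h
    using cong(3) by (intro nn_integral_cong) auto
  thus ?case using cong(4) by simp
next
  case (set A)
  thus ?case by (rule one_step_set)
next
  case (mult u c)
  have [measurable]: "u \<in> borel_measurable M" using hist_meas mult by auto
  show ?case using mult by (simp add: mult.assoc nn_integral_cmult)
next
  case (add u v)
  have [measurable]: "u \<in> borel_measurable M" "v \<in> borel_measurable M" using hist_meas add by auto
  show ?case using add by (simp add: distrib_right nn_integral_add)
next
  case (seq V)
  have [measurable]: "V i \<in> borel_measurable M" for i using hist_meas seq by auto
  have mono: "incseq (\<lambda>i \<omega>. V i \<omega> * h \<omega>)" for h :: "'a \<Rightarrow> ennreal"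
    using seq(3) by (auto simp: incseq_def le_fun_def intro!: mult_right_mono)
  have "(\<integral>\<^sup>+\<omega>. (SUP i. V i) \<omega> * h \<omega> \<partial>M) = (SUP i. (\<integral>\<^sup>+\<omega>. V i \<omega> * h \<omega> \<partial>M))"
    if [measurable]: "h \<in> borel_measurable M" for h
  proof -
    have "(\<integral>\<^sup>+\<omega>. (SUP i. V i) \<omega> * h \<omega> \<partial>M) = (\<integral>\<^sup>+\<omega>. (SUP i. V i \<omega> * h \<omega>) \<partial>M)"
      by (intro nn_integral_cong) (simp only: SUP_apply SUP_mult_right_ennreal)
    also have "\<dots> = (SUP i. (\<integral>\<^sup>+\<omega>. V i \<omega> * h \<omega> \<partial>M))"
      by (rule nn_integral_monotone_convergence_SUP[OF mono]) measurable
    finally show ?thesis .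
  qed
  thus ?case using seq by simp
qed

text \<open>The form in which the Markov property is used from here on. The function
  \<open>h\<close> may depend on the whole environment and the past of the walk, and working with
  \<open>ennreal\<close> removes all integrability questions.\<close>

lemma one_step:
  fixes h :: "int \<Rightarrow> 'a \<Rightarrow> ennreal"
  assumes h: "\<And>j. h j \<in> borel_measurable (hist n)"
  shows "(\<integral>\<^sup>+\<omega>. h (X (Suc n) \<omega>) \<omega> \<partial>M)
    = (\<integral>\<^sup>+\<omega>. ennreal (right_prob p (env \<omega>) (X n \<omega>)) * h (X n \<omega> + 1) \<omega>
         + ennreal (1 - right_prob p (env \<omega>) (X n \<omega>)) * h (X n \<omega> - 1) \<omega> \<partial>M)"
proof -
  have [measurable]: "h j \<in> borel_measurable M" for j using hist_meas[OF h] .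
  have "(\<integral>\<^sup>+\<omega>. h (X (Suc n) \<omega>) \<omega> \<partial>M)
    = (\<integral>\<^sup>+\<omega>. (\<Sum>k. h (int_decode k) \<omega> * indicator {\<omega> \<in> space M. X (Suc n) \<omega> = int_decode k} \<omega>) \<partial>M)"
  proof (intro nn_integral_cong)
    fix \<omega> assume "\<omega> \<in> space M"
    have "(\<Sum>k. h (int_decode k) \<omega> * indicator {\<omega> \<in> space M. X (Suc n) \<omega> = int_decode k} \<omega>)
      = (\<Sum>k\<in>{int_encode (X (Suc n) \<omega>)}. h (int_decode k) \<omega> * indicator {\<omega> \<in> space M. X (Suc n) \<omega> = int_decode k} \<omega>)"
      by (rule suminf_finite) (auto simp: indicator_def)
    thus "h (X (Suc n) \<omega>) \<omega> = (\<Sum>k. h (int_decode k) \<omega> * indicator {\<omega> \<in> space M. X (Suc n) \<omega> = int_decode k} \<omega>)"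
      using \<open>\<omega> \<in> space M\<close> by simp
  qed
  also have "\<dots> = (\<Sum>k. \<integral>\<^sup>+\<omega>. h (int_decode k) \<omega> * indicator {\<omega> \<in> space M. X (Suc n) \<omega> = int_decode k} \<omega> \<partial>M)"
    by (rule nn_integral_suminf) measurable
  also have "\<dots> = (\<Sum>k. \<integral>\<^sup>+\<omega>. h (int_decode k) \<omega> * ennreal (swap_trans p (env \<omega>) (X n \<omega>) (int_decode k)) \<partial>M)"
    by (simp only: one_step_factor[OF h])
  also have "\<dots> = (\<integral>\<^sup>+\<omega>. (\<Sum>k. h (int_decode k) \<omega> * ennreal (swap_trans p (env \<omega>) (X n \<omega>) (int_decode k))) \<partial>M)"
    by (rule nn_integral_suminf[symmetric]) measurable
  also have "\<dots> = (\<integral>\<^sup>+\<omega>. ennreal (right_prob p (env \<omega>) (X n \<omega>)) * h (X n \<omega> + 1) \<omega>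
         + ennreal (1 - right_prob p (env \<omega>) (X n \<omega>)) * h (X n \<omega> - 1) \<omega> \<partial>M)"
  proof (intro nn_integral_cong)
    fix \<omega> assume "\<omega> \<in> space M"
    have "(\<Sum>k. h (int_decode k) \<omega> * ennreal (swap_trans p (env \<omega>) (X n \<omega>) (int_decode k)))
      = (\<Sum>k\<in>{int_encode (X n \<omega> + 1), int_encode (X n \<omega> - 1)}. h (int_decode k) \<omega> * ennreal (swap_trans p (env \<omega>) (X n \<omega>) (int_decode k)))"
    proof (rule suminf_finite)
      fix k assume "k \<notin> {int_encode (X n \<omega> + 1), int_encode (X n \<omega> - 1)}"
      hence "int_decode k \<noteq> X n \<omega> + 1" "int_decode k \<noteq> X n \<omega> - 1"
        by (metis insertI1 insertI2 int_decode_inverse)+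
      thus "h (int_decode k) \<omega> * ennreal (swap_trans p (env \<omega>) (X n \<omega>) (int_decode k)) = 0"
        by (simp add: swap_trans_eq)
    qed simp
    also have "\<dots> = ennreal (right_prob p (env \<omega>) (X n \<omega>)) * h (X n \<omega> + 1) \<omega>
         + ennreal (1 - right_prob p (env \<omega>) (X n \<omega>)) * h (X n \<omega> - 1) \<omega>"
      by (simp add: swap_trans_eq mult.commute int_encode_eq)
    finally show "(\<Sum>k. h (int_decode k) \<omega> * ennreal (swap_trans p (env \<omega>) (X n \<omega>) (int_decode k))) = \<dots>" .
  qed
  finally show ?thesis .
qed

end

context quenched_walk
begin

lemma AE_nearest_neighbour: "AE \<omega> in M. \<forall>n. X (Suc n) \<omega> = X n \<omega> + 1 \<or> X (Suc n) \<omega> = X n \<omega> - 1"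
proof (rule AE_all_countable[THEN iffD2, OF allI])
  fix n
  \<comment> \<open>The test function is 1 exactly at the forbidden jumps, and the one-step identity
    gives it integral 0.\<close>
  define h :: "int \<Rightarrow> 'a \<Rightarrow> ennreal" where
    "h j \<omega> = (if j = X n \<omega> + 1 \<or> j = X n \<omega> - 1 then 0 else 1)" for j \<omega>
  have h: "h j \<in> borel_measurable (hist n)" for j
    unfolding h_def[abs_def]
    by (rule measurable_compose[OF X_hist_self, where g = "\<lambda>x. if j = x + 1 \<or> j = x - 1 then 0 else 1"]) simp
  have [measurable]: "(\<lambda>\<omega>. h (X (Suc n) \<omega>) \<omega>) \<in> borel_measurable M"
    by (rule measurable_compose_countable[OF hist_meas[OF h] X_meas])
  have "(\<integral>\<^sup>+\<omega>. h (X (Suc n) \<omega>) \<omega> \<partial>M) = 0"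
    using one_step[where h = h, OF h] by (simp add: h_def)
  hence "AE \<omega> in M. h (X (Suc n) \<omega>) \<omega> = 0" by (subst (asm) nn_integral_0_iff_AE) auto
  thus "AE \<omega> in M. X (Suc n) \<omega> = X n \<omega> + 1 \<or> X (Suc n) \<omega> = X n \<omega> - 1"
    by eventually_elim (auto simp: h_def split: if_splits)
qed

section \<open>The cost function and the upper bound for the speed\<close>

lemma odds_le: "odds p u x \<le> 1 / min p (1 - p)"
proof -
  have "right_prob p u x \<ge> min p (1 - p)" "min p (1 - p) > 0"
    using p01 by (auto simp: right_prob_def)
  moreover from this have "1 - right_prob p u x \<le> 1" using right_prob_01[of u x] by simp
  ultimately show ?thesis unfolding odds_def using right_prob_01[of u x]
    by (intro frac_le) auto
qed

lemma prod_odds_pos: "(\<Prod>i\<in>I. odds p u (f i)) > 0"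
  by (intro prod_pos ballI odds_pos)

lemma crossing_ge_1: "crossing p u L x \<ge> 1"
proof -
  have "0 \<le> (\<Sum>j<L. \<Prod>i<Suc j. odds p u (x - int i))"
    by (intro sum_nonneg less_imp_le[OF prod_odds_pos])
  thus ?thesis unfolding crossing_eq by simp
qed

lemma crossing_bounded: "\<exists>C. \<forall>u x. crossing p u L x \<le> C"
proof (induction L)
  case (Suc L)
  then obtain C where C: "\<And>u x. crossing p u L x \<le> C" by blast
  define K where "K = 1 / min p (1 - p)"
  have "crossing p u (Suc L) x \<le> 1 + K + K * C" for u x
  proof -
    have "odds p u x * crossing p u L (x - 1) \<le> K * C"
      using odds_le[of u x] odds_pos[of u x] C[of u "x - 1"] crossing_ge_1[of u L "x - 1"]
      using p01 by (intro mult_mono) (auto simp: K_def)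
    thus ?thesis using odds_le[of u x] by (simp add: K_def)
  qed
  thus ?case by blast
qed auto

lemma crossing_mono: "crossing p u L x \<le> crossing p u (Suc L) x"
  unfolding crossing_eq sum.lessThan_Suc[of _ L] using less_imp_le[OF prod_odds_pos]
  by (simp del: prod.lessThan_Suc)

text \<open>For infinite depth this would be an equality. The recursion produces depth
  \<open>L - 1\<close> at the left neighbour, and replacing it by the larger value at depth
  \<open>L\<close> can only decrease the left side.\<close>

lemma crossing_drift:
  "right_prob p u x * crossing p u L x - (1 - right_prob p u x) * crossing p u L (x - 1) \<le> 1"
proof (cases L)
  case 0
  thus ?thesis using right_prob_01[of u x] by simp
next
  case (Suc m)
  have "right_prob p u x * crossing p u L x
      = right_prob p u x + right_prob p u x * odds p u x + right_prob p u x * odds p u x * crossing p u m (x - 1)"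
    unfolding Suc by (simp add: algebra_simps)
  also have "\<dots> = 1 + (1 - right_prob p u x) * crossing p u m (x - 1)"
    unfolding right_prob_odds by simp
  also have "\<dots> \<le> 1 + (1 - right_prob p u x) * crossing p u L (x - 1)"
    using crossing_mono[of u m "x - 1"] right_prob_01[of u x] unfolding Suc
    by (intro add_left_mono mult_left_mono) auto
  finally show ?thesis by simp
qed

text \<open>The function \<open>G\<close> of the overview, normalised to 0 at the origin.\<close>

definition cost :: "nat \<Rightarrow> 'a \<Rightarrow> int \<Rightarrow> real" where
  "cost L \<omega> = isum (crossing p (env \<omega>) L)"

lemma cost_hist [measurable]: "(\<lambda>\<omega>. cost L \<omega> x) \<in> borel_measurable (hist n)"
  unfolding cost_def isum_def by measurable

lemma cost_X_hist: "k \<le> n \<Longrightarrow> (\<lambda>\<omega>. cost L \<omega> (X k \<omega>)) \<in> borel_measurable (hist n)"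
  by (rule measurable_compose_countable[OF cost_hist X_hist])

text \<open>Exponential form of the supermartingale property. The centred cost has nonpositive drift
  and increments bounded by \<open>D\<close>, so its exponential grows by at most the factor
  \<open>1 + (l * D)^2\<close> per step.\<close>

lemma cost_exp_moment:
  fixes D l :: real
  assumes D: "\<And>u x. crossing p u L x + 1 \<le> D" and l: "l \<ge> 0" "l * D \<le> 1"
  shows "(\<integral>\<^sup>+\<omega>. ennreal (exp (l * (cost L \<omega> (X n \<omega>) - cost L \<omega> (X 0 \<omega>) - real n))) \<partial>M)
      \<le> ennreal ((1 + (l * D)^2) ^ n)"
proof (induction n)
  case 0
  show ?case by (simp add: emeasure_space_1)
next
  case (Suc n)
  define h :: "int \<Rightarrow> 'a \<Rightarrow> ennreal" where
    "h j \<omega> = ennreal (exp (l * (cost L \<omega> j - cost L \<omega> (X 0 \<omega>) - real (Suc n))))" for j \<omega>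
  define Y where "Y \<omega> = exp (l * (cost L \<omega> (X n \<omega>) - cost L \<omega> (X 0 \<omega>) - real n))" for \<omega>
  note [measurable] = cost_X_hist[OF le0] cost_X_hist[OF order.refl]
  have h: "h j \<in> borel_measurable (hist n)" for j
    unfolding h_def[abs_def] by measurable
  have Ym: "Y \<in> borel_measurable (hist n)" unfolding Y_def[abs_def] by measurable
  have [measurable]: "Y \<in> borel_measurable M" by (rule hist_meas[OF Ym])
  have le: "ennreal (right_prob p (env \<omega>) (X n \<omega>)) * h (X n \<omega> + 1) \<omega>
         + ennreal (1 - right_prob p (env \<omega>) (X n \<omega>)) * h (X n \<omega> - 1) \<omega> \<le> ennreal (1 + (l * D)^2) * ennreal (Y \<omega>)" for \<omega>
  proof -
    define u x where "u = env \<omega>" and "x = X n \<omega>"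
    define r where "r = right_prob p u x"
    have r: "0 < r" "r < 1" using right_prob_01 by (auto simp: r_def)
    \<comment> \<open>Increments of cost minus time for a step to the right and to the left; their
      mean is nonpositive by \<open>crossing_drift\<close>.\<close>
    define a b where "a = crossing p u L x - 1" and "b = - crossing p u L (x - 1) - 1"
    have up: "cost L \<omega> (x + 1) = cost L \<omega> x + (a + 1)"
      unfolding cost_def u_def[symmetric] isum_succ a_def by simp
    have down: "cost L \<omega> (x - 1) = cost L \<omega> x + (b + 1)"
      using isum_succ[of "crossing p u L" "x - 1"] unfolding cost_def u_def[symmetric] b_def by simp
    have ab: "\<bar>a\<bar> \<le> D" "\<bar>b\<bar> \<le> D"
      using D[of u x] D[of u "x - 1"] crossing_ge_1[of u L x] crossing_ge_1[of u L "x - 1"]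
      by (auto simp: a_def b_def)
    have sq: "exp (l * z) \<le> 1 + l * z + (l * D)^2" if "\<bar>z\<bar> \<le> D" for z
    proof -
      have "\<bar>l * z\<bar> \<le> l * D" using that l by (simp add: abs_mult mult_left_mono)
      moreover from this have "(l * z)^2 \<le> (l * D)^2" by (metis abs_ge_zero power2_abs power_mono)
      ultimately show ?thesis using exp_le_quadratic[of "l * z"] l(2) by linarith
    qed
    have dr: "r * a + (1 - r) * b \<le> 0"
      using crossing_drift[of u x L] unfolding a_def b_def r_def by (simp add: algebra_simps)
    have "r * exp (l * a) + (1 - r) * exp (l * b)
        \<le> r * (1 + l * a + (l * D)^2) + (1 - r) * (1 + l * b + (l * D)^2)"
      using sq[OF ab(1)] sq[OF ab(2)] r by (intro add_mono mult_left_mono) auto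
    also have "\<dots> = 1 + l * (r * a + (1 - r) * b) + (l * D)^2" by (simp add: algebra_simps)
    also have "\<dots> \<le> 1 + (l * D)^2" using dr l by (simp add: mult_le_0_iff)
    finally have main: "r * exp (l * a) + (1 - r) * exp (l * b) \<le> 1 + (l * D)^2" .
    have e1: "h (x + 1) \<omega> = ennreal (exp (l * a) * Y \<omega>)"
      unfolding h_def up Y_def x_def[symmetric] by (simp add: algebra_simps flip: exp_add)
    have e2: "h (x - 1) \<omega> = ennreal (exp (l * b) * Y \<omega>)"
      unfolding h_def down Y_def x_def[symmetric] by (simp add: algebra_simps flip: exp_add)
    have "ennreal r * h (x + 1) \<omega> + ennreal (1 - r) * h (x - 1) \<omega>
        = ennreal ((r * exp (l * a) + (1 - r) * exp (l * b)) * Y \<omega>)"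
      unfolding e1 e2 using r
      by (simp add: algebra_simps Y_def flip: ennreal_mult ennreal_plus)
    also have "\<dots> \<le> ennreal ((1 + (l * D)^2) * Y \<omega>)"
      using main by (intro ennreal_leI mult_right_mono) (auto simp: Y_def)
    also have "\<dots> = ennreal (1 + (l * D)^2) * ennreal (Y \<omega>)"
      by (intro ennreal_mult) (auto simp: Y_def)
    finally show ?thesis unfolding r_def u_def x_def .
  qed
  note one_step[where h = h, OF h]
  also have "(\<integral>\<^sup>+\<omega>. ennreal (right_prob p (env \<omega>) (X n \<omega>)) * h (X n \<omega> + 1) \<omega>
         + ennreal (1 - right_prob p (env \<omega>) (X n \<omega>)) * h (X n \<omega> - 1) \<omega> \<partial>M) \<le> (\<integral>\<^sup>+\<omega>. ennreal (1 + (l * D)^2) * ennreal (Y \<omega>) \<partial>M)"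
    by (intro nn_integral_mono le)
  also have "\<dots> = ennreal (1 + (l * D)^2) * (\<integral>\<^sup>+\<omega>. ennreal (Y \<omega>) \<partial>M)"
    by (rule nn_integral_cmult) measurable
  also have "\<dots> \<le> ennreal (1 + (l * D)^2) * ennreal ((1 + (l * D)^2) ^ n)"
    using Suc unfolding Y_def by (intro mult_left_mono) auto
  also have "\<dots> = ennreal ((1 + (l * D)^2) ^ Suc n)" by (simp add: ennreal_mult)
  finally show ?case unfolding h_def .
qed

lemma cost_eventually:
  fixes e :: real
  assumes e: "0 < e" "e \<le> 1"
  shows "AE \<omega> in M. eventually (\<lambda>n. cost L \<omega> (X n \<omega>) - cost L \<omega> (X 0 \<omega>) < (1 + e) * n) sequentially"
proof -
  obtain C where C: "\<And>u x. crossing p u L x \<le> C" using crossing_bounded by blast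
  define D where "D = C + 1"
  have D: "crossing p u L x + 1 \<le> D" for u x using C[of u x] by (simp add: D_def)
  have D1: "D \<ge> 1" using D[of undefined undefined] crossing_ge_1[of undefined L undefined] by linarith
  \<comment> \<open>The minimiser of \<open>(l * D)^2 - l * e\<close>, with minimum
    \<open>- e^2 / (4 * D^2)\<close>. The resulting Chernoff bound is geometric in n, hence
    summable.\<close>
  define l where "l = e / (2 * D^2)"
  have l: "l > 0" using e D1 by (simp add: l_def)
  have lD: "l * D = e / (2 * D)" using D1 by (simp add: l_def power2_eq_square)
  have lD1: "l * D \<le> 1" unfolding lD using e D1 by (simp add: divide_le_eq)
  define q where "q = exp (- (e^2 / (4 * D^2)))"
  have q: "0 < q" "q < 1" using e D1 by (auto simp: q_def)
  have qb: "(1 + (l * D)^2) * exp (- (l * e)) \<le> q"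
  proof -
    have "(1 + (l * D)^2) * exp (- (l * e)) \<le> exp ((l * D)^2) * exp (- (l * e))"
      by (intro mult_right_mono) auto
    also have "\<dots> = exp ((l * D)^2 - l * e)" by (simp add: exp_diff exp_minus divide_inverse)
    also have "(l * D)^2 - l * e = - (e^2 / (4 * D^2))"
      unfolding lD unfolding l_def using D1 by (simp add: power_divide power2_eq_square field_simps)
    finally show ?thesis unfolding q_def .
  qed
  define Z where "Z n \<omega> = cost L \<omega> (X n \<omega>) - cost L \<omega> (X 0 \<omega>) - real n" for n \<omega>
  have Zm [measurable]: "Z n \<in> borel_measurable M" for n
    unfolding Z_def[abs_def]
    by (intro borel_measurable_diff hist_meas[OF cost_X_hist[OF order.refl]] borel_measurable_const)
  define A where "A n = {\<omega> \<in> space M. Z n \<omega> \<ge> e * n}" for n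
  have A [measurable]: "A n \<in> sets M" for n unfolding A_def by measurable
  have bound: "measure M (A n) \<le> q ^ n" for n
  proof -
    have "emeasure M (A n) = (\<integral>\<^sup>+\<omega>. indicator (A n) \<omega> \<partial>M)" by simp
    also have "\<dots> \<le> (\<integral>\<^sup>+\<omega>. ennreal (exp (- (l * e * n))) * ennreal (exp (l * Z n \<omega>)) \<partial>M)"
    proof (intro nn_integral_mono)
      fix \<omega>
      have "1 \<le> exp (- (l * e * n)) * exp (l * Z n \<omega>)" if "\<omega> \<in> A n"
      proof -
        have "l * (e * n) \<le> l * Z n \<omega>" using that l by (intro mult_left_mono) (auto simp: A_def)
        thus ?thesis by (simp flip: exp_add add: mult.assoc)
      qed
      thus "indicator (A n) \<omega> \<le> ennreal (exp (- (l * e * n))) * ennreal (exp (l * Z n \<omega>))"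
        by (auto simp: indicator_def simp flip: ennreal_mult)
    qed
    also have "\<dots> = ennreal (exp (- (l * e * n))) * (\<integral>\<^sup>+\<omega>. ennreal (exp (l * Z n \<omega>)) \<partial>M)"
      by (rule nn_integral_cmult) measurable
    also have "\<dots> \<le> ennreal (exp (- (l * e * n))) * ennreal ((1 + (l * D)^2) ^ n)"
      using cost_exp_moment[OF D less_imp_le[OF l] lD1, of n] by (intro mult_left_mono) (auto simp: Z_def)
    also have "\<dots> = ennreal (((1 + (l * D)^2) * exp (- (l * e))) ^ n)"
      by (simp add: power_mult_distrib mult.commute flip: ennreal_mult exp_of_nat_mult)
    also have "\<dots> \<le> ennreal (q ^ n)" using qb by (intro ennreal_leI power_mono) auto
    finally show ?thesis using q by (simp add: emeasure_eq_measure)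
  qed
  have "AE \<omega> in M. eventually (\<lambda>n. \<omega> \<in> space M - A n) sequentially"
  proof (rule borel_cantelli_AE1[OF A])
    show "summable (\<lambda>n. measure M (A n))"
      by (rule summable_comparison_test'[of "\<lambda>n. q ^ n" 0]) (use q bound in auto)
  qed (simp add: emeasure_eq_measure)
  thus ?thesis
  proof eventually_elim
    case (elim \<omega>)
    thus ?case by eventually_elim (auto simp: A_def Z_def algebra_simps)
  qed
qed

theorem speed_upper:
  fixes c :: real
  assumes c: "c > 0"
    and lim: "AE \<omega> in M. (\<lambda>n. (\<Sum>k<n. crossing p (env \<omega>) L (int k)) / n) \<longlonglongrightarrow> c"
  shows "AE \<omega> in M. \<forall>d>0::real. eventually (\<lambda>n. X n \<omega> \<le> (1 / c + d) * n) sequentially"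
proof -
  have "AE \<omega> in M. eventually (\<lambda>n. cost L \<omega> (X n \<omega>) - cost L \<omega> (X 0 \<omega>) < (1 + 1 / (real k + 1)) * n) sequentially" for k :: nat
    by (rule cost_eventually) (auto simp: field_simps)
  hence "AE \<omega> in M. \<forall>k::nat. eventually (\<lambda>n. cost L \<omega> (X n \<omega>) - cost L \<omega> (X 0 \<omega>) < (1 + 1 / (real k + 1)) * n) sequentially"
    by (rule AE_all_countable[THEN iffD2, OF allI])
  with lim show ?thesis
  proof eventually_elim
    case (elim \<omega>)
    have ev: "eventually (\<lambda>n. cost L \<omega> (X n \<omega>) \<le> cost L \<omega> (X 0 \<omega>) + (1 + e) * n) sequentially" if "e > 0" for e :: real
    proof -
      obtain k :: nat where k: "1 / (real k + 1) < e" using reals_Archimedean[OF \<open>e > 0\<close>]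
        by (auto simp: inverse_eq_divide add.commute)
      from elim(2)[rule_format, of k] show ?thesis
      proof eventually_elim
        case (elim n)
        have "(1 + 1 / (real k + 1)) * n \<le> (1 + e) * n" using k by (intro mult_right_mono) auto
        with elim show ?case by linarith
      qed
    qed
    have "(\<lambda>n. cost L \<omega> (int n) / n) \<longlonglongrightarrow> c"
      using elim(1) unfolding cost_def isum_nat .
    from speed_upper_of_cost[OF c this ev] show ?case by blast
  qed
qed

end

section \<open>Transience and recurrence\<close>

lemma potential_step:
  assumes "odds p u (x + 1) > 0"
  shows "potential p u (x + 1) = odds p u (x + 1) * potential p u x"
proof (cases "x \<ge> 0")
  case True
  hence "{1..x+1} = insert (x+1) {1..x}" "{x+1+1..0} = {}" "{x+1..0} = {}" by auto
  thus ?thesis by (simp add: potential_def)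
next
  case False
  hence "{x+1..0} = insert (x+1) {x+1+1..0}" "{1..x+1} = {}" "{1..x} = {}" by auto
  thus ?thesis using assms by (simp add: potential_def)
qed

context quenched_walk
begin

lemma potential_pos: "potential p u x > 0"
  unfolding potential_def by (intro divide_pos_pos prod_pos ballI odds_pos)

text \<open>Says that the increments of a function with slopes \<open>potential\<close> average to 0
  under one step; this is why sums of the potential are harmonic.\<close>

lemma potential_balance:
  "right_prob p u x * potential p u x = (1 - right_prob p u x) * potential p u (x - 1)"
proof -
  have "potential p u x = odds p u x * potential p u (x - 1)"
    using potential_step[of p u "x - 1"] odds_pos[of u x] by simp
  hence "right_prob p u x * potential p u x = (right_prob p u x * odds p u x) * potential p u (x - 1)"
    by (simp only: mult.assoc)
  thus ?thesis by (simp only: right_prob_odds)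
qed

lemma measurable_pred_avoid [measurable]: "Measurable.pred (hist n) (\<lambda>\<omega>. \<forall>k\<le>n. X k \<omega> \<notin> B)"
proof -
  have "{\<omega> \<in> space (hist n). X k \<omega> \<notin> B} \<in> sets (hist n)" if "k \<in> {..n}" for k
  proof -
    have "X k -` (- B) \<inter> space (hist n) \<in> sets (hist n)"
      by (rule measurable_sets[OF X_hist]) (use that in auto)
    moreover have "X k -` (- B) \<inter> space (hist n) = {\<omega> \<in> space (hist n). X k \<omega> \<notin> B}" by auto
    ultimately show ?thesis by simp
  qed
  hence "{\<omega> \<in> space (hist n). \<forall>k\<in>{..n}. X k \<omega> \<notin> B} \<in> sets (hist n)"
    by (intro sets.sets_Collect_finite_All finite_atMost)
  thus ?thesis unfolding pred_def Ball_def atMost_iff .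
qed

text \<open>\<open>B\<close> is the set at which the walk is stopped: a half line
  \<open>{b..}\<close> when hitting is to be shown, and empty for transience.\<close>

definition decreasing_harmonic :: "(int \<Rightarrow> int) \<Rightarrow> int set \<Rightarrow> (int \<Rightarrow> real) \<Rightarrow> bool" where
  "decreasing_harmonic u B h \<longleftrightarrow> (\<forall>x. h x > 0) \<and> filterlim h at_top at_bot \<and>
     (\<forall>x. x \<notin> B \<longrightarrow> h (x + 1) < h x \<and> h x < h (x - 1) \<and>
        h x = right_prob p u x * h (x + 1) + (1 - right_prob p u x) * h (x - 1))"

lemma decreasing_harmonicD:
  assumes "decreasing_harmonic u B h"
  shows "h x > 0" "filterlim h at_top at_bot"
    "x \<notin> B \<Longrightarrow> h (x + 1) < h x" "x \<notin> B \<Longrightarrow> h x < h (x - 1)"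
    "x \<notin> B \<Longrightarrow> h x = right_prob p u x * h (x + 1) + (1 - right_prob p u x) * h (x - 1)"
  using assms unfolding decreasing_harmonic_def by blast+

text \<open>Strict Jensen inequality for the reciprocal at two points: with weights r and 1 - r the
  gap equals \<open>r * (1 - r) * (b - a)^2 / (a * b * c)\<close>.\<close>

lemma reciprocal_gain_pos:
  assumes "decreasing_harmonic u B h" "x \<notin> B"
  shows "right_prob p u x * (1 / (1 + h (x + 1))) + (1 - right_prob p u x) * (1 / (1 + h (x - 1))) - 1 / (1 + h x) > 0"
proof -
  define r a b c where "r = right_prob p u x" and "a = 1 + h (x + 1)" and "b = 1 + h (x - 1)" and "c = 1 + h x"
  have r: "0 < r" "r < 1" using right_prob_01 by (auto simp: r_def)
  note D = decreasing_harmonicD[OF assms(1)]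
  have a: "0 < a" "a < c" "c < b" "0 < b" "0 < c"
    using D(1) D(3,4)[OF assms(2)] by (auto simp: a_def b_def c_def intro: add_pos_pos)
  have "r * a + (1 - r) * b = 1 + (r * h (x + 1) + (1 - r) * h (x - 1))"
    by (simp add: a_def b_def algebra_simps)
  also have "\<dots> = c" unfolding c_def r_def D(5)[OF assms(2), symmetric] ..
  finally have a6: "c = r * a + (1 - r) * b" by simp
  have "r / a + (1 - r) / b - 1 / c = ((r * b + (1 - r) * a) * c - a * b) / (a * b * c)"
    using a(1,4,5) by (simp add: field_simps)
  also have "(r * b + (1 - r) * a) * c - a * b = r * (1 - r) * (b - a)^2"
    unfolding a6 by (simp add: algebra_simps power2_eq_square)
  finally have "r / a + (1 - r) / b - 1 / c = r * (1 - r) * (b - a)^2 / (a * b * c)" .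
  moreover have "\<dots> > 0" using r a(1-5) by (intro divide_pos_pos mult_pos_pos zero_less_power) auto
  ultimately show ?thesis unfolding r_def a_def b_def c_def by simp
qed

text \<open>A positive function that is strictly decreasing and harmonic off \<open>B\<close> makes \<open>1 / (1 + h)\<close> a bounded
  strict submartingale, whose summable gains leave only finitely many visits to each site off \<open>B\<close>;
  Fatou's lemma for \<open>h\<close> itself excludes the escape to \<open>-\<infinity>\<close>.\<close>

theorem hits_or_escapes:
  fixes h :: "(int \<Rightarrow> int) \<Rightarrow> int \<Rightarrow> real"
  assumes hm [measurable]: "\<And>x. (\<lambda>u. h u x) \<in> borel_measurable envs"
    and harm: "AE \<omega> in M. decreasing_harmonic (env \<omega>) B (h (env \<omega>))"
  shows "AE \<omega> in M. (\<exists>n. X n \<omega> \<in> B) \<or> filterlim (\<lambda>n. X n \<omega>) at_top sequentially"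
proof -
  define alive where "alive n \<omega> \<longleftrightarrow> (\<forall>k\<le>n. X k \<omega> \<notin> B)" for n \<omega>
  have alive [measurable]: "Measurable.pred (hist n) (alive n)" for n
    unfolding alive_def[abs_def] by (rule measurable_pred_avoid)
  have alive_M [measurable]: "Measurable.pred M (alive n)" for n by (rule hist_meas[OF alive])
  have alive_Suc: "alive (Suc n) \<omega> \<Longrightarrow> alive n \<omega>" for n \<omega> by (auto simp: alive_def)
  define f where "f \<omega> x = h (env \<omega>) x" for \<omega> x
  have f_hist: "(\<lambda>\<omega>. f \<omega> x) \<in> borel_measurable (hist n)" for x n
    unfolding f_def by measurable
  define r where "r \<omega> x = right_prob p (env \<omega>) x" for \<omega> x
  have r: "0 < r \<omega> x" "r \<omega> x < 1" for \<omega> x using right_prob_01 by (auto simp: r_def)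
  have r_hist: "(\<lambda>\<omega>. r \<omega> x) \<in> borel_measurable (hist n)" for x n
    unfolding r_def by measurable
  have at_X: "(\<lambda>\<omega>. g \<omega> (X k \<omega>)) \<in> borel_measurable (hist n)"
    if "\<And>x. (\<lambda>\<omega>. g \<omega> x) \<in> borel_measurable (hist n)" "k \<le> n" for g :: "'a \<Rightarrow> int \<Rightarrow> real" and k n
    by (rule measurable_compose_countable[OF that(1) X_hist[OF that(2)]])
  define t where "t \<omega> x = 1 / (1 + f \<omega> x)" for \<omega> x
  have t_hist: "(\<lambda>\<omega>. t \<omega> x) \<in> borel_measurable (hist n)" for x n
    unfolding t_def using f_hist by measurable
  define gain where "gain \<omega> x = r \<omega> x * t \<omega> (x + 1) + (1 - r \<omega> x) * t \<omega> (x - 1) - t \<omega> x" for \<omega> x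
  have gain_hist: "(\<lambda>\<omega>. gain \<omega> x) \<in> borel_measurable (hist n)" for x n
    unfolding gain_def using t_hist r_hist by measurable
  have AE_pos: "AE \<omega> in M. \<forall>x. f \<omega> x > 0"
    using harm by eventually_elim (simp add: f_def decreasing_harmonicD(1))
  have AE_gain: "AE \<omega> in M. \<forall>x. x \<notin> B \<longrightarrow> gain \<omega> x > 0"
    using harm
  proof eventually_elim
    case (elim \<omega>)
    thus ?case using reciprocal_gain_pos[OF elim] by (simp add: gain_def t_def f_def r_def)
  qed
  \<comment> \<open>After \<open>B\<close> has been hit, \<open>W\<close> is set to the maximal
    value 1 of the bounded submartingale, so stopping can only increase it, and the gains
    \<open>S\<close> telescope to a total mean of at most 1.\<close>
  define S where "S n \<omega> = (if alive n \<omega> then ennreal (gain \<omega> (X n \<omega>)) else 0)" for n \<omega>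
  define W where "W n \<omega> = (if alive n \<omega> then ennreal (t \<omega> (X n \<omega>)) else 1)" for n \<omega>
  note gain_M [measurable] = hist_meas[OF at_X[OF gain_hist order.refl]]
  note t_M [measurable] = hist_meas[OF at_X[OF t_hist order.refl]]
  have S_M [measurable]: "S n \<in> borel_measurable M" for n unfolding S_def[abs_def] by measurable
  have W_M [measurable]: "W n \<in> borel_measurable M" for n unfolding W_def[abs_def] by measurable
  have W_step: "(\<integral>\<^sup>+\<omega>. W n \<omega> \<partial>M) + (\<integral>\<^sup>+\<omega>. S n \<omega> \<partial>M) \<le> (\<integral>\<^sup>+\<omega>. W (Suc n) \<omega> \<partial>M)" for n
  proof -
    define k where "k j \<omega> = (if alive n \<omega> then ennreal (t \<omega> j) else 1)" for j \<omega>
    have k_hist: "k j \<in> borel_measurable (hist n)" for j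
      unfolding k_def[abs_def] using t_hist[of j n] alive[of n] by measurable
    have "(\<integral>\<^sup>+\<omega>. W n \<omega> \<partial>M) + (\<integral>\<^sup>+\<omega>. S n \<omega> \<partial>M) = (\<integral>\<^sup>+\<omega>. W n \<omega> + S n \<omega> \<partial>M)"
      by (rule nn_integral_add[symmetric]) measurable
    also have "\<dots> = (\<integral>\<^sup>+\<omega>. ennreal (right_prob p (env \<omega>) (X n \<omega>)) * k (X n \<omega> + 1) \<omega>
         + ennreal (1 - right_prob p (env \<omega>) (X n \<omega>)) * k (X n \<omega> - 1) \<omega> \<partial>M)"
    proof (rule nn_integral_cong_AE)
      show "AE \<omega> in M. W n \<omega> + S n \<omega> = ennreal (right_prob p (env \<omega>) (X n \<omega>)) * k (X n \<omega> + 1) \<omega>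
         + ennreal (1 - right_prob p (env \<omega>) (X n \<omega>)) * k (X n \<omega> - 1) \<omega>"
        using AE_pos AE_gain
      proof eventually_elim
        case (elim \<omega>)
        define x where "x = X n \<omega>"
        have tp: "t \<omega> y \<ge> 0" for y using elim(1) by (simp add: t_def add_nonneg_nonneg less_imp_le)
        show ?case
        proof (cases "alive n \<omega>")
          case True
          hence "x \<notin> B" by (auto simp: alive_def x_def)
          hence g: "gain \<omega> x \<ge> 0" using elim(2) by (simp add: less_imp_le)
          have "W n \<omega> + S n \<omega> = ennreal (t \<omega> x + gain \<omega> x)"
            using True g tp by (simp add: W_def S_def x_def)
          also have "t \<omega> x + gain \<omega> x = r \<omega> x * t \<omega> (x + 1) + (1 - r \<omega> x) * t \<omega> (x - 1)"
            by (simp add: gain_def)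
          also have "ennreal \<dots> = ennreal (r \<omega> x) * ennreal (t \<omega> (x + 1)) + ennreal (1 - r \<omega> x) * ennreal (t \<omega> (x - 1))"
            using r[of \<omega> x] tp by (simp add: ennreal_mult)
          finally show ?thesis using True by (simp add: k_def r_def x_def)
        next
          case False
          have "ennreal (r \<omega> x) + ennreal (1 - r \<omega> x) = 1"
            using r[of \<omega> x] by (simp flip: ennreal_plus)
          thus ?thesis using False by (simp add: W_def S_def k_def r_def x_def)
        qed
      qed
    qed
    also have "\<dots> = (\<integral>\<^sup>+\<omega>. k (X (Suc n) \<omega>) \<omega> \<partial>M)"
      by (rule one_step[where h = k, OF k_hist, symmetric])
    also have "\<dots> \<le> (\<integral>\<^sup>+\<omega>. W (Suc n) \<omega> \<partial>M)"
    proof (rule nn_integral_mono_AE)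
      show "AE \<omega> in M. k (X (Suc n) \<omega>) \<omega> \<le> W (Suc n) \<omega>" using AE_pos
      proof eventually_elim
        case (elim \<omega>)
        have "t \<omega> y \<le> 1" for y using elim[rule_format, of y] by (simp add: t_def)
        thus ?case using alive_Suc[of n \<omega>] by (auto simp: k_def W_def)
      qed
    qed
    finally show ?thesis .
  qed
  have "(\<integral>\<^sup>+\<omega>. W 0 \<omega> \<partial>M) + (\<Sum>n<N. \<integral>\<^sup>+\<omega>. S n \<omega> \<partial>M) \<le> (\<integral>\<^sup>+\<omega>. W N \<omega> \<partial>M)" for N
  proof (induction N)
    case (Suc N)
    have "(\<integral>\<^sup>+\<omega>. W 0 \<omega> \<partial>M) + (\<Sum>n<Suc N. \<integral>\<^sup>+\<omega>. S n \<omega> \<partial>M)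
        = ((\<integral>\<^sup>+\<omega>. W 0 \<omega> \<partial>M) + (\<Sum>n<N. \<integral>\<^sup>+\<omega>. S n \<omega> \<partial>M)) + (\<integral>\<^sup>+\<omega>. S N \<omega> \<partial>M)"
      by (simp add: add.assoc)
    also have "\<dots> \<le> (\<integral>\<^sup>+\<omega>. W N \<omega> \<partial>M) + (\<integral>\<^sup>+\<omega>. S N \<omega> \<partial>M)" by (intro add_right_mono Suc)
    also have "\<dots> \<le> (\<integral>\<^sup>+\<omega>. W (Suc N) \<omega> \<partial>M)" by (rule W_step)
    finally show ?case .
  qed simp
  moreover have "(\<integral>\<^sup>+\<omega>. W N \<omega> \<partial>M) \<le> 1" for N
  proof -
    have "(\<integral>\<^sup>+\<omega>. W N \<omega> \<partial>M) \<le> (\<integral>\<^sup>+\<omega>. 1 \<partial>M)"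
    proof (rule nn_integral_mono_AE)
      show "AE \<omega> in M. W N \<omega> \<le> 1" using AE_pos
      proof eventually_elim
        case (elim \<omega>)
        have "t \<omega> y \<le> 1" for y using elim[rule_format, of y] by (simp add: t_def)
        thus ?case by (simp add: W_def)
      qed
    qed
    thus ?thesis by (simp add: emeasure_space_1)
  qed
  ultimately have "(\<integral>\<^sup>+\<omega>. W 0 \<omega> \<partial>M) + (\<Sum>n<N. \<integral>\<^sup>+\<omega>. S n \<omega> \<partial>M) \<le> 1" for N
    by (rule order.trans)
  hence S_le: "(\<Sum>n<N. \<integral>\<^sup>+\<omega>. S n \<omega> \<partial>M) \<le> 1" for N
    by (rule order.trans[OF add_increasing[OF zero_le order.refl]])
  have "(\<integral>\<^sup>+\<omega>. (\<Sum>n. S n \<omega>) \<partial>M) = (\<Sum>n. \<integral>\<^sup>+\<omega>. S n \<omega> \<partial>M)"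
    by (rule nn_integral_suminf) measurable
  also have "\<dots> \<le> 1"
    using S_le by (intro suminf_le_const) auto
  finally have "(\<integral>\<^sup>+\<omega>. (\<Sum>n. S n \<omega>) \<partial>M) \<noteq> \<infinity>" by (auto simp: top_unique)
  hence AE_S: "AE \<omega> in M. (\<Sum>n. S n \<omega>) \<noteq> \<infinity>"
    by (intro nn_integral_PInf_AE) measurable
  \<comment> \<open>Division by the value at the start makes the initial mean at most 1, whatever
    the integrability of \<open>h\<close> over environments; after a hit \<open>V\<close> is
    0.\<close>
  define V where "V n \<omega> = (if alive n \<omega> then ennreal (f \<omega> (X n \<omega>) / f \<omega> (X 0 \<omega>)) else 0)" for n \<omega>
  note f_M [measurable] = hist_meas[OF at_X[OF f_hist order.refl]]
  have V_M [measurable]: "V n \<in> borel_measurable M" for n unfolding V_def[abs_def] by measurable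
  have V_le: "(\<integral>\<^sup>+\<omega>. V n \<omega> \<partial>M) \<le> 1" for n
  proof (induction n)
    case 0
    have "(\<integral>\<^sup>+\<omega>. V 0 \<omega> \<partial>M) \<le> (\<integral>\<^sup>+\<omega>. 1 \<partial>M)"
    proof (rule nn_integral_mono)
      show "V 0 \<omega> \<le> 1" for \<omega> by (simp add: V_def)
    qed
    thus ?case by (simp add: emeasure_space_1)
  next
    case (Suc n)
    define k where "k j \<omega> = (if alive n \<omega> then ennreal (f \<omega> j / f \<omega> (X 0 \<omega>)) else 0)" for j \<omega>
    have k_hist: "k j \<in> borel_measurable (hist n)" for j
      unfolding k_def[abs_def] using f_hist[of j n] at_X[OF f_hist le0] alive[of n] by measurable
    have "(\<integral>\<^sup>+\<omega>. V (Suc n) \<omega> \<partial>M) \<le> (\<integral>\<^sup>+\<omega>. k (X (Suc n) \<omega>) \<omega> \<partial>M)"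
    proof (rule nn_integral_mono)
      show "V (Suc n) \<omega> \<le> k (X (Suc n) \<omega>) \<omega>" for \<omega>
        using alive_Suc[of n \<omega>] by (auto simp: V_def k_def)
    qed
    also have "\<dots> = (\<integral>\<^sup>+\<omega>. ennreal (right_prob p (env \<omega>) (X n \<omega>)) * k (X n \<omega> + 1) \<omega>
         + ennreal (1 - right_prob p (env \<omega>) (X n \<omega>)) * k (X n \<omega> - 1) \<omega> \<partial>M)"
      by (rule one_step[where h = k, OF k_hist])
    also have "\<dots> = (\<integral>\<^sup>+\<omega>. V n \<omega> \<partial>M)"
    proof (rule nn_integral_cong_AE)
      show "AE \<omega> in M. ennreal (right_prob p (env \<omega>) (X n \<omega>)) * k (X n \<omega> + 1) \<omega>
         + ennreal (1 - right_prob p (env \<omega>) (X n \<omega>)) * k (X n \<omega> - 1) \<omega> = V n \<omega>"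
        using harm
      proof eventually_elim
        case (elim \<omega>)
        define x z where "x = X n \<omega>" and "z = f \<omega> (X 0 \<omega>)"
        have fp: "f \<omega> y > 0" for y using decreasing_harmonicD(1)[OF elim] by (simp add: f_def)
        show ?case
        proof (cases "alive n \<omega>")
          case True
          hence "x \<notin> B" by (auto simp: alive_def x_def)
          hence e: "f \<omega> x = r \<omega> x * f \<omega> (x + 1) + (1 - r \<omega> x) * f \<omega> (x - 1)"
            unfolding f_def r_def by (intro decreasing_harmonicD(5)[OF elim])
          have split: "ennreal (r \<omega> x) * ennreal a + ennreal (1 - r \<omega> x) * ennreal b = ennreal (r \<omega> x * a + (1 - r \<omega> x) * b)"
            if "0 \<le> a" "0 \<le> b" for a b using that r[of \<omega> x] by (simp add: ennreal_mult)
          have "ennreal (r \<omega> x) * ennreal (f \<omega> (x + 1) / z) + ennreal (1 - r \<omega> x) * ennreal (f \<omega> (x - 1) / z)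
              = ennreal (r \<omega> x * (f \<omega> (x + 1) / z) + (1 - r \<omega> x) * (f \<omega> (x - 1) / z))"
            using fp[THEN less_imp_le] by (intro split) (simp_all add: z_def)
          also have "\<dots> = ennreal (f \<omega> x / z)" by (subst e) (simp add: add_divide_distrib)
          finally show ?thesis using True by (simp add: k_def V_def r_def x_def z_def)
        next
          case False
          thus ?thesis by (simp add: k_def V_def)
        qed
      qed
    qed
    also have "\<dots> \<le> 1" by (rule Suc)
    finally show ?case .
  qed
  have "(\<integral>\<^sup>+\<omega>. liminf (\<lambda>n. V n \<omega>) \<partial>M) \<le> liminf (\<lambda>n. \<integral>\<^sup>+\<omega>. V n \<omega> \<partial>M)"
    by (rule nn_integral_liminf) measurable
  also have "\<dots> \<le> 1"
    by (rule order.trans[OF Liminf_le_Limsup Limsup_bounded]) (auto simp: V_le)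
  finally have "(\<integral>\<^sup>+\<omega>. liminf (\<lambda>n. V n \<omega>) \<partial>M) \<noteq> \<infinity>" by (auto simp: top_unique)
  hence AE_V: "AE \<omega> in M. liminf (\<lambda>n. V n \<omega>) \<noteq> \<infinity>"
    by (intro nn_integral_PInf_AE) measurable
  from harm AE_gain AE_S AE_V AE_nearest_neighbour show ?thesis
  proof eventually_elim
    case (elim \<omega>)
    show ?case
    proof (rule disj_imp[THEN iffD2], rule impI)
      assume "\<not> (\<exists>n. X n \<omega> \<in> B)"
      hence notB: "X n \<omega> \<notin> B" for n by blast
      hence al: "alive n \<omega>" for n by (simp add: alive_def)
      have gp: "gain \<omega> (X n \<omega>) > 0" for n using elim(2) notB by blast
      have "(\<Sum>n. ennreal (gain \<omega> (X n \<omega>))) \<noteq> top" using elim(3) al by (simp add: S_def)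
      hence "summable (\<lambda>n. gain \<omega> (X n \<omega>))"
        using gp by (intro summable_suminf_not_top) (auto intro: less_imp_le)
      \<comment> \<open>For a fixed environment the gain depends only on the current site and is
        positive off \<open>B\<close>, so gains tending to 0 rule out infinitely many visits to one
        site.\<close>
      hence lim0: "(\<lambda>n. gain \<omega> (X n \<omega>)) \<longlonglongrightarrow> 0" by (rule summable_LIMSEQ_zero)
      have "finite {n. X n \<omega> = x}" for x
      proof (cases "x \<in> B")
        case True
        thus ?thesis using notB by (auto intro: finite_subset[of _ "{}"])
      next
        case False
        hence "gain \<omega> x > 0" using elim(2) by blast
        from order_tendstoD(2)[OF lim0 this]
        have "eventually (\<lambda>n. X n \<omega> \<noteq> x) sequentially" by eventually_elim auto
        thus ?thesis by (simp add: eventually_cofinite flip: cofinite_eq_sequentially)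
      qed
      hence "filterlim (\<lambda>n. X n \<omega>) at_top sequentially \<or> filterlim (\<lambda>n. X n \<omega>) at_bot sequentially"
        using elim(5) by (intro nearest_neighbour_escape) auto
      thus "filterlim (\<lambda>n. X n \<omega>) at_top sequentially"
      proof
        assume bot: "filterlim (\<lambda>n. X n \<omega>) at_bot sequentially"
        have fp: "f \<omega> y > 0" for y using decreasing_harmonicD(1)[OF elim(1)] by (simp add: f_def)
        have "filterlim (f \<omega>) at_top at_bot" using decreasing_harmonicD(2)[OF elim(1)] by (simp add: f_def[abs_def])
        hence "filterlim (\<lambda>n. f \<omega> (X n \<omega>)) at_top sequentially" using bot by (rule filterlim_compose)
        hence "filterlim (\<lambda>n. (1 / f \<omega> (X 0 \<omega>)) * f \<omega> (X n \<omega>)) at_top sequentially"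
          using fp by (intro filterlim_tendsto_pos_mult_at_top[OF tendsto_const]) auto
        hence "((\<lambda>n. ennreal ((1 / f \<omega> (X 0 \<omega>)) * f \<omega> (X n \<omega>))) \<longlongrightarrow> top) sequentially"
          by (simp add: ennreal_tendsto_top_eq_at_top)
        hence "((\<lambda>n. V n \<omega>) \<longlongrightarrow> top) sequentially" using al by (simp add: V_def)
        hence "liminf (\<lambda>n. V n \<omega>) = top" by (intro lim_imp_Liminf) auto
        thus ?thesis using elim(4) by simp
      qed
    qed
  qed
qed

end

section \<open>Criteria in terms of the potential\<close>

lemma filterlim_at_bot_of_divergence:
  fixes h V :: "int \<Rightarrow> real"
  assumes V: "\<And>x. V x > 0" and rec: "\<And>x. x < b \<Longrightarrow> h x = V x + h (x + 1)" and h: "\<And>x. h x > 0"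
    and div: "\<not> summable (\<lambda>k. V (- int k))"
  shows "filterlim h at_top at_bot"
proof -
  define m where "m = nat (1 - b)"
  define c where "c = - int m"
  have c: "c < b" by (simp add: c_def m_def)
  have "\<not> summable (\<lambda>k. V (- int (k + m)))"
    using div summable_iff_shift[of "\<lambda>k. V (- int k)" m] by blast
  moreover have "(\<lambda>k. V (- int (k + m))) = (\<lambda>k. V (c - int k))"
    by (intro ext arg_cong[where f = V]) (simp add: c_def)
  ultimately have div': "\<not> summable (\<lambda>k. V (c - int k))" by simp
  have ge: "h (c - int n) \<ge> (\<Sum>k\<le>n. V (c - int k))" for n
  proof (induction n)
    case 0
    show ?case using rec[OF c] h[of "c + 1"] by simp
  next
    case (Suc n)
    have "h (c - int (Suc n)) = V (c - int (Suc n)) + h (c - int n)"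
      using rec[of "c - int (Suc n)"] c by simp
    thus ?case using Suc by simp
  qed
  show ?thesis unfolding filterlim_at_top
  proof
    fix K
    obtain n where n: "(\<Sum>k<n. V (c - int k)) > K"
    proof (rule ccontr)
      assume "\<not> thesis"
      hence "(\<Sum>k<n. V (c - int k)) \<le> K" for n using that not_less by blast
      hence "summable (\<lambda>k. V (c - int k))"
        using V by (intro summableI_nonneg_bounded) (auto intro: less_imp_le)
      thus False using div' by simp
    qed
    have "K \<le> h x" if "x \<le> c - int n" for x
    proof -
      define m where "m = nat (c - x)"
      have m: "x = c - int m" "n \<le> m" using that by (auto simp: m_def)
      have "(\<Sum>k<n. V (c - int k)) \<le> (\<Sum>k\<le>m. V (c - int k))"
        using m V by (intro sum_mono2) (auto intro: less_imp_le)
      also have "\<dots> \<le> h x" unfolding m(1) by (rule ge)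
      finally show ?thesis using n by simp
    qed
    thus "eventually (\<lambda>x. K \<le> h x) at_bot" unfolding eventually_at_bot_linorder by blast
  qed
qed

context quenched_walk
begin

lemma decreasing_harmonicI:
  assumes h: "\<And>x. h x > 0" and rec: "\<And>x. x \<notin> B \<Longrightarrow> h x = potential p u x + h (x + 1)"
    and rec': "\<And>x. x \<notin> B \<Longrightarrow> h (x - 1) = potential p u (x - 1) + h x"
    and lim: "filterlim h at_top at_bot"
  shows "decreasing_harmonic u B h"
  unfolding decreasing_harmonic_def
proof (intro conjI allI impI lim h)
  fix x assume x: "x \<notin> B"
  show "h (x + 1) < h x" "h x < h (x - 1)"
    using rec[OF x] rec'[OF x] potential_pos[of u x] potential_pos[of u "x - 1"] by simp_all
  have "right_prob p u x * h (x + 1) + (1 - right_prob p u x) * h (x - 1)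
      = h x - (right_prob p u x * potential p u x - (1 - right_prob p u x) * potential p u (x - 1))"
    unfolding rec'[OF x] using rec[OF x] by (simp add: algebra_simps)
  thus "h x = right_prob p u x * h (x + 1) + (1 - right_prob p u x) * h (x - 1)"
    unfolding potential_balance by simp
qed

theorem hits_above:
  assumes "AE \<omega> in M. \<not> summable (\<lambda>k. potential p (env \<omega>) (- int k))"
  shows "AE \<omega> in M. \<forall>b. \<exists>n. X n \<omega> \<ge> b"
proof (rule AE_all_countable[THEN iffD2, OF allI])
  fix b :: int
  \<comment> \<open>The summand 1 keeps \<open>h\<close> positive at and beyond \<open>b\<close>,
    where the sum is empty.\<close>
  define h where "h u x = 1 + (\<Sum>y\<in>{x..<b}. potential p u y)" for u x
  have hm: "(\<lambda>u. h u x) \<in> borel_measurable envs" for x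
    unfolding h_def by measurable
  have "AE \<omega> in M. decreasing_harmonic (env \<omega>) {b..} (h (env \<omega>))"
    using assms
  proof eventually_elim
    case (elim \<omega>)
    have rec: "h (env \<omega>) x = potential p (env \<omega>) x + h (env \<omega>) (x + 1)" if "x < b" for x
    proof -
      have "{x..<b} = insert x {x+1..<b}" using that by auto
      thus ?thesis by (simp add: h_def)
    qed
    have pos: "h (env \<omega>) x > 0" for x
      unfolding h_def using potential_pos by (intro add_pos_nonneg sum_nonneg) (auto intro: less_imp_le)
    show ?case
    proof (rule decreasing_harmonicI)
      show "filterlim (h (env \<omega>)) at_top at_bot"
        by (rule filterlim_at_bot_of_divergence[where b = b and V = "potential p (env \<omega>)"])
           (use rec pos potential_pos elim in auto)
      show "h (env \<omega>) x = potential p (env \<omega>) x + h (env \<omega>) (x + 1)" if "x \<notin> {b..}" for x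
        using that by (intro rec) auto
      show "h (env \<omega>) (x - 1) = potential p (env \<omega>) (x - 1) + h (env \<omega>) x" if "x \<notin> {b..}" for x
        using that rec[of "x - 1"] by simp
    qed (rule pos)
  qed
  from hits_or_escapes[OF hm this] show "AE \<omega> in M. \<exists>n. X n \<omega> \<ge> b"
  proof eventually_elim
    case (elim \<omega>)
    thus ?case
    proof
      assume "filterlim (\<lambda>n. X n \<omega>) at_top sequentially"
      hence "eventually (\<lambda>n. b \<le> X n \<omega>) sequentially" by (simp add: filterlim_at_top)
      from eventually_happens[OF this] show ?thesis by auto
    qed auto
  qed
qed

theorem transient_right:
  assumes "AE \<omega> in M. summable (\<lambda>k. potential p (env \<omega>) (int k))"
    and "AE \<omega> in M. \<not> summable (\<lambda>k. potential p (env \<omega>) (- int k))"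
  shows "AE \<omega> in M. filterlim (\<lambda>n. X n \<omega>) at_top sequentially"
proof -
  \<comment> \<open>The tail of the potential is harmonic on the whole line, so the stopping set is
    empty and escape is the only alternative left.\<close>
  define h where "h u x = (\<Sum>k. potential p u (x + int k))" for u x
  have hm: "(\<lambda>u. h u x) \<in> borel_measurable envs" for x
    unfolding h_def by measurable
  have "AE \<omega> in M. decreasing_harmonic (env \<omega>) {} (h (env \<omega>))"
    using assms
  proof eventually_elim
    case (elim \<omega>)
    define V where "V = potential p (env \<omega>)"
    have sm: "summable (\<lambda>k. V (x + int k))" for x
    proof (cases "x \<ge> 0")
      case True
      have "summable (\<lambda>k. V (int (k + nat x)))"
        using elim(1) unfolding V_def by (subst summable_iff_shift)
      thus ?thesis using True by (simp add: add.commute)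
    next
      case False
      have "summable (\<lambda>k. V (x + int (k + nat (- x))))"
        using elim(1) False by (simp add: V_def)
      thus ?thesis by (subst (asm) summable_iff_shift[where f = "\<lambda>k. V (x + int k)"])
    qed
    have rec: "h (env \<omega>) x = V x + h (env \<omega>) (x + 1)" for x
      using suminf_split_head[OF sm[of x]] by (simp add: h_def V_def[symmetric] algebra_simps)
    have pos: "h (env \<omega>) x > 0" for x
      unfolding h_def V_def[symmetric] by (rule suminf_pos[OF sm]) (simp add: V_def potential_pos)
    show ?case
    proof (rule decreasing_harmonicI)
      show "filterlim (h (env \<omega>)) at_top at_bot"
        by (rule filterlim_at_bot_of_divergence[where b = 0 and V = V])
           (use pos potential_pos elim in \<open>auto simp: V_def intro: rec[unfolded V_def]\<close>)
      show "h (env \<omega>) x = potential p (env \<omega>) x + h (env \<omega>) (x + 1)" for x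
        using rec[of x] by (simp add: V_def)
      show "h (env \<omega>) (x - 1) = potential p (env \<omega>) (x - 1) + h (env \<omega>) x" for x
        using rec[of "x - 1"] by (simp add: V_def)
    qed (rule pos)
  qed
  from hits_or_escapes[OF hm this] show ?thesis by simp
qed

end

section \<open>The environment seen from the walker\<close>

definition shift_env :: "(int \<Rightarrow> int) \<Rightarrow> int \<Rightarrow> int" where
  "shift_env u = (\<lambda>i. u (i + 1))"

lemma shift_env_measurable [measurable]: "shift_env \<in> measurable envs envs"
  unfolding shift_env_def[abs_def] by (rule measurable_PiM_single') auto

lemma right_prob_shift: "right_prob p (shift_env u) x = right_prob p u (x + 1)"
  by (simp add: right_prob_def shift_env_def)

lemma odds_shift: "odds p (shift_env u) x = odds p u (x + 1)"
  by (simp add: odds_def right_prob_shift)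

text \<open>\<open>trap p u x\<close> is the mean number of steps from \<open>x\<close> to \<open>x + 1\<close> of the walk started at \<open>x\<close> when it is
  transient to the right, so \<open>visit_weight p u x\<close> is its mean number of visits to \<open>x\<close>.\<close>

definition trap :: "real \<Rightarrow> (int \<Rightarrow> int) \<Rightarrow> int \<Rightarrow> ennreal" where
  "trap p u x = (\<Sum>j. ennreal (\<Prod>i<j. odds p u (x + 1 + int i)))"

lemma trap_measurable [measurable]: "(\<lambda>u. trap p u x) \<in> borel_measurable envs"
  unfolding trap_def by measurable

lemma trap_shift: "trap p (shift_env u) x = trap p u (x + 1)"
  by (simp add: trap_def odds_shift algebra_simps)

definition visit_weight :: "real \<Rightarrow> (int \<Rightarrow> int) \<Rightarrow> int \<Rightarrow> ennreal" where
  "visit_weight p u x = trap p u x * ennreal (1 + odds p u x)"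

lemma visit_weight_measurable [measurable]: "(\<lambda>u. visit_weight p u x) \<in> borel_measurable envs"
  unfolding visit_weight_def by measurable

text \<open>The quenched mean of a product of functions of successive increments for the walk
  started at \<open>x\<close>. With indicators as the functions it gives the probabilities of
  cylinder sets.\<close>

primrec path_weight :: "real \<Rightarrow> (int \<Rightarrow> int) \<Rightarrow> (int \<Rightarrow> ennreal) list \<Rightarrow> int \<Rightarrow> ennreal" where
  "path_weight p u [] x = 1"
| "path_weight p u (F # Fs) x = ennreal (right_prob p u x) * (F 1 * path_weight p u Fs (x + 1))
     + ennreal (1 - right_prob p u x) * (F (- 1) * path_weight p u Fs (x - 1))"

lemma path_weight_measurable [measurable]: "(\<lambda>u. path_weight p u Fs x) \<in> borel_measurable envs"
proof (induction Fs arbitrary: x)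
  case (Cons F Fs)
  note [measurable] = Cons
  show ?case by simp
qed simp

lemma path_weight_shift: "path_weight p (shift_env u) Fs x = path_weight p u Fs (x + 1)"
  by (induction Fs arbitrary: x) (simp_all add: right_prob_shift)

lemma indicator_eq_prod:
  fixes N :: nat
  assumes "x \<in> A \<longleftrightarrow> (\<forall>i<N. y i \<in> G i)"
  shows "indicator A x = (\<Prod>i<N. indicator (G i) (y i) :: ennreal)"
proof (cases "x \<in> A")
  case True
  hence "(\<Prod>i<N. indicator (G i) (y i) :: ennreal) = 1" using assms by (intro prod.neutral) auto
  thus ?thesis using True by simp
next
  case False
  then obtain i where "i < N" "y i \<notin> G i" using assms by auto
  hence "(\<Prod>i<N. indicator (G i) (y i) :: ennreal) = 0"
    by (intro prod_zero bexI[of _ i]) auto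
  thus ?thesis using False by simp
qed

lemma measurable_int_diff:
  fixes f g :: "'a \<Rightarrow> int"
  assumes "f \<in> measurable N (count_space UNIV)" "g \<in> measurable N (count_space UNIV)"
  shows "(\<lambda>\<omega>. f \<omega> - g \<omega>) \<in> measurable N (count_space UNIV)"
proof (rule measurable_compose_countable[OF _ assms(2)])
  show "(\<lambda>\<omega>. f \<omega> - i) \<in> measurable N (count_space UNIV)" for i
    by (rule measurable_compose[OF assms(1)]) simp
qed

context quenched_walk
begin

lemma trap_rec: "trap p u x = 1 + ennreal (odds p u (x + 1)) * trap p u (x + 1)"
proof -
  define f where "f j = ennreal (\<Prod>i<j. odds p u (x + 1 + int i))" for j
  have "f (Suc j) = ennreal (odds p u (x + 1)) * ennreal (\<Prod>i<j. odds p u (x + 1 + 1 + int i))" for j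
    unfolding f_def prod.lessThan_Suc_shift
    by (simp add: ennreal_mult[OF less_imp_le[OF odds_pos] less_imp_le[OF prod_odds_pos]] algebra_simps)
  moreover have f_0: "f 0 = 1" by (simp add: f_def)
  ultimately have "(\<Sum>j. f (Suc j)) = ennreal (odds p u (x + 1)) * trap p u (x + 1)"
    by (simp add: trap_def)
  hence "(\<lambda>j. f (Suc j)) sums (ennreal (odds p u (x + 1)) * trap p u (x + 1))"
    by (metis summableI summable_sums)
  from sums_Suc[OF this] have "f sums (ennreal (odds p u (x + 1)) * trap p u (x + 1) + 1)"
    using f_0 by simp
  thus ?thesis unfolding trap_def f_def[symmetric] by (simp add: sums_iff add.commute)
qed

lemma visit_weight_right: "visit_weight p u x * ennreal (right_prob p u x) = trap p u x"
proof -
  have "ennreal (1 + odds p u x) * ennreal (right_prob p u x) = ennreal ((1 + odds p u x) * right_prob p u x)"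
    using odds_pos[of u x] right_prob_01[of u x] by (intro ennreal_mult[symmetric]) auto
  also have "(1 + odds p u x) * right_prob p u x = 1"
    unfolding one_plus_odds using right_prob_01[of u x] by simp
  finally show ?thesis by (simp add: visit_weight_def mult.assoc)
qed

lemma visit_weight_left:
  "visit_weight p u x * ennreal (1 - right_prob p u x) = ennreal (odds p u x) * trap p u x"
proof -
  have "ennreal (1 + odds p u x) * ennreal (1 - right_prob p u x) = ennreal ((1 + odds p u x) * (1 - right_prob p u x))"
    using odds_pos[of u x] right_prob_01[of u x] by (intro ennreal_mult[symmetric]) auto
  also have "(1 + odds p u x) * (1 - right_prob p u x) = odds p u x"
    unfolding one_plus_odds by (simp add: odds_def)
  finally show ?thesis by (simp add: visit_weight_def mult_ac)
qed

text \<open>Flow balance at a site: \<open>trap p u (x - 1)\<close> is the weight arriving from the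
  left neighbour and the second term the weight arriving from the right. Thus
  \<open>visit_weight p u\<close> is an invariant measure of the quenched chain.\<close>

lemma visit_weight_invariant:
  "trap p u (x - 1) + ennreal (odds p u (x + 1)) * trap p u (x + 1) = visit_weight p u x"
proof -
  have "trap p u (x - 1) + ennreal (odds p u (x + 1)) * trap p u (x + 1)
      = ennreal (odds p u x) * trap p u x + (1 + ennreal (odds p u (x + 1)) * trap p u (x + 1))"
    using trap_rec[of u "x - 1"] by (simp add: add_ac)
  also have "\<dots> = ennreal (odds p u x) * trap p u x + trap p u x"
    by (simp only: trap_rec[of u x, symmetric])
  also have "\<dots> = visit_weight p u x"
    using odds_pos[of u x] by (simp add: visit_weight_def distrib_left mult.commute add.commute)
  finally show ?thesis .
qed

text \<open>A density bounded away from 0 lets almost sure statements return from the reweighted law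
  to the original one.\<close>

lemma visit_weight_ge_1: "visit_weight p u x \<ge> 1"
proof -
  have "1 * 1 \<le> trap p u x * ennreal (1 + odds p u x)"
    using odds_pos[of u x] by (intro mult_mono) (simp_all add: trap_rec[of u x])
  thus ?thesis by (simp add: visit_weight_def)
qed

definition increment :: "nat \<Rightarrow> 'a \<Rightarrow> int" where
  "increment n \<omega> = X (Suc n) \<omega> - X n \<omega>"

lemma increment_meas [measurable]: "increment n \<in> measurable M (count_space UNIV)"
  unfolding increment_def[abs_def] by (intro measurable_int_diff X_meas)

lemma increment_hist: "increment n \<in> measurable (hist (Suc n)) (count_space UNIV)"
  unfolding increment_def[abs_def] by (intro measurable_int_diff X_hist) auto

lemma hist_mono: "f \<in> measurable (hist n) N \<Longrightarrow> f \<in> measurable (hist (Suc n)) N"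
proof -
  assume f: "f \<in> measurable (hist n) N"
  have "sets (hist n) \<subseteq> sets (hist (Suc n))"
    unfolding walk_history_def sets_measure_of[OF hist_generators]
    by (intro sigma_sets_mono') auto
  thus ?thesis using f by (auto simp: measurable_def)
qed

text \<open>Iteration of the Markov property. The factor \<open>f\<close> is there for the
  induction: the function of the first increment is absorbed into it, being measurable for the next
  history.\<close>

lemma path_law:
  assumes "f \<in> borel_measurable (hist n)"
  shows "(\<integral>\<^sup>+\<omega>. f \<omega> * (\<Prod>i<length Fs. (Fs ! i) (increment (n + i) \<omega>)) \<partial>M)
    = (\<integral>\<^sup>+\<omega>. f \<omega> * path_weight p (env \<omega>) Fs (X n \<omega>) \<partial>M)"
  using assms
proof (induction Fs arbitrary: f n)
  case (Cons F Fs)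
  have F: "(\<lambda>\<omega>. F (increment n \<omega>)) \<in> borel_measurable (hist (Suc n))"
    by (rule measurable_compose[OF increment_hist]) simp
  have f': "(\<lambda>\<omega>. f \<omega> * F (increment n \<omega>)) \<in> borel_measurable (hist (Suc n))"
    using hist_mono[OF Cons.prems] F by measurable
  define h where "h j \<omega> = f \<omega> * F (j - X n \<omega>) * path_weight p (env \<omega>) Fs j" for j \<omega>
  have h: "h j \<in> borel_measurable (hist n)" for j
  proof -
    have [measurable]: "(\<lambda>\<omega>. F (j - X n \<omega>)) \<in> borel_measurable (hist n)"
      by (rule measurable_compose[OF X_hist_self]) simp
    show ?thesis unfolding h_def[abs_def] using Cons.prems by measurable
  qed
  have "(\<integral>\<^sup>+\<omega>. f \<omega> * (\<Prod>i<length (F # Fs). ((F # Fs) ! i) (increment (n + i) \<omega>)) \<partial>M)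
     = (\<integral>\<^sup>+\<omega>. (f \<omega> * F (increment n \<omega>)) * (\<Prod>i<length Fs. (Fs ! i) (increment (Suc n + i) \<omega>)) \<partial>M)"
    by (simp add: prod.lessThan_Suc_shift mult.assoc del: prod.lessThan_Suc)
  also have "\<dots> = (\<integral>\<^sup>+\<omega>. (f \<omega> * F (increment n \<omega>)) * path_weight p (env \<omega>) Fs (X (Suc n) \<omega>) \<partial>M)"
    by (rule Cons.IH[OF f'])
  also have "\<dots> = (\<integral>\<^sup>+\<omega>. h (X (Suc n) \<omega>) \<omega> \<partial>M)"
    by (simp add: h_def increment_def)
  also have "\<dots> = (\<integral>\<^sup>+\<omega>. ennreal (right_prob p (env \<omega>) (X n \<omega>)) * h (X n \<omega> + 1) \<omega>
         + ennreal (1 - right_prob p (env \<omega>) (X n \<omega>)) * h (X n \<omega> - 1) \<omega> \<partial>M)"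
    by (rule one_step[where h = h, OF h])
  also have "\<dots> = (\<integral>\<^sup>+\<omega>. f \<omega> * path_weight p (env \<omega>) (F # Fs) (X n \<omega>) \<partial>M)"
    by (intro nn_integral_cong) (simp add: h_def distrib_left mult_ac)
  finally show ?case .
qed simp

lemma integral_shift:
  assumes stat: "distr M envs (\<lambda>\<omega>. shift_env (env \<omega>)) = distr M envs env"
    and [measurable]: "f \<in> borel_measurable envs"
  shows "(\<integral>\<^sup>+\<omega>. f (shift_env (env \<omega>)) \<partial>M) = (\<integral>\<^sup>+\<omega>. f (env \<omega>) \<partial>M)"
proof -
  have "(\<integral>\<^sup>+\<omega>. f (shift_env (env \<omega>)) \<partial>M) = (\<integral>\<^sup>+u. f u \<partial>distr M envs (\<lambda>\<omega>. shift_env (env \<omega>)))"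
    by (subst nn_integral_distr) measurable
  also have "\<dots> = (\<integral>\<^sup>+\<omega>. f (env \<omega>) \<partial>M)"
    unfolding stat by (subst nn_integral_distr) measurable
  finally show ?thesis .
qed

text \<open>Reweighting by \<open>visit_weight\<close> makes the environment seen from the walker stationary.\<close>

lemma path_weight_stationary:
  assumes stat: "distr M envs (\<lambda>\<omega>. shift_env (env \<omega>)) = distr M envs env"
  shows "(\<integral>\<^sup>+\<omega>. visit_weight p (env \<omega>) x * path_weight p (env \<omega>) ((\<lambda>_. 1) # Fs) x \<partial>M)
    = (\<integral>\<^sup>+\<omega>. visit_weight p (env \<omega>) x * path_weight p (env \<omega>) Fs x \<partial>M)"
proof -
  have "(\<integral>\<^sup>+\<omega>. visit_weight p (env \<omega>) x * path_weight p (env \<omega>) ((\<lambda>_. 1) # Fs) x \<partial>M)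
    = (\<integral>\<^sup>+\<omega>. trap p (env \<omega>) x * path_weight p (env \<omega>) Fs (x + 1)
        + ennreal (odds p (env \<omega>) x) * trap p (env \<omega>) x * path_weight p (env \<omega>) Fs (x - 1) \<partial>M)"
    by (intro nn_integral_cong)
       (simp add: distrib_left mult.assoc[symmetric] visit_weight_right visit_weight_left)
  also have "\<dots> = (\<integral>\<^sup>+\<omega>. trap p (env \<omega>) x * path_weight p (env \<omega>) Fs (x + 1) \<partial>M)
      + (\<integral>\<^sup>+\<omega>. ennreal (odds p (env \<omega>) x) * trap p (env \<omega>) x * path_weight p (env \<omega>) Fs (x - 1) \<partial>M)"
    by (rule nn_integral_add) measurable
  \<comment> \<open>After the first step the walk sits at \<open>x + 1\<close> or
    \<open>x - 1\<close>. Stationarity of the environment moves both integrals back to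
    \<open>x\<close>, where flow balance recombines them.\<close>
  also have "(\<integral>\<^sup>+\<omega>. trap p (env \<omega>) x * path_weight p (env \<omega>) Fs (x + 1) \<partial>M)
      = (\<integral>\<^sup>+\<omega>. trap p (env \<omega>) (x - 1) * path_weight p (env \<omega>) Fs x \<partial>M)"
    using integral_shift[OF stat, of "\<lambda>u. trap p u (x - 1) * path_weight p u Fs x"]
    by (simp add: trap_shift path_weight_shift)
  also have "(\<integral>\<^sup>+\<omega>. ennreal (odds p (env \<omega>) x) * trap p (env \<omega>) x * path_weight p (env \<omega>) Fs (x - 1) \<partial>M)
      = (\<integral>\<^sup>+\<omega>. ennreal (odds p (env \<omega>) (x + 1)) * trap p (env \<omega>) (x + 1) * path_weight p (env \<omega>) Fs x \<partial>M)"
    using integral_shift[OF stat, of "\<lambda>u. ennreal (odds p u x) * trap p u x * path_weight p u Fs (x - 1)"]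
    by (simp add: trap_shift path_weight_shift odds_shift)
  also have "(\<integral>\<^sup>+\<omega>. trap p (env \<omega>) (x - 1) * path_weight p (env \<omega>) Fs x \<partial>M)
      + (\<integral>\<^sup>+\<omega>. ennreal (odds p (env \<omega>) (x + 1)) * trap p (env \<omega>) (x + 1) * path_weight p (env \<omega>) Fs x \<partial>M)
      = (\<integral>\<^sup>+\<omega>. trap p (env \<omega>) (x - 1) * path_weight p (env \<omega>) Fs x
        + ennreal (odds p (env \<omega>) (x + 1)) * trap p (env \<omega>) (x + 1) * path_weight p (env \<omega>) Fs x \<partial>M)"
    by (rule nn_integral_add[symmetric]) measurable
  also have "\<dots> = (\<integral>\<^sup>+\<omega>. visit_weight p (env \<omega>) x * path_weight p (env \<omega>) Fs x \<partial>M)"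
    by (simp add: distrib_right[symmetric] visit_weight_invariant)
  finally show ?thesis .
qed

theorem speed_stationary:
  fixes m :: "nat \<Rightarrow> real"
  assumes stat: "distr M envs (\<lambda>\<omega>. shift_env (env \<omega>)) = distr M envs env"
    and mean: "\<And>x j. (\<integral>\<^sup>+\<omega>. ennreal (\<Prod>i<j. odds p (env \<omega>) (x + int i)) \<partial>M) = ennreal (m j)"
    and m: "\<And>j. m j \<ge> 0" "m 0 = 1" "summable m"
    and upper: "AE \<omega> in M. \<forall>d>0::real. eventually (\<lambda>n. X n \<omega> \<le> (1 / (2 * (\<Sum>j. m j) - 1) + d) * n) sequentially"
  shows "AE \<omega> in M. (\<lambda>n. real_of_int (X n \<omega>) / real n) \<longlonglongrightarrow> 1 / (2 * (\<Sum>j. m j) - 1)"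
proof -
  define s where "s = (\<Sum>j. m j)"
  have s1: "s \<ge> 1" using sum_le_suminf[OF m(3), of "{0}"] m(1,2) by (simp add: s_def)
  define v where "v = 1 / (2 * s - 1)"
  define w where "w \<omega> = visit_weight p (env \<omega>) x0" for \<omega>
  have w_hist: "w \<in> borel_measurable (hist n)" for n unfolding w_def[abs_def] by measurable
  have [measurable]: "w \<in> borel_measurable M" by (rule hist_meas[OF w_hist])
  have trap_int: "(\<integral>\<^sup>+\<omega>. trap p (env \<omega>) x \<partial>M) = ennreal s" for x
  proof -
    have "(\<integral>\<^sup>+\<omega>. trap p (env \<omega>) x \<partial>M) = (\<Sum>j. \<integral>\<^sup>+\<omega>. ennreal (\<Prod>i<j. odds p (env \<omega>) (x + 1 + int i)) \<partial>M)"
      unfolding trap_def by (rule nn_integral_suminf) measurable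
    also have "\<dots> = ennreal s" unfolding mean s_def by (rule suminf_ennreal2[OF m(1,3)])
    finally show ?thesis .
  qed
  have odds_trap_int: "(\<integral>\<^sup>+\<omega>. ennreal (odds p (env \<omega>) x) * trap p (env \<omega>) x \<partial>M) = ennreal (s - 1)" for x
  proof -
    have "ennreal s = (\<integral>\<^sup>+\<omega>. 1 + ennreal (odds p (env \<omega>) x) * trap p (env \<omega>) x \<partial>M)"
      using trap_int[of "x - 1"] by (subst (asm) trap_rec) simp
    also have "\<dots> = 1 + (\<integral>\<^sup>+\<omega>. ennreal (odds p (env \<omega>) x) * trap p (env \<omega>) x \<partial>M)"
      by (subst nn_integral_add) (auto simp: emeasure_space_1)
    finally have "1 + (\<integral>\<^sup>+\<omega>. ennreal (odds p (env \<omega>) x) * trap p (env \<omega>) x \<partial>M) = 1 + ennreal (s - 1)"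
      using s1 by (simp flip: ennreal_1 ennreal_plus)
    thus ?thesis by (simp add: ennreal_add_left_cancel)
  qed
  have w_int: "(\<integral>\<^sup>+\<omega>. w \<omega> \<partial>M) = ennreal (2 * s - 1)"
  proof -
    have "w \<omega> = trap p (env \<omega>) x0 + ennreal (odds p (env \<omega>) x0) * trap p (env \<omega>) x0" for \<omega>
      using odds_pos[of "env \<omega>" x0] by (simp add: w_def visit_weight_def distrib_left mult.commute)
    hence "(\<integral>\<^sup>+\<omega>. w \<omega> \<partial>M) = ennreal s + ennreal (s - 1)"
      by (simp add: nn_integral_add trap_int odds_trap_int)
    thus ?thesis using s1 by (simp flip: ennreal_plus)
  qed
  \<comment> \<open>The weight is left unnormalised: total mass \<open>2 * s - 1\<close>, with s for
    first steps to the right and s - 1 for first steps to the left.\<close>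
  define Q where "Q = density M w"
  have Q_sets [measurable_cong]: "sets Q = sets M" by (simp add: Q_def)
  have Q_space: "space Q = space M" by (simp add: Q_def)
  have Q_total: "emeasure Q (space Q) = ennreal (2 * s - 1)"
    unfolding Q_space unfolding Q_def by (subst emeasure_density) (auto simp: w_int cong: nn_integral_cong)
  interpret Q: finite_measure Q by standard (simp add: Q_total)
  have path: "(\<integral>\<^sup>+\<omega>. (\<Prod>i<length Fs. (Fs ! i) (increment i \<omega>)) \<partial>Q)
      = (\<integral>\<^sup>+\<omega>. visit_weight p (env \<omega>) x0 * path_weight p (env \<omega>) Fs x0 \<partial>M)" for Fs
  proof -
    have [measurable]: "(\<lambda>\<omega>. F (increment i \<omega>)) \<in> borel_measurable M" for F :: "int \<Rightarrow> ennreal" and i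
      by (rule measurable_compose[OF increment_meas]) simp
    have "(\<integral>\<^sup>+\<omega>. (\<Prod>i<length Fs. (Fs ! i) (increment i \<omega>)) \<partial>Q)
        = (\<integral>\<^sup>+\<omega>. w \<omega> * (\<Prod>i<length Fs. (Fs ! i) (increment (0 + i) \<omega>)) \<partial>M)"
      unfolding Q_def by (subst nn_integral_density) auto
    also have "\<dots> = (\<integral>\<^sup>+\<omega>. w \<omega> * path_weight p (env \<omega>) Fs (X 0 \<omega>) \<partial>M)"
      by (rule path_law[OF w_hist])
    also have "\<dots> = (\<integral>\<^sup>+\<omega>. visit_weight p (env \<omega>) x0 * path_weight p (env \<omega>) Fs x0 \<partial>M)"
      by (rule nn_integral_cong_AE) (use X_0 in \<open>auto simp: w_def\<close>)
    finally show ?thesis .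
  qed
  define PS where "PS = PiM (UNIV :: nat set) (\<lambda>_. count_space (UNIV :: int set))"
  define D where "D \<omega> = (\<lambda>n. increment n \<omega>)" for \<omega>
  have D_M [measurable]: "D \<in> measurable M PS"
    unfolding D_def[abs_def] PS_def by (rule measurable_PiM_single') (auto simp: increment_meas)
  hence D_Q [measurable]: "D \<in> measurable Q PS" by (simp cong: measurable_cong_sets)
  define T where "T f = (\<lambda>n. f (Suc n))" for f :: "nat \<Rightarrow> int"
  have T_PS [measurable]: "T \<in> measurable PS PS"
    unfolding T_def[abs_def] PS_def by (rule measurable_PiM_single') auto
  define P where "P = distr Q PS D"
  have P_sets [measurable_cong]: "sets P = sets PS" by (simp add: P_def)
  interpret P: finite_measure P unfolding P_def by (rule Q.finite_measure_distr) measurable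
  have coord [measurable]: "(\<lambda>f. f n) \<in> measurable PS (count_space UNIV)" for n
    unfolding PS_def by (rule measurable_component_singleton) simp
  \<comment> \<open>Used with \<open>k = 0\<close> for the law of the increments and with
    \<open>k = 1\<close> for its image under the shift.\<close>
  have cylinder: "emeasure (distr Q PS (\<lambda>\<omega> n. increment (k + n) \<omega>)) (prod_emb UNIV (\<lambda>_. count_space UNIV) J (Pi\<^sub>E J F))
      = (\<integral>\<^sup>+\<omega>. (\<Prod>i<N. indicator (if i \<in> J then F i else UNIV) (increment (k + i) \<omega>)) \<partial>Q)"
    if J: "finite J" "J \<subseteq> {..<N}" for J N k and F :: "nat \<Rightarrow> int set"
  proof -
    have [measurable]: "(\<lambda>\<omega> n. increment (k + n) \<omega>) \<in> measurable Q PS"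
      unfolding PS_def by (rule measurable_PiM_single') (auto simp: increment_meas cong: measurable_cong_sets)
    have emb: "prod_emb UNIV (\<lambda>_. count_space UNIV) J (Pi\<^sub>E J F) \<in> sets PS"
      unfolding PS_def by (rule sets_PiM_I) (use J in auto)
    have "emeasure (distr Q PS (\<lambda>\<omega> n. increment (k + n) \<omega>)) (prod_emb UNIV (\<lambda>_. count_space UNIV) J (Pi\<^sub>E J F))
        = (\<integral>\<^sup>+\<omega>. indicator (prod_emb UNIV (\<lambda>_. count_space UNIV) J (Pi\<^sub>E J F)) (\<lambda>n. increment (k + n) \<omega>) \<partial>Q)"
    proof -
      have "emeasure (distr Q PS (\<lambda>\<omega> n. increment (k + n) \<omega>)) (prod_emb UNIV (\<lambda>_. count_space UNIV) J (Pi\<^sub>E J F))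
          = (\<integral>\<^sup>+f. indicator (prod_emb UNIV (\<lambda>_. count_space UNIV) J (Pi\<^sub>E J F)) f \<partial>distr Q PS (\<lambda>\<omega> n. increment (k + n) \<omega>))"
        using emb by (intro nn_integral_indicator[symmetric]) simp
      also have "\<dots> = (\<integral>\<^sup>+\<omega>. indicator (prod_emb UNIV (\<lambda>_. count_space UNIV) J (Pi\<^sub>E J F)) (\<lambda>n. increment (k + n) \<omega>) \<partial>Q)"
        using emb by (intro nn_integral_distr borel_measurable_indicator) measurable
      finally show ?thesis .
    qed
    also have "\<dots> = (\<integral>\<^sup>+\<omega>. (\<Prod>i<N. indicator (if i \<in> J then F i else UNIV) (increment (k + i) \<omega>)) \<partial>Q)"
    proof (intro nn_integral_cong)
      fix \<omega>
      have "(\<lambda>n. increment (k + n) \<omega>) \<in> prod_emb UNIV (\<lambda>_. count_space UNIV) J (Pi\<^sub>E J F)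
          \<longleftrightarrow> (\<forall>i\<in>J. increment (k + i) \<omega> \<in> F i)"
        by (auto simp: prod_emb_def PiE_iff)
      also have "\<dots> \<longleftrightarrow> (\<forall>i<N. increment (k + i) \<omega> \<in> (if i \<in> J then F i else UNIV))" using J by auto
      finally show "indicator (prod_emb UNIV (\<lambda>_. count_space UNIV) J (Pi\<^sub>E J F)) (\<lambda>n. increment (k + n) \<omega>)
          = (\<Prod>i<N. indicator (if i \<in> J then F i else UNIV) (increment (k + i) \<omega>) :: ennreal)"
        by (rule indicator_eq_prod)
    qed
    finally show ?thesis .
  qed
  have pres: "distr P P T = P"
  proof -
    have TD: "distr P P T = distr Q PS (\<lambda>\<omega> n. increment (1 + n) \<omega>)"
    proof -
      have "distr P P T = distr P PS T" by (rule distr_cong) (auto simp: P_sets)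
      also have "\<dots> = distr Q PS (T \<circ> D)" unfolding P_def by (rule distr_distr) measurable
      also have "T \<circ> D = (\<lambda>\<omega> n. increment (1 + n) \<omega>)" by (simp add: T_def D_def fun_eq_iff)
      finally show ?thesis .
    qed
    have PD: "P = distr Q PS (\<lambda>\<omega> n. increment (0 + n) \<omega>)"
      by (simp add: P_def D_def[abs_def])
    show ?thesis
    proof (rule measure_eqI_PiM_infinite[where I = UNIV and M = "\<lambda>_. count_space UNIV"])
      show "sets (distr P P T) = sets (PiM UNIV (\<lambda>_. count_space UNIV))" "sets P = sets (PiM UNIV (\<lambda>_. count_space UNIV))"
        by (simp_all add: P_sets PS_def)
      show "finite_measure (distr P P T)" by (rule P.finite_measure_distr) (simp add: P_sets cong: measurable_cong_sets)
      fix J :: "nat set" and F :: "nat \<Rightarrow> int set"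
      assume J: "finite J"
      obtain N where N: "J \<subseteq> {..<N}" using finite_nat_bounded[OF J] by blast
      \<comment> \<open>Prefixing the constant function 1 to this list ignores the first increment,
        which is the shift by one step.\<close>
      define Fs :: "(int \<Rightarrow> ennreal) list" where "Fs = map (\<lambda>i. indicator (if i \<in> J then F i else UNIV)) [0..<N]"
      have "emeasure (distr P P T) (prod_emb UNIV (\<lambda>_. count_space UNIV) J (Pi\<^sub>E J F))
          = (\<integral>\<^sup>+\<omega>. (\<Prod>i<N. indicator (if i \<in> J then F i else UNIV) (increment (1 + i) \<omega>)) \<partial>Q)"
        unfolding TD by (rule cylinder[OF J N])
      also have "\<dots> = (\<integral>\<^sup>+\<omega>. (\<Prod>i<length ((\<lambda>_. 1) # Fs). (((\<lambda>_. 1) # Fs) ! i) (increment i \<omega>)) \<partial>Q)"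
        by (auto simp: Fs_def prod.lessThan_Suc_shift simp del: prod.lessThan_Suc intro!: nn_integral_cong prod.cong)
      also have "\<dots> = (\<integral>\<^sup>+\<omega>. (\<Prod>i<length Fs. (Fs ! i) (increment i \<omega>)) \<partial>Q)"
        unfolding path by (rule path_weight_stationary[OF stat])
      also have "\<dots> = (\<integral>\<^sup>+\<omega>. (\<Prod>i<N. indicator (if i \<in> J then F i else UNIV) (increment (0 + i) \<omega>)) \<partial>Q)"
        by (auto simp: Fs_def intro!: nn_integral_cong prod.cong)
      also have "\<dots> = emeasure P (prod_emb UNIV (\<lambda>_. count_space UNIV) J (Pi\<^sub>E J F))"
        unfolding PD by (rule cylinder[OF J N, symmetric])
      finally show "emeasure (distr P P T) (prod_emb UNIV (\<lambda>_. count_space UNIV) J (Pi\<^sub>E J F))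
          = emeasure P (prod_emb UNIV (\<lambda>_. count_space UNIV) J (Pi\<^sub>E J F))" .
    qed
  qed
  \<comment> \<open>Clipping gives a bound at every point of the sequence space; the increments
    themselves are 1 or -1 only almost surely.\<close>
  define g :: "(nat \<Rightarrow> int) \<Rightarrow> real" where "g f = max (- 1) (min 1 (real_of_int (f 0)))" for f
  have g_PS [measurable]: "g \<in> borel_measurable PS"
    unfolding g_def[abs_def] by (rule measurable_compose[OF coord]) simp
  interpret bounded_observable P T g
    by unfold_locales (auto simp: pres g_def P_sets cong: measurable_cong_sets)
  have absM: "AE \<omega> in Q. R \<omega>" if "AE \<omega> in M. R \<omega>" for R
    unfolding Q_def using that by (subst AE_density) auto
  have absQ: "AE \<omega> in M. R \<omega>" if "AE \<omega> in Q. R \<omega>" for R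
  proof -
    have "0 < w \<omega>" for \<omega>
      using visit_weight_ge_1[of "env \<omega>" x0] by (simp add: w_def less_le_trans[OF zero_less_one])
    thus ?thesis using that unfolding Q_def by (subst (asm) AE_density) auto
  qed
  have sum_D: "AE \<omega> in Q. \<forall>n. orbit_sum T g n (D \<omega>) = real_of_int (X n \<omega> - x0)"
    using absM[OF AE_nearest_neighbour] absM[OF X_0]
  proof eventually_elim
    case (elim \<omega>)
    have "(T ^^ i) f n = f (n + i)" for i n f by (induction i arbitrary: n) (auto simp: T_def)
    hence gi: "g ((T ^^ i) (D \<omega>)) = real_of_int (X (Suc i) \<omega>) - real_of_int (X i \<omega>)" for i
      using elim(1)[rule_format, of i] by (auto simp: g_def D_def increment_def)
    show ?case unfolding orbit_sum_def gi using elim(2) sum_lessThan_telescope[of "\<lambda>i. real_of_int (X i \<omega>)"] by simp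
  qed
  \<comment> \<open>Steps to the right have weight s, so the mean is 2 s - (2 s - 1) = 1, which is
    \<open>v\<close> times the total mass.\<close>
  have mean_g: "(\<integral>f. g f \<partial>P) \<ge> v * measure P (space P)"
  proof -
    define E where "E = {\<omega> \<in> space Q. increment 0 \<omega> = 1}"
    have E_sets [measurable]: "E \<in> sets Q"
    proof -
      have "increment 0 -` {1} \<inter> space M \<in> sets M" by (rule measurable_sets[OF increment_meas]) simp
      also have "increment 0 -` {1} \<inter> space M = E" by (auto simp: E_def Q_space)
      finally show ?thesis by (simp add: Q_sets)
    qed
    have "emeasure Q E = (\<integral>\<^sup>+\<omega>. indicator {1} (increment 0 \<omega>) \<partial>Q)"
    proof -
      have "emeasure Q E = (\<integral>\<^sup>+\<omega>. indicator E \<omega> \<partial>Q)" using E_sets by simp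
      also have "\<dots> = (\<integral>\<^sup>+\<omega>. indicator {1} (increment 0 \<omega>) \<partial>Q)"
        by (intro nn_integral_cong) (auto simp: E_def indicator_def)
      finally show ?thesis .
    qed
    also have "\<dots> = (\<integral>\<^sup>+\<omega>. visit_weight p (env \<omega>) x0 * path_weight p (env \<omega>) [indicator {1}] x0 \<partial>M)"
      using path[of "[indicator {1}]"] by simp
    also have "\<dots> = ennreal s" by (simp add: visit_weight_right trap_int)
    finally have QE: "measure Q E = s" using s1 by (simp add: measure_def)
    have QT: "measure Q (space Q) = 2 * s - 1" using s1 by (simp add: measure_def Q_total)
    have "(\<integral>f. g f \<partial>P) = (\<integral>\<omega>. g (D \<omega>) \<partial>Q)" unfolding P_def by (rule integral_distr) measurable
    also have "\<dots> = (\<integral>\<omega>. 2 * indicator E \<omega> - 1 \<partial>Q)"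
    proof (rule integral_cong_AE)
      show "AE \<omega> in Q. g (D \<omega>) = 2 * indicator E \<omega> - 1"
        using absM[OF AE_nearest_neighbour] AE_space
        by eventually_elim (auto simp: g_def D_def E_def increment_def indicator_def dest: spec[of _ 0])
    qed measurable
    also have "\<dots> = 2 * measure Q E - measure Q (space Q)"
    proof -
      have "integrable Q (indicat_real E)" by (rule Q.integrable_const_bound[where B = 1]) auto
      moreover have "E \<inter> space Q = E" by (auto simp: E_def)
      ultimately show ?thesis by (subst Bochner_Integration.integral_diff) auto
    qed
    also have "\<dots> = 1" using QE QT by simp
    finally have "(\<integral>f. g f \<partial>P) = 1" .
    moreover have "measure P (space P) = 2 * s - 1"
      using measure_distr[OF D_Q, of "space PS"] measurable_space[OF D_Q] QT
      by (simp add: P_def) (metis (no_types, lifting) Int_absorb1 subsetI vimageI)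
    ultimately show ?thesis using s1 by (simp add: v_def)
  qed
  have upper_P: "AE f in P. \<forall>e>0. eventually (\<lambda>n. orbit_sum T g n f \<le> n * (v + e)) sequentially"
  proof -
    \<comment> \<open>Countably many tolerances make the property a measurable set of sequences,
      which can be carried from \<open>Q\<close> to the image law \<open>P\<close>.\<close>
    have "AE \<omega> in Q. \<forall>k::nat. \<exists>N. \<forall>n\<ge>N. orbit_sum T g n (D \<omega>) \<le> n * (v + 1 / (real k + 1))"
      using absM[OF upper] sum_D
    proof eventually_elim
      case (elim \<omega>)
      show ?case
      proof
        fix k :: nat
        define d where "d = 1 / (real k + 1) / 2"
        have d: "d > 0" by (simp add: d_def)
        have "eventually (\<lambda>n. real n * d > - real_of_int x0) sequentially"
          using d by real_asymp
        moreover have "eventually (\<lambda>n. X n \<omega> \<le> (v + d) * n) sequentially"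
          using elim(1)[rule_format, OF d] by (simp add: v_def s_def)
        ultimately have "eventually (\<lambda>n. orbit_sum T g n (D \<omega>) \<le> n * (v + 1 / (real k + 1))) sequentially"
        proof eventually_elim
          case (elim n)
          have "orbit_sum T g n (D \<omega>) = real_of_int (X n \<omega>) - real_of_int x0"
            using \<open>\<forall>n. orbit_sum T g n (D \<omega>) = real_of_int (X n \<omega> - x0)\<close> by simp
          also have "\<dots> \<le> (v + d) * n + n * d" using elim by linarith
          also have "\<dots> = n * (v + (d + d))" by (simp add: algebra_simps)
          also have "d + d = 1 / (real k + 1)" unfolding d_def by (rule field_sum_of_halves)
          finally show ?case .
        qed
        thus "\<exists>N. \<forall>n\<ge>N. orbit_sum T g n (D \<omega>) \<le> n * (v + 1 / (real k + 1))"
          unfolding eventually_sequentially .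
      qed
    qed
    moreover have "{f \<in> space PS. \<forall>k::nat. \<exists>N. \<forall>n\<ge>N. orbit_sum T g n f \<le> n * (v + 1 / (real k + 1))} \<in> sets PS"
    proof -
      have [measurable]: "orbit_sum T g n \<in> borel_measurable PS" for n
        using orbit_g_measurable[of n] by (simp add: P_sets cong: measurable_cong_sets)
      show ?thesis by measurable
    qed
    ultimately have "AE f in P. \<forall>k::nat. \<exists>N. \<forall>n\<ge>N. orbit_sum T g n f \<le> n * (v + 1 / (real k + 1))"
      unfolding P_def by (subst AE_distr_iff) auto
    thus ?thesis
    proof eventually_elim
      case (elim f)
      show ?case
      proof (intro allI impI)
        fix e :: real assume "e > 0"
        then obtain k :: nat where k: "1 / (real k + 1) < e" using reals_Archimedean[of e]
          by (auto simp: inverse_eq_divide add.commute)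
        from elim obtain N where N: "\<forall>n\<ge>N. orbit_sum T g n f \<le> n * (v + 1 / (real k + 1))" by blast
        show "eventually (\<lambda>n. orbit_sum T g n f \<le> n * (v + e)) sequentially"
          unfolding eventually_sequentially
        proof (intro exI[of _ N] allI impI)
          fix n assume "n \<ge> N"
          hence "orbit_sum T g n f \<le> n * (v + 1 / (real k + 1))" using N by blast
          also have "\<dots> \<le> n * (v + e)" using k by (intro mult_left_mono) auto
          finally show "orbit_sum T g n f \<le> n * (v + e)" .
        qed
      qed
    qed
  qed
  have "AE f in P. (\<lambda>n. orbit_sum T g n f / n) \<longlonglongrightarrow> v"
    by (rule orbit_average_tendsto[OF upper_P mean_g])
  hence "AE \<omega> in Q. (\<lambda>n. orbit_sum T g n (D \<omega>) / n) \<longlonglongrightarrow> v"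
    unfolding P_def by (rule AE_distrD[OF D_Q])
  with sum_D have "AE \<omega> in Q. (\<lambda>n. real_of_int (X n \<omega>) / real n) \<longlonglongrightarrow> v"
  proof eventually_elim
    case (elim \<omega>)
    have "(\<lambda>n. real_of_int x0 / real n) \<longlonglongrightarrow> 0" by real_asymp
    from tendsto_add[OF elim(2) this]
    have "(\<lambda>n. orbit_sum T g n (D \<omega>) / n + real_of_int x0 / real n) \<longlonglongrightarrow> v" by simp
    moreover have "orbit_sum T g n (D \<omega>) / n + real_of_int x0 / real n = real_of_int (X n \<omega>) / real n" for n
      using elim(1) by (simp add: diff_divide_distrib)
    ultimately show ?case by simp
  qed
  thus ?thesis unfolding v_def s_def by (rule absQ)
qed

end

section \<open>Products over the moving average environment\<close>

abbreviation bit_space :: "(int \<Rightarrow> bool) measure" where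
  "bit_space \<equiv> PiM UNIV (\<lambda>_. count_space UNIV)"

definition maj_env :: "(int \<Rightarrow> bool) \<Rightarrow> int \<Rightarrow> int" where
  "maj_env v = (\<lambda>i. if maj (v i) (v (i + 1)) (v (i + 2)) then 1 else - 1)"

lemma bit_measurable [measurable]: "(\<lambda>v. v i) \<in> measurable bit_space (count_space UNIV)"
  by (rule measurable_component_singleton) simp

lemma bit_pred_measurable: "Measurable.pred bit_space (\<lambda>v. v i)"
  by (rule bit_measurable)

definition window_ratio :: "real \<Rightarrow> (int \<Rightarrow> bool) \<Rightarrow> int \<Rightarrow> real" where
  "window_ratio s v i = maj_ratio s (v i) (v (i + 1)) (v (i + 2))"

lemma maj_measurable:
  assumes "Measurable.pred N f" "Measurable.pred N g" "Measurable.pred N h"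
  shows "Measurable.pred N (\<lambda>v. maj (f v) (g v) (h v))"
  unfolding maj_def by (intro pred_intros_logic assms)

lemma maj_ratio_measurable:
  assumes "Measurable.pred N f" "Measurable.pred N g" "Measurable.pred N h"
  shows "(\<lambda>v. maj_ratio s (f v) (g v) (h v)) \<in> borel_measurable N"
  unfolding maj_ratio_def
  using measurable_compose[OF maj_measurable[OF assms], of "\<lambda>c. if c then s else 1 / s" borel] by simp

lemma window_ratio_measurable [measurable]: "(\<lambda>v. window_ratio s v i) \<in> borel_measurable bit_space"
  unfolding window_ratio_def by (rule maj_ratio_measurable; rule bit_pred_measurable)

lemma maj_env_measurable [measurable]: "maj_env \<in> measurable bit_space envs"
proof (rule measurable_PiM_single')
  show "(\<lambda>v. maj_env v i) \<in> measurable bit_space (count_space UNIV)" for i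
    unfolding maj_env_def
    using measurable_compose[OF maj_measurable[OF bit_pred_measurable bit_pred_measurable bit_pred_measurable],
        of "\<lambda>c. if c then 1 else - 1" "count_space UNIV" i "i + 1" "i + 2"] by simp
qed auto

lemma odds_maj_env:
  assumes "0 < p" "p < 1"
  shows "odds p (maj_env v) i = window_ratio ((1 - p) / p) v i"
  using assms by (simp add: odds_def right_prob_def maj_env_def window_ratio_def maj_ratio_def)

lemma window_ratio_pos: "s > 0 \<Longrightarrow> window_ratio s v i > 0"
  by (simp add: window_ratio_def maj_ratio_def)

lemma maj_ratio_rev: "maj_ratio s x y z = maj_ratio s z y x"
  by (auto simp: maj_ratio_def maj_def)

text \<open>The averaging operator obtained by integrating out the leftmost bit of a product of ratios.\<close>

definition pull_back :: "real \<Rightarrow> real \<Rightarrow> (bool \<Rightarrow> bool \<Rightarrow> real) \<Rightarrow> bool \<Rightarrow> bool \<Rightarrow> real" where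
  "pull_back a s g y z = a * g True y * maj_ratio s True y z + (1 - a) * g False y * maj_ratio s False y z"

text \<open>Integrating out bits on the left yields the same numbers as averaging over new bits on
  the right, with the boundary pair reversed, because the majority is symmetric in its three
  bits.\<close>

lemma pull_back_iterate: "(pull_back a s ^^ j) (\<lambda>_ _. 1) = (\<lambda>y z. prod_mean_from a s j z y)"
proof (induction j)
  case (Suc j)
  show ?case
  proof (intro ext)
    fix y z
    show "(pull_back a s ^^ Suc j) (\<lambda>_ _. 1) y z = prod_mean_from a s (Suc j) z y"
      unfolding funpow.simps comp_apply Suc pull_back_def prod_mean_from.simps
        maj_ratio_rev[of s z y True] maj_ratio_rev[of s z y False] by (simp only: mult_ac)
  qed
qed simp

section \<open>Integrals over independent bits\<close>

locale bernoulli_bits = prob_space M for M :: "'a measure" +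
  fixes a :: real and b :: "int \<Rightarrow> 'a \<Rightarrow> bool"
  assumes indep: "indep_vars (\<lambda>_. count_space UNIV) b UNIV"
    and prob_bit: "\<And>i. prob {\<omega> \<in> space M. b i \<omega>} = a"
begin

definition bits :: "'a \<Rightarrow> int \<Rightarrow> bool" where "bits \<omega> = (\<lambda>i. b i \<omega>)"

lemma b_meas [measurable]: "b i \<in> measurable M (count_space UNIV)"
  using indep unfolding indep_vars_def by blast

lemma bits_meas [measurable]: "bits \<in> measurable M bit_space"
  unfolding bits_def[abs_def] by (rule measurable_PiM_single') (simp_all add: b_meas)

lemma bit_event [measurable]: "{\<omega> \<in> space M. b i \<omega>} \<in> events"
  using b_meas[of i] unfolding pred_def .

lemma prob_not_bit: "prob {\<omega> \<in> space M. \<not> b i \<omega>} = 1 - a"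
proof -
  have "space M - {\<omega> \<in> space M. b i \<omega>} = {\<omega> \<in> space M. \<not> b i \<omega>}" by auto
  with prob_compl[OF bit_event, of i] show ?thesis by (simp only: prob_bit)
qed

lemma integral_bit:
  "(\<integral>\<omega>. (if b i \<omega> then c else d) \<partial>M) = a * c + (1 - a) * (d :: real)"
proof -
  have [simp]: "integrable M (indicat_real {\<omega> \<in> space M. b i \<omega>})"
    by (rule integrable_const_bound[where B = 1]) auto
  have "(\<integral>\<omega>. (if b i \<omega> then c else d) \<partial>M)
      = (\<integral>\<omega>. indicator {\<omega> \<in> space M. b i \<omega>} \<omega> * (c - d) + d \<partial>M)"
    by (intro Bochner_Integration.integral_cong) (auto simp: indicator_def)
  also have "\<dots> = a * (c - d) + d"
    by (subst Bochner_Integration.integral_add)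
       (auto simp: prob_bit prob_space Int_absorb1 intro!: integrable_mult_left)
  finally show ?thesis by (simp add: algebra_simps)
qed

text \<open>Fubini for one bit: by \<open>dep\<close> the function \<open>g c\<close> ignores bit
  \<open>i\<close>, hence depends on the other bits only and is independent of bit
  \<open>i\<close>.\<close>

lemma integral_split_bit:
  fixes g :: "bool \<Rightarrow> (int \<Rightarrow> bool) \<Rightarrow> real"
  assumes g [measurable]: "\<And>c. g c \<in> borel_measurable bit_space" and bd: "\<And>c v. \<bar>g c v\<bar> \<le> K"
    and dep: "\<And>c v d. g c (v(i := d)) = g c v"
  shows "(\<integral>\<omega>. g (b i \<omega>) (bits \<omega>) \<partial>M)
    = a * (\<integral>\<omega>. g True (bits \<omega>) \<partial>M) + (1 - a) * (\<integral>\<omega>. g False (bits \<omega>) \<partial>M)"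
proof -
  define J where "J = UNIV - {i}"
  \<comment> \<open>Extends an assignment of the other bits by the value \<open>False\<close> at
    \<open>i\<close>, so that \<open>g c\<close> can be read as a function on them.\<close>
  define ext where "ext w = (\<lambda>k. if k \<in> J then w k else False)" for w :: "int \<Rightarrow> bool"
  define R where "R \<omega> = restrict (\<lambda>k. b k \<omega>) J" for \<omega>
  define S where "S \<omega> = restrict (\<lambda>k. b k \<omega>) {i}" for \<omega>
  have iv: "indep_var (PiM {i} (\<lambda>_. count_space UNIV)) S (PiM J (\<lambda>_. count_space UNIV)) R"
    unfolding S_def R_def by (rule indep_var_restrict[OF indep]) (auto simp: J_def)
  have [measurable]: "ext \<in> measurable (PiM J (\<lambda>_. count_space UNIV)) bit_space"
    unfolding ext_def[abs_def]
  proof (rule measurable_PiM_single')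
    fix k show "(\<lambda>w. if k \<in> J then w k else False) \<in> measurable (PiM J (\<lambda>_. count_space UNIV)) (count_space UNIV)"
      by (cases "k \<in> J") (auto intro: measurable_component_singleton)
  qed auto
  have bits_ext: "g c (bits \<omega>) = g c (ext (R \<omega>))" for c \<omega>
  proof -
    have "ext (R \<omega>) = (bits \<omega>)(i := False)"
      by (auto simp: ext_def R_def bits_def J_def fun_eq_iff)
    thus ?thesis using dep by simp
  qed
  have main: "(\<integral>\<omega>. indicator {c} (b i \<omega>) * g c (bits \<omega>) \<partial>M)
      = (\<integral>\<omega>. indicator {c} (b i \<omega>) \<partial>M) * (\<integral>\<omega>. g c (bits \<omega>) \<partial>M)" for c
  proof -
    have sm: "(\<lambda>w. indicator {c} (w i) :: real) \<in> borel_measurable (PiM {i} (\<lambda>_. count_space UNIV))"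
      by (rule measurable_compose[OF measurable_component_singleton]) auto
    have "indep_var borel ((\<lambda>w. indicator {c} (w i) :: real) \<circ> S) borel ((\<lambda>w. g c (ext w)) \<circ> R)"
      by (rule indep_var_compose[OF iv sm]) measurable
    hence iv': "indep_var borel (\<lambda>\<omega>. indicator {c} (b i \<omega>) :: real) borel (\<lambda>\<omega>. g c (bits \<omega>))"
      by (simp add: comp_def S_def bits_ext)
    have "(\<lambda>\<omega>. indicator {c} (b i \<omega>) :: real) \<in> borel_measurable M"
      by (rule measurable_compose[OF b_meas]) simp
    hence "integrable M (\<lambda>\<omega>. indicator {c} (b i \<omega>) :: real)"
      by (intro integrable_const_bound[where B = 1]) auto
    moreover have "integrable M (\<lambda>\<omega>. g c (bits \<omega>))"
      using bd by (intro integrable_const_bound[where B = K] measurable_compose[OF bits_meas g]) auto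
    ultimately show ?thesis by (rule indep_var_lebesgue_integral[OF iv'])
  qed
  have int: "integrable M (\<lambda>\<omega>. indicator {c} (b i \<omega>) * g c (bits \<omega>))" for c
  proof -
    have [measurable]: "(\<lambda>\<omega>. indicator {c} (b i \<omega>) :: real) \<in> borel_measurable M"
      by (rule measurable_compose[OF b_meas]) simp
    show ?thesis using bd[of c] order.trans[OF abs_ge_zero bd[of c]]
      by (intro integrable_const_bound[where B = K]) (auto simp: indicator_def abs_mult)
  qed
  have "(\<integral>\<omega>. g (b i \<omega>) (bits \<omega>) \<partial>M)
      = (\<integral>\<omega>. indicator {True} (b i \<omega>) * g True (bits \<omega>) + indicator {False} (b i \<omega>) * g False (bits \<omega>) \<partial>M)"
    by (intro Bochner_Integration.integral_cong) (auto simp: indicator_def)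
  also have "\<dots> = (\<integral>\<omega>. indicator {True} (b i \<omega>) \<partial>M) * (\<integral>\<omega>. g True (bits \<omega>) \<partial>M)
      + (\<integral>\<omega>. indicator {False} (b i \<omega>) \<partial>M) * (\<integral>\<omega>. g False (bits \<omega>) \<partial>M)"
    by (simp only: Bochner_Integration.integral_add[OF int int] main)
  also have "(\<integral>\<omega>. indicator {True} (b i \<omega>) \<partial>M) = a"
    using integral_bit[of i 1 0] by (simp add: indicator_def of_bool_def)
  also have "(\<integral>\<omega>. indicator {False} (b i \<omega>) \<partial>M) = 1 - a"
  proof -
    have "(\<lambda>\<omega>. indicator {False} (b i \<omega>) :: real) = (\<lambda>\<omega>. if b i \<omega> then 0 else 1)"
      by (auto simp: fun_eq_iff)
    thus ?thesis using integral_bit[of i 0 1] by simp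
  qed
  finally show ?thesis .
qed

lemma integral_pair:
  "(\<integral>\<omega>. g (b i \<omega>) (b (i + 1) \<omega>) \<partial>M) = pair_mean a g"
proof -
  define K where "K = \<bar>g True True\<bar> + \<bar>g True False\<bar> + \<bar>g False True\<bar> + \<bar>g False False\<bar>"
  have "(\<integral>\<omega>. g (b i \<omega>) (b (i + 1) \<omega>) \<partial>M) = (\<integral>\<omega>. g (b i \<omega>) (bits \<omega> (i + 1)) \<partial>M)"
    by (simp add: bits_def)
  also have "\<dots>
      = a * (\<integral>\<omega>. g True (bits \<omega> (i + 1)) \<partial>M) + (1 - a) * (\<integral>\<omega>. g False (bits \<omega> (i + 1)) \<partial>M)"
  proof (rule integral_split_bit[where g = "\<lambda>c v. g c (v (i + 1))" and K = K])
    show "(\<lambda>v. g c (v (i + 1))) \<in> borel_measurable bit_space" for c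
      by (rule measurable_compose[OF bit_measurable]) simp
    show "\<bar>g c (v (i + 1))\<bar> \<le> K" for c v
      unfolding K_def by (cases c; cases "v (i + 1)") auto
  qed simp
  finally have split: "(\<integral>\<omega>. g (b i \<omega>) (b (i + 1) \<omega>) \<partial>M)
      = a * (\<integral>\<omega>. g True (bits \<omega> (i + 1)) \<partial>M) + (1 - a) * (\<integral>\<omega>. g False (bits \<omega> (i + 1)) \<partial>M)" .
  have bit: "(\<integral>\<omega>. g c (bits \<omega> (i + 1)) \<partial>M) = a * g c True + (1 - a) * g c False" for c
  proof -
    have "(\<integral>\<omega>. g c (bits \<omega> (i + 1)) \<partial>M) = (\<integral>\<omega>. (if b (i + 1) \<omega> then g c True else g c False) \<partial>M)"
      by (intro Bochner_Integration.integral_cong) (auto simp: bits_def)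
    thus ?thesis by (simp add: integral_bit)
  qed
  show ?thesis unfolding split bit
    by (simp add: pair_mean_def power2_eq_square algebra_simps)
qed

text \<open>The leftmost bit occurs only in \<open>g\<close> and in the first ratio, so integrating
  it out turns \<open>g\<close> into \<open>pull_back a s g\<close> on the next pair. The induction
  needs arbitrary \<open>g\<close>.\<close>

lemma integral_window_prod:
  assumes s: "s > 0"
  shows "(\<integral>\<omega>. g (b x \<omega>) (b (x + 1) \<omega>) * (\<Prod>i<j. window_ratio s (bits \<omega>) (x + int i)) \<partial>M)
    = pair_mean a ((pull_back a s ^^ j) g)"
proof (induction j arbitrary: x g)
  case 0
  show ?case by (simp add: integral_pair)
next
  case (Suc j)
  define P where "P v = (\<Prod>i<j. window_ratio s v (x + 1 + int i))" for v
  have P_meas [measurable]: "P \<in> borel_measurable bit_space" unfolding P_def[abs_def] by measurable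
  define C where "C = max s (1 / s)"
  have C: "C > 0" using s by (auto simp: C_def)
  have rb: "0 \<le> maj_ratio s c y z" "maj_ratio s c y z \<le> C" for c y z using s by (auto simp: maj_ratio_def C_def)
  have Pb: "0 \<le> P v" "P v \<le> C ^ j" for v
  proof -
    show "0 \<le> P v" unfolding P_def using rb by (intro prod_nonneg) (auto simp: window_ratio_def)
    have "P v \<le> (\<Prod>i<j. C)" unfolding P_def using rb by (intro prod_mono) (auto simp: window_ratio_def)
    thus "P v \<le> C ^ j" by simp
  qed
  define K where "K = \<bar>g True True\<bar> + \<bar>g True False\<bar> + \<bar>g False True\<bar> + \<bar>g False False\<bar>"
  define h where "h c v = g c (v (x + 1)) * (maj_ratio s c (v (x + 1)) (v (x + 2)) * P v)" for c v
  have hm: "h c \<in> borel_measurable bit_space" for c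
  proof -
    have [measurable]: "(\<lambda>v. g c (v (x + 1))) \<in> borel_measurable bit_space"
      by (rule measurable_compose[OF bit_measurable]) simp
    have [measurable]: "(\<lambda>v. maj_ratio s c (v (x + 1)) (v (x + 2))) \<in> borel_measurable bit_space"
      by (rule maj_ratio_measurable) (simp_all add: bit_pred_measurable)
    show ?thesis unfolding h_def[abs_def] by measurable
  qed
  have hb: "\<bar>h c v\<bar> \<le> K * (C * C ^ j)" for c v
  proof -
    have "\<bar>g c (v (x + 1))\<bar> \<le> K" unfolding K_def by (cases c; cases "v (x + 1)") auto
    moreover have "\<bar>maj_ratio s c (v (x + 1)) (v (x + 2)) * P v\<bar> \<le> C * C ^ j"
      using rb Pb C by (simp add: abs_mult mult_mono)
    ultimately show ?thesis unfolding h_def abs_mult[of "g _ _"] by (intro mult_mono) (auto simp: K_def)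
  qed
  have hd: "h c (v(x := d)) = h c v" for c v d
    unfolding h_def P_def window_ratio_def by simp
  have hi: "integrable M (\<lambda>\<omega>. h c (bits \<omega>))" for c
    using hb by (intro integrable_const_bound[where B = "K * (C * C ^ j)"] measurable_compose[OF bits_meas hm]) auto
  have "(\<integral>\<omega>. g (b x \<omega>) (b (x + 1) \<omega>) * (\<Prod>i<Suc j. window_ratio s (bits \<omega>) (x + int i)) \<partial>M)
      = (\<integral>\<omega>. h (b x \<omega>) (bits \<omega>) \<partial>M)"
    by (intro Bochner_Integration.integral_cong refl)
       (simp add: prod.lessThan_Suc_shift h_def P_def window_ratio_def bits_def algebra_simps del: prod.lessThan_Suc)
  also have "\<dots> = a * (\<integral>\<omega>. h True (bits \<omega>) \<partial>M) + (1 - a) * (\<integral>\<omega>. h False (bits \<omega>) \<partial>M)"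
    by (rule integral_split_bit[OF hm hb hd])
  also have "\<dots> = (\<integral>\<omega>. a * h True (bits \<omega>) + (1 - a) * h False (bits \<omega>) \<partial>M)"
    using hi by (subst Bochner_Integration.integral_add) auto
  also have "\<dots> = (\<integral>\<omega>. pull_back a s g (b (x + 1) \<omega>) (b (x + 1 + 1) \<omega>)
      * (\<Prod>i<j. window_ratio s (bits \<omega>) (x + 1 + int i)) \<partial>M)"
    by (intro Bochner_Integration.integral_cong refl)
       (simp add: h_def P_def pull_back_def bits_def algebra_simps)
  also have "\<dots> = pair_mean a ((pull_back a s ^^ j) (pull_back a s g))" by (rule Suc)
  finally show ?case by (simp add: funpow_swap1)
qed

lemma integral_ratio_prod:
  assumes s: "s > 0"
  shows "(\<integral>\<^sup>+\<omega>. ennreal (\<Prod>i<j. window_ratio s (bits \<omega>) (x + int i)) \<partial>M) = ennreal (prod_mean a s j)"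
proof -
  define P where "P v = (\<Prod>i<j. window_ratio s v (x + int i))" for v
  have P_meas: "P \<in> borel_measurable bit_space" unfolding P_def[abs_def] by measurable
  define C where "C = max s (1 / s)"
  have rb: "0 \<le> maj_ratio s c y z" "maj_ratio s c y z \<le> C" for c y z using s by (auto simp: maj_ratio_def C_def)
  have Pb: "0 \<le> P v" "P v \<le> C ^ j" for v
  proof -
    show "0 \<le> P v" unfolding P_def using rb by (intro prod_nonneg) (auto simp: window_ratio_def)
    have "P v \<le> (\<Prod>i<j. C)" unfolding P_def using rb by (intro prod_mono) (auto simp: window_ratio_def)
    thus "P v \<le> C ^ j" by simp
  qed
  have "integrable M (\<lambda>\<omega>. P (bits \<omega>))"
    by (rule integrable_const_bound[where B = "C ^ j"]) (simp_all add: Pb measurable_compose[OF bits_meas P_meas])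
  hence "(\<integral>\<^sup>+\<omega>. ennreal (P (bits \<omega>)) \<partial>M) = ennreal (\<integral>\<omega>. P (bits \<omega>) \<partial>M)"
    by (rule nn_integral_eq_integral) (simp add: Pb)
  also have "(\<integral>\<omega>. P (bits \<omega>) \<partial>M) = pair_mean a ((pull_back a s ^^ j) (\<lambda>_ _. 1))"
    using integral_window_prod[OF s, of "\<lambda>_ _. 1" x j] by (simp only: P_def mult_1_left)
  also have "\<dots> = prod_mean a s j"
    \<comment> \<open>The reversal of the pair disappears because \<open>pair_mean\<close> is
      symmetric in the two bits.\<close>
    unfolding pull_back_iterate prod_mean_def pair_mean_def by (simp only: add.commute)
  finally show ?thesis unfolding P_def .
qed

end

section \<open>A strong law of large numbers for finite windows\<close>

text \<open>Overlapping windows are dependent, but along one residue class they are disjoint.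
  Averages over the classes combine; the incomplete last group has fewer than \<open>d\<close>
  terms.\<close>

lemma average_of_residue_averages:
  fixes y :: "nat \<Rightarrow> real" and \<mu> :: real
  assumes d: "d > 0" and bd: "\<And>k. \<bar>y k\<bar> \<le> C"
    and lim: "\<And>r. r < d \<Longrightarrow> (\<lambda>n. (\<Sum>k<n. y (k * d + r)) / n) \<longlonglongrightarrow> \<mu>"
  shows "(\<lambda>n. (\<Sum>k<n. y k) / n) \<longlonglongrightarrow> \<mu>"
proof -
  define S where "S n = (\<Sum>k<n. y k)" for n
  have "S (n * d) = (\<Sum>r<d. \<Sum>k<n. y (k * d + r))" for n
  proof -
    have "S (n * d) = (\<Sum>k<n. \<Sum>j\<in>{k*d..<k*d+d}. y j)"
      unfolding S_def by (rule sum.nat_group[symmetric])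
    also have "\<dots> = (\<Sum>k<n. \<Sum>r<d. y (k * d + r))"
    proof (rule sum.cong[OF refl])
      fix k
      have "(\<Sum>j\<in>{0+k*d..<d+k*d}. y j) = (\<Sum>r\<in>{0..<d}. y (r + k * d))"
        by (rule sum.shift_bounds_nat_ivl)
      thus "(\<Sum>j\<in>{k*d..<k*d+d}. y j) = (\<Sum>r<d. y (k * d + r))"
        by (simp add: add.commute atLeast0LessThan)
    qed
    also have "\<dots> = (\<Sum>r<d. \<Sum>k<n. y (k * d + r))" by (rule sum.swap)
    finally show ?thesis .
  qed
  hence Sd: "S (n * d) / n = (\<Sum>r<d. (\<Sum>k<n. y (k * d + r)) / n)" for n
    by (simp add: sum_divide_distrib)
  have "(\<lambda>n. S (n * d) / n) \<longlonglongrightarrow> (\<Sum>r<d. \<mu>)"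
    unfolding Sd by (intro tendsto_sum lim) auto
  hence lim_d: "(\<lambda>n. S (n * d) / n) \<longlonglongrightarrow> d * \<mu>" by simp
  have divtop: "filterlim (\<lambda>n. n div d) at_top sequentially"
    unfolding filterlim_at_top
  proof
    fix K
    show "eventually (\<lambda>n. K \<le> n div d) sequentially"
      using eventually_ge_at_top[of "K * d"] by eventually_elim (use d in \<open>simp add: less_eq_div_iff_mult_less_eq\<close>)
  qed
  have l1: "(\<lambda>n. S (n div d * d) / (n div d)) \<longlonglongrightarrow> d * \<mu>"
    using filterlim_compose[OF lim_d divtop] by simp
  have l0: "(\<lambda>n. (C * d) / real n) \<longlonglongrightarrow> 0"
    using tendsto_const lim_const_over_n by blast
  have l0': "(\<lambda>n. real d / real n) \<longlonglongrightarrow> 0" using lim_const_over_n by blast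
  have l2: "(\<lambda>n. real (n div d) / real n) \<longlonglongrightarrow> 1 / d"
  proof -
    have "(\<lambda>n. real (n div d) / real n - 1 / d) \<longlonglongrightarrow> 0"
    proof (rule Lim_null_comparison)
      show "eventually (\<lambda>n. norm (real (n div d) / real n - 1 / d) \<le> real d / real n) sequentially"
        using eventually_gt_at_top[of 0]
      proof eventually_elim
        case (elim n)
        have "real n = real d * real (n div d) + real (n mod d)"
          by (metis mult_div_mod_eq of_nat_add of_nat_mult)
        hence "real (n div d) / real n - 1 / d = - (real (n mod d) / (real d * real n))"
          using elim d by (simp add: field_simps)
        also have "norm \<dots> = real (n mod d) / (real d * real n)" by simp
        also have "\<dots> \<le> real d / (1 * real n)"
          using elim d mod_less_divisor[OF d, of n] by (intro frac_le mult_right_mono) auto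
        finally show ?case by simp
      qed
      show "(\<lambda>n. real d / real n) \<longlonglongrightarrow> 0" by (rule l0')
    qed
    thus ?thesis by (rule LIM_zero_cancel)
  qed
  have "(\<lambda>n. S n / n - S (n div d * d) / (n div d) * (real (n div d) / real n)) \<longlonglongrightarrow> 0"
  proof (rule Lim_null_comparison)
    show "eventually (\<lambda>n. norm (S n / n - S (n div d * d) / (n div d) * (real (n div d) / real n)) \<le> (C * d) / real n) sequentially"
      using eventually_ge_at_top[of d]
    proof eventually_elim
      case (elim n)
      have n: "n > 0" "n div d > 0" using elim d by (auto simp: div_greater_zero_iff)
      have le: "n div d * d \<le> n" by simp
      have "S n - S (n div d * d) = (\<Sum>k\<in>{n div d * d..<n}. y k)"
        unfolding S_def using sum_diff_nat_ivl[of 0 "n div d * d" n y] le by (simp add: atLeast0LessThan)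
      also have "\<bar>\<dots>\<bar> \<le> (\<Sum>k\<in>{n div d * d..<n}. C)"
        by (rule order.trans[OF sum_abs sum_mono]) (rule bd)
      also have "\<dots> = real (n mod d) * C" by (simp add: minus_div_mult_eq_mod)
      also have "\<dots> \<le> real d * C"
        using mod_less_divisor[OF d, of n] order.trans[OF abs_ge_zero bd[of 0]] by (intro mult_right_mono) auto
      finally have "\<bar>S n - S (n div d * d)\<bar> \<le> C * d" by (simp add: mult.commute)
      moreover have "S n / n - S (n div d * d) / (n div d) * (real (n div d) / real n) = (S n - S (n div d * d)) / n"
        using n by (simp add: diff_divide_distrib)
      ultimately show ?case using n by (simp add: abs_divide divide_right_mono)
    qed
  qed (rule l0)
  from tendsto_add[OF this tendsto_mult[OF l1 l2]] show ?thesis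
    using d by (simp add: S_def)
qed

context bernoulli_bits
begin

text \<open>A function of the bits in \<open>K j\<close> factors through the restriction to
  \<open>K j\<close>; the bits outside are filled with \<open>False\<close>, and disjoint blocks are
  independent.\<close>

lemma indep_blocks:
  assumes disj: "disjoint_family_on K J"
    and H: "\<And>j. j \<in> J \<Longrightarrow> H j \<in> measurable bit_space (N j)"
    and dep: "\<And>j v v'. j \<in> J \<Longrightarrow> (\<And>k. k \<in> K j \<Longrightarrow> v k = v' k) \<Longrightarrow> H j v = H j v'"
  shows "indep_vars N (\<lambda>j \<omega>. H j (bits \<omega>)) J"
proof -
  define ext where "ext j w = (\<lambda>k. if k \<in> K j then w k else False)" for j and w :: "int \<Rightarrow> bool"
  have ext: "ext j \<in> measurable (PiM (K j) (\<lambda>_. count_space UNIV)) bit_space" for j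
    unfolding ext_def[abs_def]
  proof (rule measurable_PiM_single')
    fix k show "(\<lambda>w. if k \<in> K j then w k else False) \<in> measurable (PiM (K j) (\<lambda>_. count_space UNIV)) (count_space UNIV)"
      by (cases "k \<in> K j") (auto intro: measurable_component_singleton)
  qed auto
  have "indep_vars (\<lambda>j. PiM (K j) (\<lambda>_. count_space UNIV)) (\<lambda>j \<omega>. restrict (\<lambda>k. b k \<omega>) (K j)) J"
    by (rule indep_vars_restrict[OF indep _ disj]) auto
  hence "indep_vars N (\<lambda>j \<omega>. H j (ext j (restrict (\<lambda>k. b k \<omega>) (K j)))) J"
    by (rule indep_vars_compose2[where Y = "\<lambda>j w. H j (ext j w)"]) (rule measurable_compose[OF ext H])
  moreover have "H j (ext j (restrict (\<lambda>k. b k \<omega>) (K j))) = H j (bits \<omega>)" if "j \<in> J" for j \<omega>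
    by (rule dep[OF that]) (simp add: ext_def bits_def)
  hence "indep_vars N (\<lambda>j \<omega>. H j (ext j (restrict (\<lambda>k. b k \<omega>) (K j)))) J
      \<longleftrightarrow> indep_vars N (\<lambda>j \<omega>. H j (bits \<omega>)) J"
    by (intro indep_vars_cong) simp_all
  ultimately show ?thesis by simp
qed

text \<open>Covers the symmetries used later: shifts, reflections and, with \<open>1 - a\<close>,
  flips combined with reflections.\<close>

lemma reindex:
  assumes "inj f"
  shows "bernoulli_bits M a (\<lambda>i \<omega>. b (f i) \<omega>)" "bernoulli_bits M (1 - a) (\<lambda>i \<omega>. \<not> b (f i) \<omega>)"
proof -
  have disj: "disjoint_family_on (\<lambda>j. {f j}) UNIV"
    using assms by (auto simp: disjoint_family_on_def inj_def)
  have "indep_vars (\<lambda>_. count_space UNIV) (\<lambda>j \<omega>. bits \<omega> (f j)) UNIV"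
    by (rule indep_blocks[OF disj, where H = "\<lambda>j v. v (f j)"]) (simp_all add: bit_measurable)
  hence 1: "indep_vars (\<lambda>_. count_space UNIV) (\<lambda>j \<omega>. b (f j) \<omega>) UNIV" by (simp add: bits_def)
  have "indep_vars (\<lambda>_. count_space UNIV) (\<lambda>j \<omega>. \<not> bits \<omega> (f j)) UNIV"
    by (rule indep_blocks[OF disj, where H = "\<lambda>j v. \<not> v (f j)"])
       (simp_all add: measurable_compose[OF bit_measurable])
  hence 2: "indep_vars (\<lambda>_. count_space UNIV) (\<lambda>j \<omega>. \<not> b (f j) \<omega>) UNIV" by (simp add: bits_def)
  show "bernoulli_bits M a (\<lambda>i \<omega>. b (f i) \<omega>)"
    by unfold_locales (simp_all add: 1 prob_bit)
  show "bernoulli_bits M (1 - a) (\<lambda>i \<omega>. \<not> b (f i) \<omega>)"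
    by unfold_locales (simp_all add: 2 prob_not_bit)
qed

text \<open>The joint law is determined by \<open>a\<close>, so every symmetry that preserves
  \<open>a\<close> preserves the law.\<close>

lemma bits_law: "distr M bit_space bits = PiM UNIV (\<lambda>_. measure_pmf (bernoulli_pmf a))"
proof -
  have a: "0 \<le> a" "a \<le> 1" using prob_bit[of 0] by auto
  have marg: "distr M (count_space UNIV) (b i) = measure_pmf (bernoulli_pmf a)" for i
  proof (rule measure_eqI_finite[where A = UNIV])
    fix c :: bool
    have "emeasure (distr M (count_space UNIV) (b i)) {c} = ennreal (prob (b i -` {c} \<inter> space M))"
      by (simp add: emeasure_distr emeasure_eq_measure)
    also have "prob (b i -` {c} \<inter> space M) = (if c then a else 1 - a)"
    proof (cases c)
      case True
      have "b i -` {c} \<inter> space M = {\<omega> \<in> space M. b i \<omega>}" using True by auto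
      thus ?thesis using True by (simp add: prob_bit)
    next
      case False
      have "b i -` {c} \<inter> space M = {\<omega> \<in> space M. \<not> b i \<omega>}" using False by auto
      thus ?thesis using False by (simp add: prob_not_bit)
    qed
    also have "ennreal \<dots> = emeasure (measure_pmf (bernoulli_pmf a)) {c}"
      using a by (cases c) (simp_all add: emeasure_pmf_single)
    finally show "emeasure (distr M (count_space UNIV) (b i)) {c} = emeasure (measure_pmf (bernoulli_pmf a)) {c}" .
  qed auto
  have "distr M bit_space (\<lambda>\<omega>. \<lambda>i\<in>UNIV. b i \<omega>) = (\<Pi>\<^sub>M i\<in>UNIV. distr M (count_space UNIV) (b i))"
    using indep by (subst (asm) indep_vars_iff_distr_eq_PiM') (auto simp: b_meas)
  thus ?thesis unfolding marg by (simp add: bits_def[abs_def] restrict_UNIV)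
qed

lemma distr_bits_reindex:
  assumes "inj f"
  shows "distr M bit_space (\<lambda>\<omega> i. b (f i) \<omega>) = distr M bit_space bits"
proof -
  interpret B: bernoulli_bits M a "\<lambda>i \<omega>. b (f i) \<omega>" by (rule reindex(1)[OF assms])
  show ?thesis using B.bits_law unfolding bits_law B.bits_def[abs_def] by simp
qed

lemma distr_bits_flip:
  assumes "a = 1 / 2"
  shows "distr M bit_space (\<lambda>\<omega> i. \<not> b i \<omega>) = distr M bit_space bits"
proof -
  interpret B: bernoulli_bits M "1 - a" "\<lambda>i \<omega>. \<not> b i \<omega>" using reindex(2)[of "\<lambda>i. i"] by simp
  show ?thesis using B.bits_law unfolding bits_law B.bits_def[abs_def] by (simp add: assms)
qed

text \<open>Along each residue class modulo the window length the values are independent and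
  bounded; Hoeffding's inequality and Borel-Cantelli give the limit there.\<close>

lemma window_SLLN:
  fixes H :: "(int \<Rightarrow> bool) \<Rightarrow> real"
  assumes H [measurable]: "H \<in> borel_measurable bit_space" and bd: "\<And>v. \<bar>H v\<bar> \<le> C"
    and dep: "\<And>v v'. (\<And>k. - int m \<le> k \<Longrightarrow> k \<le> int m \<Longrightarrow> v k = v' k) \<Longrightarrow> H v = H v'"
  shows "AE \<omega> in M. (\<lambda>n. (\<Sum>k<n. H (\<lambda>i. bits \<omega> (i + int k))) / n) \<longlonglongrightarrow> (\<integral>\<omega>. H (bits \<omega>) \<partial>M)"
proof -
  define \<mu> where "\<mu> = (\<integral>\<omega>. H (bits \<omega>) \<partial>M)"
  \<comment> \<open>Strictly positive even if \<open>C = 0\<close>, so that the Hoeffding exponent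
    is a genuine quotient.\<close>
  define c where "c = C + 1"
  have C0: "C \<ge> 0" using order.trans[OF abs_ge_zero bd] .
  have c: "c > 0" using C0 by (simp add: c_def)
  define sh where "sh t v = (\<lambda>i. v (i + t))" for t :: int and v :: "int \<Rightarrow> bool"
  have sh [measurable]: "sh t \<in> measurable bit_space bit_space" for t
    unfolding sh_def[abs_def] by (rule measurable_PiM_single') (auto intro: bit_measurable)
  \<comment> \<open>The number of bits in a window from \<open>- m\<close> to \<open>m\<close>:
    windows shifted by multiples of \<open>d\<close> are disjoint.\<close>
  define d where "d = 2 * m + 1"
  have d: "d > 0" by (simp add: d_def)
  define Z where "Z r k \<omega> = H (sh (int (k * d + r)) (bits \<omega>))" for r k \<omega>
  have Zm [measurable]: "Z r k \<in> borel_measurable M" for r k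
    unfolding Z_def[abs_def] by measurable
  have EZ: "expectation (Z r k) = \<mu>" for r k
  proof -
    define t where "t = int (k * d + r)"
    have "(\<integral>\<omega>. H (sh t (bits \<omega>)) \<partial>M) = (\<integral>v. H v \<partial>distr M bit_space (\<lambda>\<omega> i. b (i + t) \<omega>))"
      by (subst integral_distr) (auto simp: sh_def bits_def[abs_def] intro!: measurable_PiM_single' b_meas)
    also have "distr M bit_space (\<lambda>\<omega> i. b (i + t) \<omega>) = distr M bit_space bits"
      by (rule distr_bits_reindex) (auto simp: inj_def)
    also have "(\<integral>v. H v \<partial>distr M bit_space bits) = \<mu>"
      unfolding \<mu>_def by (subst integral_distr) auto
    finally show ?thesis by (simp add: Z_def[abs_def] t_def)
  qed
  have indZ: "indep_vars (\<lambda>_. borel) (Z r) UNIV" for r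
    unfolding Z_def[abs_def]
  proof (rule indep_blocks[where K = "\<lambda>k. {int (k * d + r) - int m .. int (k * d + r) + int m}"
        and H = "\<lambda>k v. H (sh (int (k * d + r)) v)"])
    show "disjoint_family_on (\<lambda>k. {int (k * d + r) - int m .. int (k * d + r) + int m}) UNIV"
      unfolding disjoint_family_on_def
    proof (intro ballI impI)
      have *: "{int (k * d + r) - int m .. int (k * d + r) + int m} \<inter> {int (l * d + r) - int m .. int (l * d + r) + int m} = {}"
        if "k < l" for k l
      proof -
        have "Suc k * d \<le> l * d" using that by (intro mult_right_mono) auto
        hence "k * d + d \<le> l * d" by (simp add: add.commute)
        hence "int (k * d) + int d \<le> int (l * d)" by linarith
        hence "int (k * d + r) + int m < int (l * d + r) - int m" by (simp add: d_def del: of_nat_mult)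
        thus ?thesis by auto
      qed
      fix k l :: nat assume "k \<noteq> l"
      thus "{int (k * d + r) - int m .. int (k * d + r) + int m} \<inter> {int (l * d + r) - int m .. int (l * d + r) + int m} = {}"
        using *[of k l] *[of l k] by (cases "k < l") (auto simp: Int_commute)
    qed
    show "(\<lambda>v. H (sh (int (k * d + r)) v)) \<in> borel_measurable bit_space" for k by measurable
    show "H (sh (int (k * d + r)) v) = H (sh (int (k * d + r)) v')"
      if "\<And>i. i \<in> {int (k * d + r) - int m .. int (k * d + r) + int m} \<Longrightarrow> v i = v' i" for k v v'
      by (rule dep) (auto simp: sh_def intro!: that)
  qed
  have conv: "AE \<omega> in M. (\<lambda>n. (\<Sum>k<n. Z r k \<omega>) / n) \<longlonglongrightarrow> \<mu>" for r
  proof -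
    have "AE \<omega> in M. eventually (\<lambda>n. \<bar>(\<Sum>k<n. Z r k \<omega>) - n * \<mu>\<bar> < n * e) sequentially" if e: "e > 0" for e :: real
    proof -
      define A where "A n = {\<omega> \<in> space M. \<bar>(\<Sum>k<n. Z r k \<omega>) - n * \<mu>\<bar> \<ge> n * e}" for n
      have A [measurable]: "A n \<in> sets M" for n unfolding A_def by measurable
      define q where "q = exp (- (e^2 / (2 * c^2)))"
      have q: "0 < q" "q < 1" using e c by (auto simp: q_def)
      have bound: "prob (A n) \<le> 2 * q ^ n" if n: "n > 0" for n
      proof -
        interpret H: Hoeffding_ineq M "{..<n}" "Z r" "\<lambda>_. - c" "\<lambda>_. c" "\<Sum>k<n. expectation (Z r k)"
        proof unfold_locales
          show "indep_vars (\<lambda>_. borel) (Z r) {..<n}" by (rule indep_vars_subset[OF indZ]) auto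
          show "AE x in M. Z r i x \<in> {- c..c}" for i
          proof (rule AE_I2)
            fix x
            show "Z r i x \<in> {- c..c}"
              using bd[of "sh (int (i * d + r)) (bits x)"] unfolding Z_def c_def atLeastAtMost_iff by linarith
          qed
        qed auto
        have s: "(\<Sum>i<n. (c - - c)^2) = n * (4 * c^2)" by (simp add: power2_eq_square)
        have "prob {x \<in> space M. \<bar>(\<Sum>i<n. Z r i x) - (\<Sum>k<n. expectation (Z r k))\<bar> \<ge> n * e}
            \<le> 2 * exp (- 2 * (n * e)^2 / (\<Sum>i<n. (c - - c)^2))"
          by (rule H.Hoeffding_ineq_abs_ge) (use e c n in \<open>auto simp: s\<close>)
        also have "- 2 * (n * e)^2 / (\<Sum>i<n. (c - - c)^2) = real n * (- (e^2 / (2 * c^2)))"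
          unfolding s using n c by (simp add: field_simps power2_eq_square)
        also have "exp \<dots> = q ^ n" unfolding q_def by (rule exp_of_nat_mult)
        finally show ?thesis unfolding A_def by (simp add: EZ)
      qed
      have "AE \<omega> in M. eventually (\<lambda>n. \<omega> \<in> space M - A n) sequentially"
      proof (rule borel_cantelli_AE1[OF A])
        show "summable (\<lambda>n. prob (A n))"
          by (rule summable_comparison_test'[of "\<lambda>n. 2 * q ^ n" 1]) (use q bound in \<open>auto intro!: summable_mult\<close>)
      qed (simp add: emeasure_eq_measure)
      thus ?thesis
      proof eventually_elim
        case (elim \<omega>)
        thus ?case by eventually_elim (auto simp: A_def)
      qed
    qed
    from this[of "1 / (real j + 1)" for j :: nat]
    have "AE \<omega> in M. eventually (\<lambda>n. \<bar>(\<Sum>k<n. Z r k \<omega>) - n * \<mu>\<bar> < n * (1 / (real j + 1))) sequentially" for j :: nat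
      by (simp del: times_divide_eq_right)
    hence "AE \<omega> in M. \<forall>j::nat. eventually (\<lambda>n. \<bar>(\<Sum>k<n. Z r k \<omega>) - n * \<mu>\<bar> < n * (1 / (real j + 1))) sequentially"
      by (rule AE_all_countable[THEN iffD2, OF allI])
    thus ?thesis
    proof eventually_elim
      case (elim \<omega>)
      show ?case
      proof (rule tendstoI)
        fix e :: real assume "e > 0"
        then obtain j :: nat where j: "1 / (real j + 1) < e" using reals_Archimedean[of e]
          by (auto simp: inverse_eq_divide add.commute)
        from elim[rule_format, of j] eventually_gt_at_top[of 0]
        show "eventually (\<lambda>n. dist ((\<Sum>k<n. Z r k \<omega>) / n) \<mu> < e) sequentially"
        proof eventually_elim
          case (elim n)
          have "dist ((\<Sum>k<n. Z r k \<omega>) / n) \<mu> = \<bar>(\<Sum>k<n. Z r k \<omega>) - n * \<mu>\<bar> / n"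
          proof -
            have "(\<Sum>k<n. Z r k \<omega>) / n - \<mu> = ((\<Sum>k<n. Z r k \<omega>) - n * \<mu>) / n"
              using elim(2) by (simp add: field_simps)
            thus ?thesis by (simp add: dist_real_def abs_divide)
          qed
          also have "\<dots> < 1 / (real j + 1)" using elim by (simp add: divide_less_eq mult.commute)
          finally show ?case using j by simp
        qed
      qed
    qed
  qed
  hence "AE \<omega> in M. \<forall>r. (\<lambda>n. (\<Sum>k<n. Z r k \<omega>) / n) \<longlonglongrightarrow> \<mu>"
    by (rule AE_all_countable[THEN iffD2, OF allI])
  thus ?thesis
  proof eventually_elim
    case (elim \<omega>)
    show ?case unfolding \<mu>_def[symmetric]
    proof (rule average_of_residue_averages[OF d])
      show "\<bar>H (\<lambda>i. bits \<omega> (i + int k))\<bar> \<le> C" for k by (rule bd)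
      show "(\<lambda>n. (\<Sum>k<n. H (\<lambda>i. bits \<omega> (i + int (k * d + r)))) / n) \<longlonglongrightarrow> \<mu>" for r
        using elim[rule_format, of r] unfolding Z_def sh_def .
    qed
  qed
qed

end

section \<open>Summability of the potential\<close>

definition ratio_prod :: "real \<Rightarrow> (int \<Rightarrow> bool) \<Rightarrow> nat \<Rightarrow> real" where
  "ratio_prod s v k = (\<Prod>i<k. window_ratio s v (1 + int i))"

lemma ratio_prod_measurable [measurable]: "(\<lambda>v. ratio_prod s v k) \<in> borel_measurable bit_space"
  unfolding ratio_prod_def by measurable

lemma ratio_prod_pos: "s > 0 \<Longrightarrow> ratio_prod s v k > 0"
  unfolding ratio_prod_def by (intro prod_pos ballI window_ratio_pos)

lemma ratio_prod_add:
  "ratio_prod s v (n + k) = ratio_prod s v n * (\<Prod>i<k. window_ratio s v (1 + int (n + i)))"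
  by (induction k) (simp_all add: ratio_prod_def mult.assoc)

lemma window_ratio_flip: "window_ratio s (\<lambda>i. \<not> v i) i = 1 / window_ratio s v i"
  by (auto simp: window_ratio_def maj_ratio_def maj_def)

lemma ratio_prod_flip: "ratio_prod s (\<lambda>i. \<not> v i) k = 1 / ratio_prod s v k"
  by (simp add: ratio_prod_def window_ratio_flip prod_dividef)

text \<open>The reflection j -> 3 - j maps the window 1 + i, 2 + i, 3 + i onto -i, 1 - i, 2 - i, so
  the factors of the potential left of 0 become factors of a product to the right.\<close>

lemma window_ratio_reverse: "window_ratio s (\<lambda>i. v (3 - i)) (1 + i) = window_ratio s v (- i)"
  by (simp add: window_ratio_def maj_ratio_rev[of s "v (2 - i)"] algebra_simps)

lemma potential_maj_env:
  assumes p: "0 < p" "p < 1" and s: "s = (1 - p) / p"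
  shows "potential p (maj_env v) (int k) = ratio_prod s v k"
    and "potential p (maj_env v) (- int k) = 1 / ratio_prod s (\<lambda>i. v (3 - i)) k"
proof -
  have s0: "s > 0" using p s by simp
  have o: "odds p (maj_env v) i = window_ratio s v i" for i using odds_maj_env[OF p] s by simp
  have op: "odds p (maj_env v) i > 0" for i unfolding o by (rule window_ratio_pos[OF s0])
  show "potential p (maj_env v) (int k) = ratio_prod s v k"
  proof (induction k)
    case (Suc k)
    have "potential p (maj_env v) (int (Suc k)) = odds p (maj_env v) (int k + 1) * potential p (maj_env v) (int k)"
      using potential_step[OF op, of "int k"] by (simp add: add.commute)
    thus ?case using Suc by (simp add: ratio_prod_def o add.commute)
  qed (simp add: potential_def ratio_prod_def)
  show "potential p (maj_env v) (- int k) = 1 / ratio_prod s (\<lambda>i. v (3 - i)) k"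
  proof (induction k)
    case (Suc k)
    have "potential p (maj_env v) (- int k) = odds p (maj_env v) (- int k) * potential p (maj_env v) (- int (Suc k))"
      using potential_step[OF op, of "- int (Suc k)"] by simp
    hence "potential p (maj_env v) (- int (Suc k)) = potential p (maj_env v) (- int k) / window_ratio s v (- int k)"
      using op[of "- int k"] unfolding o by (simp add: field_simps)
    also have "\<dots> = 1 / ratio_prod s (\<lambda>i. v (3 - i)) (Suc k)"
      unfolding Suc by (simp add: ratio_prod_def window_ratio_reverse mult.commute)
    finally show ?case .
  qed (simp add: potential_def ratio_prod_def)
qed

lemma summable_ratio_prod_shift:
  assumes s: "s > 0"
  shows "summable (ratio_prod s v) \<longleftrightarrow> summable (\<lambda>k. \<Prod>i<k. window_ratio s v (1 + int (n + i)))"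
proof -
  have "summable (ratio_prod s v) \<longleftrightarrow> summable (\<lambda>k. ratio_prod s v (k + n))"
    by (rule summable_iff_shift[symmetric])
  also have "(\<lambda>k. ratio_prod s v (k + n)) = (\<lambda>k. ratio_prod s v n * (\<Prod>i<k. window_ratio s v (1 + int (n + i))))"
    by (simp only: add.commute[of _ n] ratio_prod_add)
  also have "summable \<dots> \<longleftrightarrow> summable (\<lambda>k. \<Prod>i<k. window_ratio s v (1 + int (n + i)))"
    using ratio_prod_pos[OF s, of v n] by (subst summable_cmult_iff) auto
  finally show ?thesis .
qed

text \<open>The bound ranges over natural numbers so that summability becomes a countable
  combination of measurable conditions.\<close>

lemma summable_iff_bounded_sums:
  fixes f :: "nat \<Rightarrow> real"
  assumes "\<And>k. f k \<ge> 0"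
  shows "summable f \<longleftrightarrow> (\<exists>B::nat. \<forall>N. (\<Sum>k<N. f k) \<le> B)"
proof
  assume sm: "summable f"
  obtain B :: nat where B: "suminf f \<le> B" using real_arch_simple by blast
  have "(\<Sum>k<N. f k) \<le> B" for N
    using sum_le_suminf[OF sm, of "{..<N}"] assms B by fastforce
  thus "\<exists>B::nat. \<forall>N. (\<Sum>k<N. f k) \<le> B" by blast
next
  assume "\<exists>B::nat. \<forall>N. (\<Sum>k<N. f k) \<le> B"
  then obtain B :: nat where "\<forall>N. (\<Sum>k<N. f k) \<le> B" ..
  thus "summable f" using assms by (intro summableI_nonneg_bounded[of f "real B"]) auto
qed

lemma summable_window_prod_sets:
  assumes s: "s > 0"
  shows "{v \<in> space bit_space. summable (\<lambda>k. \<Prod>i<k. window_ratio s v (1 + int (n + i)))} \<in> sets bit_space"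
proof -
  have "(\<Prod>i<k. window_ratio s v (1 + int (n + i))) \<ge> 0" for k v
    using window_ratio_pos[OF s] by (intro prod_nonneg) (auto intro: less_imp_le)
  note * = summable_iff_bounded_sums[of "\<lambda>k. \<Prod>i<k. window_ratio s _ (1 + int (n + i))", OF this]
  show ?thesis unfolding * by measurable
qed

lemma ratio_prod_powr:
  assumes s: "s' > 0" "s = s' powr t"
  shows "ratio_prod s v k = ratio_prod s' v k powr t"
proof -
  have "window_ratio s v i = window_ratio s' v i powr t" for i
    using s by (simp add: window_ratio_def maj_ratio_def powr_divide)
  moreover have "ratio_prod r v (Suc n) = ratio_prod r v n * window_ratio r v (1 + int n)" for r n
    by (simp add: ratio_prod_def)
  ultimately show ?thesis
    using ratio_prod_pos[OF s(1), THEN less_imp_le] window_ratio_pos[OF s(1), THEN less_imp_le]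
    by (induction k) (simp_all add: powr_mult, simp add: ratio_prod_def)
qed

text \<open>Summable products are eventually below 1, and there a power \<open>t \<ge> 1\<close>
  only makes them smaller. This reaches parameters at which the mean of the sum is infinite.\<close>

lemma summable_ratio_prod_mono:
  assumes s: "s' > 0" "s = s' powr t" "t \<ge> 1" and sm: "summable (ratio_prod s' v)"
  shows "summable (ratio_prod s v)"
proof -
  have "ratio_prod s' v \<longlonglongrightarrow> 0" using sm by (rule summable_LIMSEQ_zero)
  hence "eventually (\<lambda>k. ratio_prod s' v k < 1) sequentially" by (rule order_tendstoD) simp
  hence "eventually (\<lambda>k. norm (ratio_prod s v k) \<le> ratio_prod s' v k) sequentially"
  proof eventually_elim
    case (elim k)
    have "ratio_prod s' v k powr t \<le> ratio_prod s' v k powr 1"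
      using elim ratio_prod_pos[OF s(1), of v k] s(3) by (intro powr_mono') auto
    thus ?case using ratio_prod_pos[OF s(1), of v k] by (simp add: ratio_prod_powr[OF s(1,2)])
  qed
  thus ?thesis using sm by (rule summable_comparison_test_ev)
qed

context bernoulli_bits
begin

lemma AE_summable_ratio_prod:
  assumes a: "0 < a" "a < 1" and p: "0 < p" "p < 1" and F: "cutoff_fun a ((1 - p) / p) > 0"
  shows "AE \<omega> in M. summable (ratio_prod ((1 - p) / p) (bits \<omega>))"
proof -
  define s where "s = (1 - p) / p"
  have s: "s > 0" using p by (simp add: s_def)
  have sm: "summable (prod_mean a s)" using prod_mean_summable_iff(1)[OF a p] F by (simp add: s_def)
  have "(\<integral>\<^sup>+\<omega>. (\<Sum>k. ennreal (ratio_prod s (bits \<omega>) k)) \<partial>M)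
      = (\<Sum>k. \<integral>\<^sup>+\<omega>. ennreal (ratio_prod s (bits \<omega>) k) \<partial>M)"
    by (rule nn_integral_suminf) measurable
  also have "\<dots> = (\<Sum>k. ennreal (prod_mean a s k))"
    unfolding ratio_prod_def by (simp only: integral_ratio_prod[OF s])
  also have "\<dots> = ennreal (\<Sum>k. prod_mean a s k)"
    by (rule suminf_ennreal2[OF prod_mean_nonneg[OF a s] sm])
  finally have "(\<integral>\<^sup>+\<omega>. (\<Sum>k. ennreal (ratio_prod s (bits \<omega>) k)) \<partial>M) \<noteq> \<infinity>" by simp
  hence "AE \<omega> in M. (\<Sum>k. ennreal (ratio_prod s (bits \<omega>) k)) \<noteq> \<infinity>"
    by (intro nn_integral_PInf_AE) measurable
  thus ?thesis unfolding s_def[symmetric]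
  proof eventually_elim
    case (elim \<omega>)
    thus ?case using ratio_prod_pos[OF s, THEN less_imp_le] by (intro summable_suminf_not_top) auto
  qed
qed

text \<open>Dropping the first \<open>n\<close> ratios divides the series by a positive constant up
  to finitely many terms, so summability is a tail event of the bits.\<close>

lemma summable_ratio_prod_0_1:
  assumes s: "s > 0"
  defines "E \<equiv> {\<omega> \<in> space M. summable (ratio_prod s (bits \<omega>))}"
  shows "prob E = 0 \<or> prob E = 1"
proof -
  define A where "A n = sigma_sets (space M) {b (int n) -` S \<inter> space M | S. S \<in> sets (count_space (UNIV :: bool set))}" for n :: nat
  have gen: "{b (int n) -` S \<inter> space M | S. S \<in> sets (count_space (UNIV :: bool set))} \<subseteq> Pow (space M)" for n by auto
  have "indep_vars (\<lambda>_. count_space UNIV) (\<lambda>n \<omega>. b (int n) \<omega>) (UNIV :: nat set)"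
  proof -
    have "indep_vars (\<lambda>_. count_space UNIV) (\<lambda>n \<omega>. bits \<omega> (int n)) (UNIV :: nat set)"
      by (rule indep_blocks[where K = "\<lambda>n. {int n}" and H = "\<lambda>n v. v (int n)"])
         (simp_all add: disjoint_family_on_def bit_measurable)
    thus ?thesis by (simp add: bits_def)
  qed
  hence indA: "indep_sets A UNIV" unfolding indep_vars_def A_def by simp
  have saA: "sigma_algebra (space M) (A n)" for n
    unfolding A_def by (rule sigma_algebra_sigma_sets[OF gen])
  have "E \<in> tail_events A" unfolding tail_events_def
  proof
    fix n :: nat
    define W where "W = sigma (space M) (\<Union>(A ` {n..}))"
    have genW: "\<Union>(A ` {n..}) \<subseteq> Pow (space M)"
    proof -
      have "A m \<subseteq> Pow (space M)" for m
        unfolding A_def using sigma_sets_into_sp[OF gen] by blast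
      thus ?thesis by blast
    qed
    have W: "space W = space M" "sets W = sigma_sets (space M) (\<Union>(A ` {n..}))"
      unfolding W_def using genW by (simp_all add: space_measure_of sets_measure_of)
    \<comment> \<open>Overwriting the bits before \<open>n\<close> gives a map measurable for the
      bits from \<open>n\<close> on, and the shifted product cannot see the difference.\<close>
    define c where "c \<omega> = (\<lambda>i. if i \<ge> int n then b i \<omega> else False)" for \<omega>
    have "c \<in> measurable W bit_space"
      unfolding c_def[abs_def]
    proof (rule measurable_PiM_single')
      fix i :: int
      show "(\<lambda>\<omega>. if i \<ge> int n then b i \<omega> else False) \<in> measurable W (count_space UNIV)"
      proof (cases "i \<ge> int n")
        case True
        have "b i -` S \<inter> space W \<in> sets W" for S
        proof -
          have "b (int (nat i)) -` S \<inter> space M \<in> A (nat i)"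
            unfolding A_def by (rule sigma_sets.Basic) auto
          hence "b (int (nat i)) -` S \<inter> space M \<in> \<Union>(A ` {n..})" using True by (intro UN_I[of "nat i"]) auto
          thus ?thesis unfolding W using True by (intro sigma_sets.Basic) simp
        qed
        thus ?thesis using True by (simp add: measurable_def)
      qed simp
    qed auto
    hence "c -` {v \<in> space bit_space. summable (\<lambda>k. \<Prod>i<k. window_ratio s v (1 + int (n + i)))} \<inter> space W \<in> sets W"
      by (rule measurable_sets) (rule summable_window_prod_sets[OF s])
    also have "c -` {v \<in> space bit_space. summable (\<lambda>k. \<Prod>i<k. window_ratio s v (1 + int (n + i)))} \<inter> space W = E"
    proof -
      have "window_ratio s (c \<omega>) (1 + int (n + i)) = window_ratio s (bits \<omega>) (1 + int (n + i))" for i \<omega>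
        by (simp add: window_ratio_def c_def bits_def)
      thus ?thesis unfolding E_def W summable_ratio_prod_shift[OF s, of _ n] by (auto simp: space_PiM)
    qed
    finally show "E \<in> sigma_sets (space M) (\<Union>(A ` {n..}))" unfolding W .
  qed
  from kolmogorov_0_1_law[OF saA indA this] show ?thesis .
qed

text \<open>For fair bits, flipping preserves the law and inverts every product. A sequence and its
  reciprocals cannot both tend to 0, so summability does not have probability 1, and by the 0-1 law
  it has probability 0.\<close>

lemma AE_not_summable_ratio_prod_half:
  assumes s: "s > 0" and a: "a = 1 / 2"
  shows "AE \<omega> in M. \<not> summable (ratio_prod s (bits \<omega>))"
proof -
  define G where "G = {v \<in> space bit_space. summable (ratio_prod s v)}"
  have G: "G \<in> sets bit_space"
    using summable_window_prod_sets[OF s, of 0] unfolding G_def ratio_prod_def by simp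
  define flip where "flip \<omega> = (\<lambda>i. \<not> b i \<omega>)" for \<omega>
  have flip: "flip \<in> measurable M bit_space"
    unfolding flip_def[abs_def]
    by (rule measurable_PiM_single') (auto intro: measurable_compose[OF b_meas])
  define E where "E = {\<omega> \<in> space M. summable (ratio_prod s (bits \<omega>))}"
  define E' where "E' = {\<omega> \<in> space M. summable (ratio_prod s (flip \<omega>))}"
  have EG: "E = bits -` G \<inter> space M" "E' = flip -` G \<inter> space M"
    by (auto simp: E_def E'_def G_def space_PiM)
  have E_sets: "E \<in> events" "E' \<in> events"
    unfolding EG using bits_meas flip G by (auto intro: measurable_sets)
  have "prob E' = measure (distr M bit_space flip) G"
    unfolding EG by (rule measure_distr[OF flip G, symmetric])
  also have "distr M bit_space flip = distr M bit_space bits"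
    using distr_bits_flip[OF a] by (simp add: flip_def[abs_def])
  also have "measure \<dots> G = prob E" unfolding EG by (rule measure_distr[OF bits_meas G])
  finally have eq: "prob E' = prob E" .
  have "prob E \<noteq> 1"
  proof
    assume 1: "prob E = 1"
    hence "AE \<omega> in M. \<omega> \<in> E" "AE \<omega> in M. \<omega> \<in> E'"
      using prob_eq_1[OF E_sets(1)] prob_eq_1[OF E_sets(2)] eq by simp_all
    hence "AE \<omega> in M. False"
    proof eventually_elim
      case (elim \<omega>)
      have "flip \<omega> = (\<lambda>i. \<not> bits \<omega> i)" by (simp add: flip_def bits_def)
      hence "summable (\<lambda>k. 1 / ratio_prod s (bits \<omega>) k)"
        using elim(2) by (simp add: E'_def ratio_prod_flip[abs_def])
      hence "(\<lambda>k. 1 / ratio_prod s (bits \<omega>) k) \<longlonglongrightarrow> 0" by (rule summable_LIMSEQ_zero)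
      moreover have "ratio_prod s (bits \<omega>) \<longlonglongrightarrow> 0"
        using elim(1) by (intro summable_LIMSEQ_zero) (simp add: E_def)
      ultimately have "(\<lambda>k. 1 / ratio_prod s (bits \<omega>) k * ratio_prod s (bits \<omega>) k) \<longlonglongrightarrow> 0 * 0"
        by (intro tendsto_mult)
      moreover have "1 / ratio_prod s (bits \<omega>) k * ratio_prod s (bits \<omega>) k = 1" for k
        using ratio_prod_pos[OF s, of "bits \<omega>" k] by simp
      ultimately have "(\<lambda>k. 1 :: real) \<longlonglongrightarrow> 0" by simp
      thus False using LIMSEQ_unique[OF _ tendsto_const] by fastforce
    qed
    thus False by simp
  qed
  hence "prob E = 0" using summable_ratio_prod_0_1[OF s] by (simp add: E_def)
  hence "AE \<omega> in M. \<omega> \<notin> E" using E_sets by (simp add: prob_eq_0)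
  thus ?thesis using AE_space by eventually_elim (simp add: E_def)
qed

end

section \<open>The walk in the moving average environment\<close>

locale maj_walk = bernoulli_bits M a b for M :: "'a measure" and a :: real and b :: "int \<Rightarrow> 'a \<Rightarrow> bool" +
  fixes p :: real and x0 :: int and X :: "nat \<Rightarrow> 'a \<Rightarrow> int"
  assumes a01: "0 < a" "a < 1" and p01': "0 < p" "p < 1"
    and maj_walk: "swap_walk M p x0 (\<lambda>i \<omega>. maj_env (\<lambda>j. b j \<omega>) i) X"
begin

sublocale quenched_walk M p x0 "\<lambda>i \<omega>. maj_env (\<lambda>j. b j \<omega>) i" X
  by unfold_locales (rule p01' maj_walk)+

definition \<sigma> :: real where "\<sigma> = (1 - p) / p"

lemma \<sigma>_pos: "\<sigma> > 0"
  using p01' by (simp add: \<sigma>_def)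

lemma env_eq: "env \<omega> = maj_env (bits \<omega>)"
  by (simp add: env_def bits_def)

lemma odds_env: "odds p (env \<omega>) i = window_ratio \<sigma> (bits \<omega>) i"
  unfolding env_eq \<sigma>_def by (rule odds_maj_env[OF p01'])

lemma env_stationary: "distr M envs (\<lambda>\<omega>. shift_env (env \<omega>)) = distr M envs env"
proof -
  define sh where "sh \<omega> = (\<lambda>i. b (i + 1) \<omega>)" for \<omega>
  have sh [measurable]: "sh \<in> measurable M bit_space"
    unfolding sh_def[abs_def] by (rule measurable_PiM_single') (simp_all add: b_meas)
  have "(\<lambda>\<omega>. shift_env (env \<omega>)) = (\<lambda>\<omega>. maj_env (sh \<omega>))"
    by (intro ext) (simp only: shift_env_def env_eq, simp add: maj_env_def sh_def bits_def add_ac)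
  hence "distr M envs (\<lambda>\<omega>. shift_env (env \<omega>)) = distr M envs (maj_env \<circ> sh)" by (simp add: comp_def)
  also have "\<dots> = distr (distr M bit_space sh) envs maj_env"
    by (rule distr_distr[symmetric]) measurable
  also have "distr M bit_space sh = distr M bit_space bits"
    unfolding sh_def[abs_def] by (rule distr_bits_reindex) (auto simp: inj_def)
  also have "distr (distr M bit_space bits) envs maj_env = distr M envs (maj_env \<circ> bits)"
    by (rule distr_distr) measurable
  also have "maj_env \<circ> bits = env" by (simp add: fun_eq_iff env_eq)
  finally show ?thesis .
qed

lemma odds_prod_mean:
  "(\<integral>\<^sup>+\<omega>. ennreal (\<Prod>i<j. odds p (env \<omega>) (x + int i)) \<partial>M) = ennreal (prod_mean a \<sigma> j)"
  unfolding odds_env by (rule integral_ratio_prod[OF \<sigma>_pos])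

definition mean_crossing :: "nat \<Rightarrow> real" where
  "mean_crossing L = 1 + 2 * (\<Sum>j<L. prod_mean a \<sigma> (Suc j))"

lemma mean_crossing_ge_1: "mean_crossing L \<ge> 1"
  unfolding mean_crossing_def using prod_mean_nonneg[OF a01 \<sigma>_pos] by (simp add: sum_nonneg)

lemma crossing_expectation: "(\<integral>\<omega>. crossing p (env \<omega>) L 0 \<partial>M) = mean_crossing L"
proof -
  have e: "integrable M (\<lambda>\<omega>. \<Prod>i<Suc j. odds p (env \<omega>) (0 - int i))"
    "(\<integral>\<omega>. (\<Prod>i<Suc j. odds p (env \<omega>) (0 - int i)) \<partial>M) = prod_mean a \<sigma> (Suc j)" for j
  proof -
    \<comment> \<open>The crossing time multiplies odds from right to left; the reversed order
      starts at \<open>- int j\<close> and matches \<open>odds_prod_mean\<close>.\<close>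
    have eq: "(\<Prod>i<Suc j. odds p (env \<omega>) (0 - int i)) = (\<Prod>i<Suc j. odds p (env \<omega>) (- int j + int i))" for \<omega>
      by (subst prod.nat_diff_reindex[symmetric]) (auto intro!: prod.cong simp: of_nat_diff)
    have pos: "0 \<le> (\<Prod>i<Suc j. odds p (env \<omega>) (- int j + int i))" for \<omega>
      by (rule less_imp_le[OF prod_odds_pos])
    have m: "(\<lambda>\<omega>. \<Prod>i<Suc j. odds p (env \<omega>) (- int j + int i)) \<in> borel_measurable M"
      by measurable
    show "integrable M (\<lambda>\<omega>. \<Prod>i<Suc j. odds p (env \<omega>) (0 - int i))"
      unfolding eq using odds_prod_mean[where j = "Suc j" and x = "- int j"]
      by (intro integrableI_nn_integral_finite[where x = "prod_mean a \<sigma> (Suc j)"] m AE_I2 pos)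
    show "(\<integral>\<omega>. (\<Prod>i<Suc j. odds p (env \<omega>) (0 - int i)) \<partial>M) = prod_mean a \<sigma> (Suc j)"
      unfolding eq integral_eq_nn_integral[OF m AE_I2[OF pos]] odds_prod_mean
      by (rule enn2real_ennreal[OF prod_mean_nonneg[OF a01 \<sigma>_pos]])
  qed
  have "(\<integral>\<omega>. crossing p (env \<omega>) L 0 \<partial>M)
      = (\<integral>\<omega>. 1 + 2 * (\<Sum>j<L. \<Prod>i<Suc j. odds p (env \<omega>) (0 - int i)) \<partial>M)"
    by (simp only: crossing_eq)
  also have "\<dots> = 1 + 2 * (\<Sum>j<L. prod_mean a \<sigma> (Suc j))"
    using e by (simp add: prob_space del: prod.lessThan_Suc)
  finally show ?thesis by (simp add: mean_crossing_def)
qed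

lemma crossing_average:
  "AE \<omega> in M. (\<lambda>n. (\<Sum>k<n. crossing p (env \<omega>) L (int k)) / n) \<longlonglongrightarrow> mean_crossing L"
proof -
  define H where "H v = crossing p (maj_env v) L 0" for v
  obtain C where C: "\<And>u x. crossing p u L x \<le> C" using crossing_bounded by blast
  have Hm: "H \<in> borel_measurable bit_space"
    unfolding H_def[abs_def] by (rule measurable_compose[OF maj_env_measurable crossing_measurable])
  have Hb: "\<bar>H v\<bar> \<le> C" for v
    using C[of "maj_env v" 0] crossing_ge_1[of "maj_env v" L 0] by (simp add: H_def)
  have sh: "H (\<lambda>i. v (i + t)) = crossing p (maj_env v) L t" for v t
  proof -
    have "odds p (maj_env (\<lambda>i. v (i + t))) (0 - int i) = odds p (maj_env v) (t - int i)" for i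
      unfolding odds_maj_env[OF p01'] by (simp add: window_ratio_def algebra_simps)
    thus ?thesis unfolding H_def crossing_eq by simp
  qed
  have "AE \<omega> in M. (\<lambda>n. (\<Sum>k<n. H (\<lambda>i. bits \<omega> (i + int k))) / n) \<longlonglongrightarrow> (\<integral>\<omega>. H (bits \<omega>) \<partial>M)"
  \<comment> \<open>Depth \<open>L\<close> at site 0 uses sites down to -(L - 1), and the majority
    at site 0 looks ahead to bit 2.\<close>
  proof (rule window_SLLN[OF Hm Hb, where m = "L + 2"])
    fix v v' :: "int \<Rightarrow> bool"
    assume *: "\<And>k. - int (L + 2) \<le> k \<Longrightarrow> k \<le> int (L + 2) \<Longrightarrow> v k = v' k"
    have "odds p (maj_env v) (0 - int i) = odds p (maj_env v') (0 - int i)" if "i < L" for i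
      unfolding odds_maj_env[OF p01'] window_ratio_def using that by (simp add: *)
    thus "H v = H v'" unfolding H_def crossing_eq
      by (intro arg_cong2[where f = "(+)"] arg_cong2[where f = "(*)"] sum.cong prod.cong refl) simp
  qed
  moreover have "(\<integral>\<omega>. H (bits \<omega>) \<partial>M) = mean_crossing L"
    using crossing_expectation by (simp add: H_def env_eq)
  ultimately show ?thesis unfolding sh env_eq by simp
qed

lemma speed_le:
  fixes v :: real
  assumes v: "v \<ge> 0" "\<And>e. e > 0 \<Longrightarrow> \<exists>L. 1 / mean_crossing L < v + e"
  shows "AE \<omega> in M. \<forall>d>0::real. eventually (\<lambda>n. X n \<omega> \<le> (v + d) * n) sequentially"
proof -
  have "AE \<omega> in M. \<forall>d>0::real. eventually (\<lambda>n. X n \<omega> \<le> (1 / mean_crossing L + d) * n) sequentially" for L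
    using mean_crossing_ge_1[of L] by (intro speed_upper[OF _ crossing_average]) auto
  hence "AE \<omega> in M. \<forall>L. \<forall>d>0::real. eventually (\<lambda>n. X n \<omega> \<le> (1 / mean_crossing L + d) * n) sequentially"
    by (rule AE_all_countable[THEN iffD2, OF allI])
  thus ?thesis
  proof eventually_elim
    case (elim \<omega>)
    show ?case
    proof (intro allI impI)
      fix d :: real assume d: "d > 0"
      then obtain L where L: "1 / mean_crossing L < v + d / 2" using v(2)[of "d/2"] by auto
      have "eventually (\<lambda>n. X n \<omega> \<le> (1 / mean_crossing L + d / 2) * n) sequentially"
        using elim d by simp
      thus "eventually (\<lambda>n. X n \<omega> \<le> (v + d) * n) sequentially"
      proof eventually_elim
        case (elim n)
        have "(1 / mean_crossing L + d / 2) * n \<le> (v + d) * n" using L by (intro mult_right_mono) auto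
        with elim show ?case by linarith
      qed
    qed
  qed
qed

text \<open>With a divergent sum of means the mean crossing times are unbounded in \<open>L\<close>,
  so the upper bounds for the speed decrease to 0.\<close>

lemma speed_nonpos:
  assumes F: "\<not> cutoff_fun a \<sigma> > 0"
  shows "AE \<omega> in M. \<forall>d>0::real. eventually (\<lambda>n. real_of_int (X n \<omega>) \<le> d * real n) sequentially"
proof -
  have ns: "\<not> summable (prod_mean a \<sigma>)"
    using F prod_mean_summable_iff(1)[OF a01 p01'] by (simp add: \<sigma>_def)
  have "\<exists>L. 1 / mean_crossing L < 0 + e" if e: "e > 0" for e
  proof (rule ccontr)
    assume "\<not> ?thesis"
    hence *: "1 / mean_crossing L \<ge> e" for L by (auto simp: not_less)
    have "mean_crossing L \<le> 1 / e" for L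
      using *[of L] mean_crossing_ge_1[of L] e by (simp add: field_simps)
    hence "(\<Sum>j<L. prod_mean a \<sigma> (Suc j)) \<le> 1 / e" for L
      using prod_mean_nonneg[OF a01 \<sigma>_pos] unfolding mean_crossing_def
      by (smt (verit, best) sum_nonneg)
    hence "summable (\<lambda>j. prod_mean a \<sigma> (Suc j))"
      using prod_mean_nonneg[OF a01 \<sigma>_pos] by (intro summableI_nonneg_bounded)
    thus False using ns by (simp add: summable_Suc_iff)
  qed
  from speed_le[OF order.refl this] show ?thesis by simp
qed

lemma speed_pos:
  assumes F: "cutoff_fun a \<sigma> > 0"
  shows "AE \<omega> in M. (\<lambda>n. real_of_int (X n \<omega>) / real n) \<longlonglongrightarrow> drift a p"
proof -
  define s where "s = (\<Sum>j. prod_mean a \<sigma> j)"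
  have sm: "summable (prod_mean a \<sigma>)"
    using F prod_mean_summable_iff(1)[OF a01 p01'] by (simp add: \<sigma>_def)
  have dr: "2 * s - 1 = 1 / drift a p" "drift a p > 0"
    using F prod_mean_summable_iff(2)[OF a01 p01'] by (simp_all add: \<sigma>_def s_def)
  have drift: "1 / (2 * s - 1) = drift a p" using dr by simp
  have "(\<lambda>L. (\<Sum>j<L. prod_mean a \<sigma> (Suc j))) \<longlonglongrightarrow> s - 1"
    using summable_LIMSEQ[of "\<lambda>j. prod_mean a \<sigma> (Suc j)"] sm
    by (simp add: summable_Suc_iff suminf_split_head s_def prod_mean_0)
  hence "mean_crossing \<longlonglongrightarrow> 1 + 2 * (s - 1)"
    unfolding mean_crossing_def[abs_def] by (intro tendsto_intros)
  hence lim: "mean_crossing \<longlonglongrightarrow> 2 * s - 1" by (simp add: algebra_simps)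
  have "(\<lambda>L. 1 / mean_crossing L) \<longlonglongrightarrow> 1 / (2 * s - 1)"
    by (intro tendsto_divide tendsto_const lim) (use dr in simp)
  hence lim': "(\<lambda>L. 1 / mean_crossing L) \<longlonglongrightarrow> drift a p" unfolding drift .
  have "\<exists>L. 1 / mean_crossing L < drift a p + e" if "e > 0" for e
  proof -
    have "eventually (\<lambda>L. 1 / mean_crossing L < drift a p + e) sequentially"
      using that by (intro order_tendstoD(2)[OF lim']) simp
    from eventually_happens[OF this] show ?thesis by simp
  qed
  from speed_le[OF less_imp_le[OF dr(2)] this]
  have upper: "AE \<omega> in M. \<forall>d>0::real. eventually (\<lambda>n. X n \<omega> \<le> (1 / (2 * (\<Sum>j. prod_mean a \<sigma> j) - 1) + d) * n) sequentially"
    unfolding s_def[symmetric] drift .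
  show ?thesis
    using speed_stationary[OF env_stationary odds_prod_mean prod_mean_nonneg[OF a01 \<sigma>_pos] prod_mean_0 sm upper]
    unfolding s_def[symmetric] drift .
qed

lemma potential_env:
  "potential p (env \<omega>) (int k) = ratio_prod \<sigma> (bits \<omega>) k"
  "potential p (env \<omega>) (- int k) = 1 / ratio_prod \<sigma> (\<lambda>i. bits \<omega> (3 - i)) k"
  unfolding env_eq by (rule potential_maj_env[OF p01' \<sigma>_def])+

text \<open>Serves positive and zero speed alike. The auxiliary \<open>s\<close> lies strictly
  between 1 and both \<sigma> and the cutoff root: there the cutoff function is positive, and
  \<sigma> is a power of \<open>s\<close> with exponent at least 1.\<close>

lemma drift_to_right:
  assumes "a > 1/2 \<and> \<sigma> < 1 \<or> a < 1/2 \<and> \<sigma> > 1"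
  shows "AE \<omega> in M. filterlim (\<lambda>n. X n \<omega>) at_top sequentially"
proof -
  obtain s where s: "s > 0" "s \<noteq> 1" "cutoff_fun a s > 0" "ln \<sigma> / ln s \<ge> 1"
  proof (cases "a > 1/2")
    case True
    with assms have s1: "\<sigma> < 1" by auto
    note sc = sigma_cutoff_gt[OF True a01(2)]
    define s where "s = (max \<sigma> (sigma_cutoff a) + 1) / 2"
    have s: "\<sigma> < s" "sigma_cutoff a < s" "s < 1" using s1 sc(3) by (auto simp: s_def max_def)
    have "0 < s" using s(1) \<sigma>_pos by linarith
    have "ln \<sigma> \<le> ln s" "ln s < 0" using s \<sigma>_pos \<open>0 < s\<close> by auto
    hence "ln \<sigma> / ln s \<ge> 1" by (simp add: le_divide_eq)
    thus ?thesis using that[of s] s \<open>0 < s\<close> sc(4) by auto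
  next
    case False
    with assms have lt: "a < 1/2" and s1: "\<sigma> > 1" by auto
    note sc = sigma_cutoff_lt[OF a01(1) lt]
    define s where "s = (min \<sigma> (sigma_cutoff a) + 1) / 2"
    have s: "s < \<sigma>" "s < sigma_cutoff a" "1 < s" using s1 sc(2) by (auto simp: s_def min_def)
    have "ln s \<le> ln \<sigma>" "ln s > 0" using s by auto
    hence "ln \<sigma> / ln s \<ge> 1" by (simp add: le_divide_eq)
    thus ?thesis using that[of s] s sc(4) by auto
  qed
  \<comment> \<open>The swap parameter whose odds ratio is \<open>s\<close>.\<close>
  define p' where "p' = 1 / (1 + s)"
  have p': "0 < p'" "p' < 1" "(1 - p') / p' = s" using s(1) by (auto simp: p'_def field_simps)
  define t where "t = ln \<sigma> / ln s"
  have ln0: "ln s \<noteq> 0" using s(1,2) by simp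
  have t: "\<sigma> = s powr t" using s(1) \<sigma>_pos ln0 by (simp add: powr_def t_def)
  have sm: "AE \<omega> in M. summable (ratio_prod \<sigma> (bits \<omega>))"
    using AE_summable_ratio_prod[OF a01 p'(1,2)] s(3) unfolding p'(3)
    by (auto elim!: eventually_mono intro: summable_ratio_prod_mono[OF s(1) t s(4)[folded t_def]])
  \<comment> \<open>Left of 0 the potential is the reciprocal of a product over reflected bits.
    These products tend to 0, so the terms eventually exceed 1 and their sum diverges.\<close>
  interpret R: bernoulli_bits M a "\<lambda>i \<omega>. b (3 - i) \<omega>"
    by (rule reindex(1)) (auto simp: inj_def)
  have Rbits: "R.bits \<omega> = (\<lambda>i. bits \<omega> (3 - i))" for \<omega>
    by (simp add: R.bits_def bits_def)
  have sm': "AE \<omega> in M. summable (ratio_prod \<sigma> (\<lambda>i. bits \<omega> (3 - i)))"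
    using R.AE_summable_ratio_prod[OF a01 p'(1,2)] s(3) unfolding p'(3) Rbits
    by (auto elim!: eventually_mono intro: summable_ratio_prod_mono[OF s(1) t s(4)[folded t_def]])
  show ?thesis
  proof (rule transient_right)
    show "AE \<omega> in M. summable (\<lambda>k. potential p (env \<omega>) (int k))"
      unfolding potential_env using sm by simp
    show "AE \<omega> in M. \<not> summable (\<lambda>k. potential p (env \<omega>) (- int k))"
      using sm' unfolding potential_env
    proof eventually_elim
      case (elim \<omega>)
      have pos: "ratio_prod \<sigma> (\<lambda>i. bits \<omega> (3 - i)) k > 0" for k by (rule ratio_prod_pos[OF \<sigma>_pos])
      have "ratio_prod \<sigma> (\<lambda>i. bits \<omega> (3 - i)) \<longlonglongrightarrow> 0" using elim by (rule summable_LIMSEQ_zero)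
      hence "eventually (\<lambda>k. ratio_prod \<sigma> (\<lambda>i. bits \<omega> (3 - i)) k < 1) sequentially" by (rule order_tendstoD) simp
      hence ev: "eventually (\<lambda>k. 1 / ratio_prod \<sigma> (\<lambda>i. bits \<omega> (3 - i)) k > 1) sequentially"
        by eventually_elim (use pos in simp)
      show ?case
      proof
        assume "summable (\<lambda>k. 1 / ratio_prod \<sigma> (\<lambda>i. bits \<omega> (3 - i)) k)"
        hence "(\<lambda>k. 1 / ratio_prod \<sigma> (\<lambda>i. bits \<omega> (3 - i)) k) \<longlonglongrightarrow> 0" by (rule summable_LIMSEQ_zero)
        hence "eventually (\<lambda>k. 1 / ratio_prod \<sigma> (\<lambda>i. bits \<omega> (3 - i)) k < 1) sequentially" by (rule order_tendstoD) simp
        with ev have "eventually (\<lambda>k::nat. False) sequentially" by eventually_elim auto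
        thus False by simp
      qed
    qed
  qed
qed

text \<open>Either the potential is constantly 1, or the bits are fair and the left half of the
  potential is itself a product over flipped and reflected bits, almost surely not summable.\<close>

lemma unbounded_above:
  assumes "a = 1/2 \<or> \<sigma> = 1"
  shows "AE \<omega> in M. \<forall>c. \<exists>n. X n \<omega> \<ge> c"
proof (rule hits_above)
  show "AE \<omega> in M. \<not> summable (\<lambda>k. potential p (env \<omega>) (- int k))"
  proof (cases "\<sigma> = 1")
    case True
    have "window_ratio 1 v i = 1" for v i by (simp add: window_ratio_def maj_ratio_def)
    hence "potential p (env \<omega>) (- int k) = 1" for \<omega> k
      unfolding potential_env True by (simp add: ratio_prod_def)
    thus ?thesis by (simp add: summable_const_iff)
  next
    case False
    with assms have a: "a = 1/2" by simp
    interpret R: bernoulli_bits M "1 - a" "\<lambda>i \<omega>. \<not> b (3 - i) \<omega>"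
      by (rule reindex(2)) (auto simp: inj_def)
    have "1 / ratio_prod \<sigma> (\<lambda>i. bits \<omega> (3 - i)) k = ratio_prod \<sigma> (R.bits \<omega>) k" for \<omega> k
      by (simp add: R.bits_def bits_def ratio_prod_flip)
    thus ?thesis unfolding potential_env
      using R.AE_not_summable_ratio_prod_half[OF \<sigma>_pos] a by simp
  qed
qed

text \<open>Majorities are taken over \<open>i, i + 1, i + 2\<close>, so negating the site \<open>i\<close> reflects the bits about \<open>1\<close>;
  steps to the left become steps to the right, which flips all bits.\<close>

lemma reflected: "maj_walk M (1 - a) (\<lambda>i \<omega>. \<not> b (2 - i) \<omega>) p (- x0) (\<lambda>n \<omega>. - X n \<omega>)"
proof -
  define V where "V i \<omega> = maj_env (\<lambda>j. b j \<omega>) i" for i \<omega>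
  define V' where "V' i \<omega> = maj_env (\<lambda>j. \<not> b (2 - j) \<omega>) i" for i \<omega>
  have V': "V' i \<omega> = - V (- i) \<omega>" for i \<omega>
    by (auto simp: V_def V'_def maj_env_def maj_def algebra_simps)
  have V1: "V i \<omega> = 1 \<or> V i \<omega> = - 1" for i \<omega> by (simp add: V_def maj_env_def)
  have W: "swap_walk M p x0 V X" using maj_walk unfolding V_def[abs_def] .
  \<comment> \<open>Sign changes and relabelling of sites leave the generating level sets unchanged,
    so both walks condition on the same history.\<close>
  have hist: "walk_history M V' (\<lambda>n \<omega>. - X n \<omega>) n = walk_history M V X n" for n
  proof -
    have 1: "{{\<omega> \<in> space M. V' i \<omega> = c} | i c. True} = {{\<omega> \<in> space M. V i \<omega> = c} | i c. True}"
    proof (intro equalityI subsetI)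
      fix S assume "S \<in> {{\<omega> \<in> space M. V' i \<omega> = c} | i c. True}"
      then obtain i c where "S = {\<omega> \<in> space M. V' i \<omega> = c}" by blast
      also have "\<dots> = {\<omega> \<in> space M. V (- i) \<omega> = - c}" unfolding V' by auto
      finally show "S \<in> {{\<omega> \<in> space M. V i \<omega> = c} | i c. True}" by blast
    next
      fix S assume "S \<in> {{\<omega> \<in> space M. V i \<omega> = c} | i c. True}"
      then obtain i c where "S = {\<omega> \<in> space M. V i \<omega> = c}" by blast
      also have "\<dots> = {\<omega> \<in> space M. V' (- i) \<omega> = - c}" unfolding V' by auto
      finally show "S \<in> {{\<omega> \<in> space M. V' i \<omega> = c} | i c. True}" by blast
    qed
    have 2: "{{\<omega> \<in> space M. - X k \<omega> = c} | k c. k \<le> n} = {{\<omega> \<in> space M. X k \<omega> = c} | k c. k \<le> n}"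
    proof (intro equalityI subsetI)
      fix S assume "S \<in> {{\<omega> \<in> space M. - X k \<omega> = c} | k c. k \<le> n}"
      then obtain k c where "S = {\<omega> \<in> space M. - X k \<omega> = c}" "k \<le> n" by blast
      moreover from this(1) have "S = {\<omega> \<in> space M. X k \<omega> = - c}" by auto
      ultimately show "S \<in> {{\<omega> \<in> space M. X k \<omega> = c} | k c. k \<le> n}" by blast
    next
      fix S assume "S \<in> {{\<omega> \<in> space M. X k \<omega> = c} | k c. k \<le> n}"
      then obtain k c where "S = {\<omega> \<in> space M. X k \<omega> = c}" "k \<le> n" by blast
      moreover from this(1) have "S = {\<omega> \<in> space M. - X k \<omega> = - c}" by auto
      ultimately show "S \<in> {{\<omega> \<in> space M. - X k \<omega> = c} | k c. k \<le> n}" by blast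
    qed
    show ?thesis unfolding walk_history_def 1 2 ..
  qed
  have W': "swap_walk M p (- x0) V' (\<lambda>n \<omega>. - X n \<omega>)"
    unfolding swap_walk_def hist
  proof (intro conjI allI)
    have neg: "(\<lambda>\<omega>. - f \<omega>) \<in> measurable M (count_space UNIV)"
      if "f \<in> measurable M (count_space UNIV)" for f :: "'a \<Rightarrow> int"
      by (rule measurable_compose[OF that]) simp
    show "V' i \<in> measurable M (count_space UNIV)" for i
      unfolding V'[abs_def] using W by (intro neg) (auto simp: swap_walk_def)
    show "(\<lambda>\<omega>. - X n \<omega>) \<in> measurable M (count_space UNIV)" for n
      by (intro neg X_meas)
    show "AE \<omega> in M. - X 0 \<omega> = - x0" using X_0 by simp
    fix n j
    have "AE \<omega> in M. real_cond_exp M (walk_history M V X n) (indicator {\<omega>' \<in> space M. X (Suc n) \<omega>' = - j}) \<omega>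
        = swap_trans p (\<lambda>i. V i \<omega>) (X n \<omega>) (- j)"
      using W unfolding swap_walk_def by blast
    moreover have "{\<omega>' \<in> space M. X (Suc n) \<omega>' = - j} = {\<omega>' \<in> space M. - X (Suc n) \<omega>' = j}" by auto
    \<comment> \<open>Relies on the sites taking only the values 1 and -1: \<open>swap_trans\<close>
      tests for 1 alone, and only then does negating the site swap the two probabilities.\<close>
    moreover have "swap_trans p (\<lambda>i. V i \<omega>) (X n \<omega>) (- j) = swap_trans p (\<lambda>i. V' i \<omega>) (- X n \<omega>) j" for \<omega>
      using V1[of "X n \<omega>" \<omega>] by (auto simp: swap_trans_def V')
    ultimately show "AE \<omega> in M. real_cond_exp M (walk_history M V X n) (indicator {\<omega>' \<in> space M. - X (Suc n) \<omega>' = j}) \<omega>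
        = swap_trans p (\<lambda>i. V' i \<omega>) (- X n \<omega>) j" by simp
  qed
  interpret R: bernoulli_bits M "1 - a" "\<lambda>i \<omega>. \<not> b (2 - i) \<omega>"
    by (rule reindex(2)) (auto simp: inj_def)
  show ?thesis
    by unfold_locales (use a01 p01' W' in \<open>simp_all add: V'_def[abs_def]\<close>)
qed

end

section \<open>Classification of the regimes and the theorem\<close>

lemma moving_avg_eq_maj_env: "moving_avg Uh i \<omega> = maj_env (\<lambda>j. Uh j \<omega> = 1) i"
proof -
  have ins: "{k \<in> insert x S. P k} = (if P x then insert x {k \<in> S. P k} else {k \<in> S. P k})"
    for x :: int and S P by auto
  have "card {k \<in> {i, i + 1, i + 2}. Uh k \<omega> = 1} \<ge> 2 \<longleftrightarrow> maj (Uh i \<omega> = 1) (Uh (i + 1) \<omega> = 1) (Uh (i + 2) \<omega> = 1)"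
    unfolding ins maj_def by (simp add: card_insert_if)
  thus ?thesis by (simp add: moving_avg_def maj_env_def)
qed

lemma limsup_eq_top_of_unbounded:
  fixes x :: "nat \<Rightarrow> int"
  assumes "\<forall>c. \<exists>n. x n \<ge> c"
  shows "limsup (\<lambda>n. ereal (real_of_int (x n))) = \<infinity>"
proof (rule ccontr)
  assume "\<not> ?thesis"
  hence "limsup (\<lambda>n. ereal (real_of_int (x n))) < \<infinity>" by simp
  then obtain k :: nat where "limsup (\<lambda>n. ereal (real_of_int (x n))) < ereal (real k)"
    using less_PInf_Ex_of_nat by auto
  then obtain C where "limsup (\<lambda>n. ereal (real_of_int (x n))) < ereal C" ..
  hence "eventually (\<lambda>n. ereal (real_of_int (x n)) < ereal C) sequentially"
    by (rule Limsup_lessD)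
  then obtain N where N: "\<And>n. n \<ge> N \<Longrightarrow> real_of_int (x n) < C"
    by (auto simp: eventually_sequentially)
  \<comment> \<open>Bounds the eventual values by \<open>C\<close> and the finitely many earlier
    ones by their maximum.\<close>
  define K where "K = max \<lceil>C\<rceil> (Max (x ` {..N}))"
  have "x n \<le> K" for n
  proof (cases "n \<ge> N")
    case True
    thus ?thesis using N[of n] unfolding K_def by linarith
  next
    case False
    hence "x n \<le> Max (x ` {..N})" by (intro Max_ge) auto
    thus ?thesis by (simp add: K_def)
  qed
  moreover obtain n where "x n \<ge> K + 1" using assms by blast
  ultimately show False by (metis add_le_same_cancel1 not_one_le_zero order.trans)
qed

lemma liminf_eq_bot_of_unbounded:
  fixes x :: "nat \<Rightarrow> int"
  assumes "\<forall>c. \<exists>n. - x n \<ge> c"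
  shows "liminf (\<lambda>n. ereal (real_of_int (x n))) = - \<infinity>"
proof -
  have "limsup (\<lambda>n. ereal (real_of_int (- x n))) = \<infinity>"
    by (rule limsup_eq_top_of_unbounded[OF assms])
  thus ?thesis
    using ereal_Liminf_uminus[of sequentially "\<lambda>n. ereal (real_of_int (- x n))"] by simp
qed

lemma cutoff_root_sigma_cutoff:
  assumes "0 < a" "a < 1" "a \<noteq> 1/2"
  shows "\<exists>!s. cutoff_root a s" "cutoff_root a (sigma_cutoff a)"
proof -
  show ex: "\<exists>!s. cutoff_root a s"
    using sigma_cutoff_gt(1)[of a] sigma_cutoff_lt(1)[of a] assms by (cases "a > 1/2") auto
  show "cutoff_root a (sigma_cutoff a)"
    unfolding sigma_cutoff_def using theI'[OF ex] assms(3) by simp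
qed

lemma sigma_cutoff_pos:
  assumes "0 < a" "a < 1"
  shows "sigma_cutoff a > 0"
  using cutoff_root_sigma_cutoff(2)[OF assms] by (cases "a = 1/2") (auto simp: sigma_cutoff_def cutoff_root_def)

lemma p_cutoff_bounds:
  assumes "0 < a" "a < 1"
  shows "0 < p_cutoff a" "p_cutoff a < 1" "p_cutoff a > 1/2 \<longleftrightarrow> a > 1/2" "p_cutoff a < 1/2 \<longleftrightarrow> a < 1/2"
proof -
  note pos = sigma_cutoff_pos[OF assms]
  have e: "p_cutoff a = 1 / (1 + sigma_cutoff a)" by (simp add: p_cutoff_def inverse_eq_divide)
  show "0 < p_cutoff a" "p_cutoff a < 1" unfolding e using pos by auto
  have "p_cutoff a > 1/2 \<longleftrightarrow> sigma_cutoff a < 1" "p_cutoff a < 1/2 \<longleftrightarrow> sigma_cutoff a > 1"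
    unfolding e using pos by (auto simp: field_simps)
  moreover have "a > 1/2 \<Longrightarrow> sigma_cutoff a < 1" "a < 1/2 \<Longrightarrow> sigma_cutoff a > 1" "a = 1/2 \<Longrightarrow> sigma_cutoff a = 1"
    using sigma_cutoff_gt(3)[of a] sigma_cutoff_lt(2)[of a] assms by (auto simp: sigma_cutoff_def)
  ultimately show "p_cutoff a > 1/2 \<longleftrightarrow> a > 1/2" "p_cutoff a < 1/2 \<longleftrightarrow> a < 1/2"
    by (cases rule: linorder_cases[of a "1/2"]; linarith)+
qed

text \<open>The mirror symmetry of the cutoff function makes the root for \<open>1 - a\<close> the
  reciprocal of the root for \<open>a\<close>.\<close>

lemma p_cutoff_mirror:
  assumes "0 < a" "a < 1"
  shows "p_cutoff (1 - a) = 1 - p_cutoff a"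
proof -
  have eq: "sigma_cutoff (1 - a) = 1 / sigma_cutoff a"
  proof (cases "a = 1/2")
    case False
    have r: "cutoff_root a (sigma_cutoff a)" using cutoff_root_sigma_cutoff(2)[OF assms False] .
    hence "cutoff_root (1 - a) (1 / sigma_cutoff a)"
      using cutoff_fun_mirror[of "1 / sigma_cutoff a" a] by (auto simp: cutoff_root_def)
    thus ?thesis
      using cutoff_root_sigma_cutoff[of "1 - a"] assms False by (metis add_diff_cancel_left' diff_add_cancel
        diff_gt_0_iff_gt diff_less_eq less_add_same_cancel1 field_sum_of_halves)
  qed (simp add: sigma_cutoff_def)
  show ?thesis unfolding p_cutoff_def eq using sigma_cutoff_pos[OF assms] by (simp add: field_simps)
qed

lemma cutoff_fun_pos_iff_regime:
  assumes a: "0 < a" "a < 1" and p: "0 < p" "p < 1"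
  shows "cutoff_fun a ((1 - p) / p) > 0 \<longleftrightarrow> regime_1a a p"
proof -
  define s where "s = (1 - p) / p"
  have s: "s > 0" using p by (simp add: s_def)
  note pos = sigma_cutoff_pos[OF a]
  have s1: "s < 1 \<longleftrightarrow> p > 1/2" "1 < s \<longleftrightarrow> p < 1/2" using p by (auto simp: s_def field_simps)
  have e: "p_cutoff a = 1 / (1 + sigma_cutoff a)" by (simp add: p_cutoff_def inverse_eq_divide)
  have sc: "sigma_cutoff a < s \<longleftrightarrow> p < p_cutoff a" "s < sigma_cutoff a \<longleftrightarrow> p_cutoff a < p"
    using p pos by (auto simp: s_def e field_simps)
  consider "a > 1/2" | "a = 1/2" | "a < 1/2" by linarith
  thus ?thesis unfolding s_def[symmetric]
  proof cases
    case 1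
    thus "cutoff_fun a s > 0 \<longleftrightarrow> regime_1a a p"
      using sigma_cutoff_gt(4)[OF 1 a(2)] s s1 sc by (auto simp: regime_1a_def)
  next
    case 2
    have "cutoff_fun a s \<le> 0" unfolding 2 by (rule cutoff_fun_half_le[OF s])
    with 2 show "cutoff_fun a s > 0 \<longleftrightarrow> regime_1a a p" by (simp add: regime_1a_def)
  next
    case 3
    thus "cutoff_fun a s > 0 \<longleftrightarrow> regime_1a a p"
      using sigma_cutoff_lt(4)[OF a(1) 3] s s1 sc by (auto simp: regime_1a_def)
  qed
qed

text \<open>Turns the speed of the reflected walk, which has parameters \<open>1 - a\<close> and
  \<open>p\<close>, into the expression of the theorem for the left direction.\<close>

lemma drift_mirror: "drift (1 - a) p = drift a (1 - p)"
proof -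
  have "drift_num (1 - a) p = drift_num a (1 - p)" unfolding drift_num_def by algebra
  moreover have "drift_den (1 - a) p = drift_den a (1 - p)" unfolding drift_den_def by algebra
  ultimately show ?thesis by (simp add: drift_def)
qed

lemma tendsto_zero_of_bounds:
  fixes x :: "nat \<Rightarrow> int"
  assumes "\<forall>d>0::real. eventually (\<lambda>n. real_of_int (x n) \<le> d * real n) sequentially"
    and "\<forall>d>0::real. eventually (\<lambda>n. real_of_int (- x n) \<le> d * real n) sequentially"
  shows "(\<lambda>n. real_of_int (x n) / real n) \<longlonglongrightarrow> 0"
proof (rule tendstoI)
  fix e :: real assume e: "e > 0"
  have "eventually (\<lambda>n. real_of_int (x n) \<le> e / 2 * real n) sequentially"
    "eventually (\<lambda>n. real_of_int (- x n) \<le> e / 2 * real n) sequentially"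
    by (rule assms(1)[rule_format] assms(2)[rule_format], use e in simp)+
  thus "eventually (\<lambda>n. dist (real_of_int (x n) / real n) 0 < e) sequentially"
    using eventually_gt_at_top[of 0]
  proof eventually_elim
    case (elim n)
    hence "\<bar>real_of_int (x n)\<bar> \<le> e / 2 * real n" by (simp add: abs_le_iff)
    also have "\<dots> < e * real n" using e elim by simp
    finally show ?case using elim by (simp add: dist_real_def abs_divide divide_less_eq)
  qed
qed

lemma regimes_mirror:
  assumes "0 < a" "a < 1"
  shows "regime_1a (1 - a) p \<longleftrightarrow> regime_1b a p" "regime_2a (1 - a) p \<longleftrightarrow> regime_2b a p"
  unfolding regime_1a_def regime_1b_def regime_2a_def regime_2b_def p_cutoff_mirror[OF assms]
  by (auto simp: not_less)

lemma regimes_classified: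
  assumes a: "0 < a" "a < 1" and p: "0 < p" "p < 1"
  shows "regime_1a a p \<or> regime_2a a p \<longleftrightarrow> a > 1/2 \<and> p > 1/2 \<or> a < 1/2 \<and> p < 1/2"
    and "regime_1b a p \<or> regime_2b a p \<longleftrightarrow> a > 1/2 \<and> p < 1/2 \<or> a < 1/2 \<and> p > 1/2"
    and "regime_1a a p \<Longrightarrow> \<not> regime_2a a p" "regime_1b a p \<Longrightarrow> \<not> regime_2b a p"
  using p_cutoff_bounds[OF a] p unfolding regime_1a_def regime_1b_def regime_2a_def regime_2b_def
  by auto

theorem theorem3p4:
  fixes M :: "'a measure"
    and \<alpha> p :: real
    and x0 :: int
    and Uh :: "int \<Rightarrow> 'a \<Rightarrow> int"
    and X :: "nat \<Rightarrow> 'a \<Rightarrow> int"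
  assumes "prob_space M"
    and "0 < \<alpha>" "\<alpha> < 1"
    and "0 < p" "p < 1"
    and "iid_signs M \<alpha> Uh"
    and "swap_walk M p x0 (moving_avg Uh) X"
  shows "(\<alpha> \<noteq> 1/2 \<longrightarrow> (\<exists>!\<sigma>. cutoff_root \<alpha> \<sigma>)) \<and>
    (p_cutoff \<alpha> > 1/2 \<longleftrightarrow> \<alpha> > 1/2) \<and>
    (\<exists>V::real.
      (AE \<omega> in M. (\<lambda>n. real_of_int (X n \<omega>) / real n) \<longlonglongrightarrow> V) \<and>
      (regime_1a \<alpha> p \<longrightarrow>
        (AE \<omega> in M. filterlim (\<lambda>n. X n \<omega>) at_top sequentially) \<and>
        V = drift \<alpha> p \<and> drift \<alpha> p > 0) \<and>
      (regime_1b \<alpha> p \<longrightarrow>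
        (AE \<omega> in M. filterlim (\<lambda>n. X n \<omega>) at_bot sequentially) \<and>
        V = - drift \<alpha> (1 - p) \<and> - drift \<alpha> (1 - p) < 0) \<and>
      (regime_2a \<alpha> p \<longrightarrow>
        (AE \<omega> in M. filterlim (\<lambda>n. X n \<omega>) at_top sequentially) \<and> V = 0) \<and>
      (regime_2b \<alpha> p \<longrightarrow>
        (AE \<omega> in M. filterlim (\<lambda>n. X n \<omega>) at_bot sequentially) \<and> V = 0) \<and>
      (\<not> (regime_1a \<alpha> p \<or> regime_1b \<alpha> p \<or> regime_2a \<alpha> p \<or> regime_2b \<alpha> p)
         \<longleftrightarrow> \<alpha> = 1/2 \<or> p = 1/2) \<and>
      (\<alpha> = 1/2 \<or> p = 1/2 \<longrightarrow>
        (AE \<omega> in M. liminf (\<lambda>n. ereal (real_of_int (X n \<omega>))) = - \<infinity> \<and>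
                    limsup (\<lambda>n. ereal (real_of_int (X n \<omega>))) = \<infinity>) \<and> V = 0))"
proof -
  note a = assms(2,3) and p = assms(4,5)
  interpret prob_space M by (rule assms(1))
  define b where "b i \<omega> \<longleftrightarrow> Uh i \<omega> = 1" for i \<omega>
  have U_eq: "moving_avg Uh = (\<lambda>i \<omega>. maj_env (\<lambda>j. b j \<omega>) i)"
    by (simp add: fun_eq_iff moving_avg_eq_maj_env b_def)
  have "indep_vars (\<lambda>_. count_space UNIV) Uh UNIV" and Uh1: "prob {\<omega> \<in> space M. Uh i \<omega> = 1} = \<alpha>" for i
    using assms(6) unfolding iid_signs_def by blast+
  hence "indep_vars (\<lambda>_. count_space UNIV) (\<lambda>i \<omega>. Uh i \<omega> = 1) UNIV"
    by (intro indep_vars_compose2[where Y = "\<lambda>_ z. z = 1" and M' = "\<lambda>_. count_space UNIV"]) simp_all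
  hence ind: "indep_vars (\<lambda>_. count_space UNIV) b UNIV" by (simp add: b_def[abs_def])
  interpret W: maj_walk M \<alpha> b p x0 X
    by unfold_locales (use ind Uh1 a p assms(7) in \<open>simp_all add: b_def[symmetric] U_eq\<close>)
  interpret R: maj_walk M "1 - \<alpha>" "\<lambda>i \<omega>. \<not> b (2 - i) \<omega>" p "- x0" "\<lambda>n \<omega>. - X n \<omega>"
    by (rule W.reflected)
  have a': "0 < 1 - \<alpha>" "1 - \<alpha> < 1" using a by auto
  have F: "cutoff_fun \<alpha> W.\<sigma> > 0 \<longleftrightarrow> regime_1a \<alpha> p"
    unfolding W.\<sigma>_def by (rule cutoff_fun_pos_iff_regime[OF a p])
  have F': "cutoff_fun (1 - \<alpha>) R.\<sigma> > 0 \<longleftrightarrow> regime_1b \<alpha> p"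
    unfolding R.\<sigma>_def regimes_mirror(1)[OF a, symmetric] by (rule cutoff_fun_pos_iff_regime[OF a' p])
  have s1: "W.\<sigma> < 1 \<longleftrightarrow> p > 1/2" "W.\<sigma> > 1 \<longleftrightarrow> p < 1/2" "W.\<sigma> = 1 \<longleftrightarrow> p = 1/2"
    using p unfolding W.\<sigma>_def by (auto simp: field_simps)
  note cls = regimes_classified[OF a p]
  \<comment> \<open>\<open>P\<close> and \<open>Q\<close> mark the sides of the two critical lines
    on which the walk moves to the right and to the left; together they exhaust everything off these
    lines.\<close>
  define P Q where "P \<longleftrightarrow> \<alpha> > 1/2 \<and> p > 1/2 \<or> \<alpha> < 1/2 \<and> p < 1/2"
    and "Q \<longleftrightarrow> \<alpha> > 1/2 \<and> p < 1/2 \<or> \<alpha> < 1/2 \<and> p > 1/2"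
  have PQ: "\<not> (P \<and> Q)" "P \<or> Q \<longleftrightarrow> \<not> (\<alpha> = 1/2 \<or> p = 1/2)"
    unfolding P_def Q_def
    by (cases rule: linorder_cases[of \<alpha> "1/2"]; cases rule: linorder_cases[of p "1/2"]; simp)+
  have cls12: "regime_1a \<alpha> p \<or> regime_2a \<alpha> p \<longleftrightarrow> P" "regime_1b \<alpha> p \<or> regime_2b \<alpha> p \<longleftrightarrow> Q"
    unfolding P_def Q_def by (rule cls)+
  have excl: "\<not> (regime_1a \<alpha> p \<and> regime_1b \<alpha> p)" "\<not> (regime_1a \<alpha> p \<and> regime_2b \<alpha> p)"
    "\<not> (regime_1b \<alpha> p \<and> regime_2a \<alpha> p)"
    "\<alpha> = 1/2 \<or> p = 1/2 \<Longrightarrow> \<not> regime_1a \<alpha> p \<and> \<not> regime_1b \<alpha> p"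
    using cls12 PQ by blast+
  have up: "AE \<omega> in M. filterlim (\<lambda>n. X n \<omega>) at_top sequentially" if "regime_1a \<alpha> p \<or> regime_2a \<alpha> p"
  proof (rule W.drift_to_right)
    show "\<alpha> > 1/2 \<and> W.\<sigma> < 1 \<or> \<alpha> < 1/2 \<and> W.\<sigma> > 1"
      using that cls12(1) unfolding s1 P_def by blast
  qed
  have down: "AE \<omega> in M. filterlim (\<lambda>n. X n \<omega>) at_bot sequentially" if "regime_1b \<alpha> p \<or> regime_2b \<alpha> p"
  proof -
    have "AE \<omega> in M. filterlim (\<lambda>n. - X n \<omega>) at_top sequentially"
    proof (rule R.drift_to_right)
      have "\<alpha> > 1/2 \<and> W.\<sigma> > 1 \<or> \<alpha> < 1/2 \<and> W.\<sigma> < 1"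
        using that cls12(2) unfolding s1 Q_def by blast
      thus "1 - \<alpha> > 1/2 \<and> R.\<sigma> < 1 \<or> 1 - \<alpha> < 1/2 \<and> R.\<sigma> > 1" by argo
    qed
    thus ?thesis
    proof eventually_elim
      case (elim \<omega>)
      show ?case unfolding filterlim_at_bot
      proof
        fix z
        from elim have "eventually (\<lambda>n. - z \<le> - X n \<omega>) sequentially"
          unfolding filterlim_at_top by (rule spec)
        thus "eventually (\<lambda>n. X n \<omega> \<le> z) sequentially" by simp
      qed
    qed
  qed
  have d: "drift \<alpha> p > 0" if "regime_1a \<alpha> p"
    using prod_mean_summable_iff(2)[OF a p] F that unfolding W.\<sigma>_def by blast
  have d': "drift \<alpha> (1 - p) > 0" if "regime_1b \<alpha> p"
    using prod_mean_summable_iff(2)[OF a' p] F' that unfolding R.\<sigma>_def drift_mirror by blast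
  define V where "V = (if regime_1a \<alpha> p then drift \<alpha> p else if regime_1b \<alpha> p then - drift \<alpha> (1 - p) else 0)"
  have V: "AE \<omega> in M. (\<lambda>n. real_of_int (X n \<omega>) / real n) \<longlonglongrightarrow> V"
  proof -
    consider "regime_1a \<alpha> p" | "regime_1b \<alpha> p" "\<not> regime_1a \<alpha> p" | "\<not> regime_1a \<alpha> p" "\<not> regime_1b \<alpha> p" by blast
    thus ?thesis
    proof cases
      case 1
      thus ?thesis using W.speed_pos F by (simp add: V_def)
    next
      case 2
      have "AE \<omega> in M. (\<lambda>n. real_of_int (- X n \<omega>) / real n) \<longlonglongrightarrow> drift \<alpha> (1 - p)"
        using R.speed_pos F' 2(1) unfolding drift_mirror by simp
      thus ?thesis
      proof eventually_elim
        case (elim \<omega>)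
        from tendsto_minus[OF elim] show ?case using 2 by (simp add: V_def)
      qed
    next
      case 3
      \<comment> \<open>Neither the walk nor its reflection has a positive cutoff value, so both
        upper bounds are 0 and pinch the speed.\<close>
      have "AE \<omega> in M. \<forall>d>0::real. eventually (\<lambda>n. real_of_int (X n \<omega>) \<le> d * real n) sequentially"
        by (rule W.speed_nonpos) (use F 3 in simp)
      moreover have "AE \<omega> in M. \<forall>d>0::real. eventually (\<lambda>n. real_of_int (- X n \<omega>) \<le> d * real n) sequentially"
        by (rule R.speed_nonpos) (use F' 3 in simp)
      ultimately show ?thesis
      proof eventually_elim
        case (elim \<omega>)
        from tendsto_zero_of_bounds[OF elim] show ?case using 3 by (simp add: V_def)
      qed
    qed
  qed
  have rec: "AE \<omega> in M. liminf (\<lambda>n. ereal (real_of_int (X n \<omega>))) = - \<infinity> \<and>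
      limsup (\<lambda>n. ereal (real_of_int (X n \<omega>))) = \<infinity>" if "\<alpha> = 1/2 \<or> p = 1/2"
  proof -
    have "AE \<omega> in M. \<forall>c. \<exists>n. X n \<omega> \<ge> c"
      by (rule W.unbounded_above) (use that s1 in auto)
    moreover have "AE \<omega> in M. \<forall>c. \<exists>n. - X n \<omega> \<ge> c"
      by (rule R.unbounded_above) (use that s1 in auto)
    ultimately show ?thesis
    proof eventually_elim
      case (elim \<omega>)
      show ?case
        by (intro conjI liminf_eq_bot_of_unbounded[OF elim(2)] limsup_eq_top_of_unbounded[OF elim(1)])
    qed
  qed
  have none: "\<not> (regime_1a \<alpha> p \<or> regime_1b \<alpha> p \<or> regime_2a \<alpha> p \<or> regime_2b \<alpha> p)
         \<longleftrightarrow> \<alpha> = 1/2 \<or> p = 1/2"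
    using cls12 PQ(2) by blast
  show ?thesis
  proof (intro conjI impI exI[of _ V] V none)
    show "\<exists>!\<sigma>. cutoff_root \<alpha> \<sigma>" if "\<alpha> \<noteq> 1/2" by (rule cutoff_root_sigma_cutoff(1)[OF a that])
    show "p_cutoff \<alpha> > 1/2 \<longleftrightarrow> \<alpha> > 1/2" by (rule p_cutoff_bounds(3)[OF a])
    show "V = drift \<alpha> p" if "regime_1a \<alpha> p" using that by (simp add: V_def)
    show "V = - drift \<alpha> (1 - p)" if "regime_1b \<alpha> p" using that excl(1) by (auto simp: V_def)
    show "V = 0" if "regime_2a \<alpha> p" using that cls(3) excl(3) by (auto simp: V_def)
    show "V = 0" if "regime_2b \<alpha> p" using that cls(4) excl(2) by (auto simp: V_def)
    show "V = 0" if "\<alpha> = 1/2 \<or> p = 1/2" using excl(4)[OF that] by (simp add: V_def)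
    show "AE \<omega> in M. filterlim (\<lambda>n. X n \<omega>) at_top sequentially" if "regime_1a \<alpha> p" using up that by blast
    show "AE \<omega> in M. filterlim (\<lambda>n. X n \<omega>) at_bot sequentially" if "regime_1b \<alpha> p" using down that by blast
    show "AE \<omega> in M. filterlim (\<lambda>n. X n \<omega>) at_top sequentially" if "regime_2a \<alpha> p" using up that by blast
    show "AE \<omega> in M. filterlim (\<lambda>n. X n \<omega>) at_bot sequentially" if "regime_2b \<alpha> p" using down that by blast
    show "drift \<alpha> p > 0" if "regime_1a \<alpha> p" using d[OF that] .
    show "- drift \<alpha> (1 - p) < 0" if "regime_1b \<alpha> p" using d'[OF that] by simp
    show "AE \<omega> in M. liminf (\<lambda>n. ereal (real_of_int (X n \<omega>))) = - \<infinity> \<and>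
      limsup (\<lambda>n. ereal (real_of_int (X n \<omega>))) = \<infinity>" if "\<alpha> = 1/2 \<or> p = 1/2"
      by (rule rec[OF that])
  qed
qed

end
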